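(* Let $G$ be a group and let $H\le G$. Assume that $G$ is finitely generated relative to $H$, i.e. $G=\langle X\cup H\rangle$ for some finite $X\subseteq G$. Then the following conditions are equivalent. (a) The extension problem for the pair $H\le G$ is solvable. (b) For every $A\in\mathcal A(H)$, $\mathrm{Ind}(A)$ is an extension of $A$. (c) The subgroup $H$ is incompressible in $G$.
   Context: Conventions. All group actions on metric spaces are by isometries. An arbitrary cardinal $c\ge 2^{\aleph_0}$ is fixed and all metric spaces are assumed to have cardinality at most $c$. Graphs carry the combinatorial metric (edges of length $1$). Generating sets and sets used to form Cayley graphs are symmetric. Extensions. A map $f\colon R\to S$ between metric spaces with $H$-actions is coarsely $H$-equivariant if $\sup_{h\in H} d_S(f(hx),hf(x))<\infty$ for every $x\in R$. It is a quasi-isometric embedding if there is $C$ with $\frac1C d_R(x,y)-C\le d_S(f(x),f(y))\le C d_R(x,y)+C$ for all $x,y\in R$, and a quasi-isometry if in addition $S$ is contained in the $\varepsilon$-neighborhood of $f(R)$ for some constant $\varepsilon$. For $H\le G$, an action of $G$ on a metric space $S$ is an extension of an action of $H$ on a metric space $R$ if there is a coarsely $H$-equivariant quasi-isometric embedding $R\to S$. The extension problem is solvable for $H\le G$ if every action of $H$ on a metric space has an extension to an action of $G$ on some metric space. Equivalence classes. Two actions of a group $G$ on metric spaces $R$, $S$ are equivalent if there is a coarsely $G$-equivariant quasi-isometry $R\to S$. $\mathcal A(G)$ is the set of equivalence classes of actions of $G$ on geodesic metric spaces. $B\in\mathcal A(G)$ is an extension of $A\in\mathcal A(H)$ if some (equivalently,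 any) action in $B$ is an extension of some (equivalently, any) action in $A$. Induced action. Let $X\subseteq G$ with $G=\langle X\cup H\rangle$, and let $A\in\mathcal A(H)$. Every class $A$ contains an action of $H$ on a connected graph $R$ by graph automorphisms that is free on the vertex set $V(R)$. Fix such an action, a vertex $b\in V(R)$, and a map $t\colon G\to G$ choosing a representative $t(g)\in gH$ of each left coset (so $t(g)$ depends only on $gH$) with $t(h)=1$ for $h\in H$. Let $Y=G/H\times R$, a disjoint union of copies of $R$, with $G$-action $g(aH,r)=(gaH,\,t(ga)^{-1}g\,t(a)\,r)$. Let $S$ be the graph obtained from the disjoint union of the (possibly disconnected) Cayley graph $\Gamma(G,X)$ and $Y$ by identifying the vertex $g(H,b)$ of $Y$ with the vertex $g$ of $\Gamma(G,X)$ for all $g\in G$. $S$ is connected and the $G$-actions on $\Gamma(G,X)$ and $Y$ induce an action of $G$ on $S$. Its equivalence class is denoted $\mathrm{Ind}_X(A)\in\mathcal A(G)$; it is independent of the choices of $R$, $b$, $t$, and of $X$ among finite relative generating sets. For $X$ finite it is denoted $\mathrm{Ind}(A)$. Incompressibility. Let $\mathcal M(H)$ be the set of left invariant metrics on $H$ with values in $\mathbb N\cup\{0\}$. For $d_H\in\mathcal M(H)$ and a symmetric subset $X\subseteq G$ with $G=\langle X\cup H\rangle$ put $w(1)=0$; $w(g)=1$ if $g\in X\setminus\{1\}$; $w(g)=d_H(1,g)$ if $g\in H\setminus X$, $g\neq 1$; and $w(g)=\infty$ otherwise. The induced metric on $G$ is $d_{\{d_H\},X}(f,g)=\min\{\sum_{i=1}^k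 w(x_i)\mid x_1,\dots,x_k\in G,\ x_1\cdots x_k=f^{-1}g\}$. $H$ is incompressible in $G$ with respect to $X$ if for every $d_H\in\mathcal M(H)$ the inclusion is a quasi-isometric embedding $(H,d_H)\to(G,d_{\{d_H\},X})$. When $G$ is finitely generated relative to $H$, $H$ is incompressible in $G$ if it is so with respect to some (equivalently, any) finite relative generating set $X$, i.e. finite symmetric $X\subseteq G$ with $G=\langle X\cup H\rangle$. *)

theory Defs
  imports
    "HOL-Algebra.Group_Action"
    "HOL-Algebra.Left_Coset"
    "HOL-Algebra.Generated_Groups"
    "HOL-Analysis.Abstract_Metric_Spaces"
    "HOL-Library.Extended_Nat"
    "HOL-Library.Equipollence"
begin

section \<open>Isometric actions on metric spaces\<close>

text \<open>
  The cardinal $c$ bounding all metric spaces is the cardinality of a type \<open>'m\<close>: a metric space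
  of cardinality at most $c$ is, up to isometry, one whose set of points is a subset of \<open>'m\<close>.
  Quantification over all metric spaces is therefore quantification over \<open>('g, 'm) isoact\<close>.
  Other point types occur only for the concrete spaces constructed below.

  The subgroup \<open>H\<close> as a group in its own right is \<open>G\<lparr>carrier := H\<rparr>\<close>.
\<close>

record ('g, 'p) isoact =
  points :: "'p set"
  metric :: "'p \<Rightarrow> 'p \<Rightarrow> real"
  act :: "'g \<Rightarrow> 'p \<Rightarrow> 'p"

text \<open>Metric spaces that are acted on are understood to be nonempty.\<close>

definition isometric_action :: "'g monoid \<Rightarrow> ('g, 'p) isoact \<Rightarrow> bool" where
  "isometric_action G R \<longleftrightarrow>
     points R \<noteq> {} \<and> Metric_space (points R) (metric R) \<and>
     group_action G (points R) (act R) \<and>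
     (\<forall>g\<in>carrier G. \<forall>x\<in>points R. \<forall>y\<in>points R. metric R (act R g x) (act R g y) = metric R x y)"

definition geodesic_space :: "'p set \<Rightarrow> ('p \<Rightarrow> 'p \<Rightarrow> real) \<Rightarrow> bool" where
  "geodesic_space M d \<longleftrightarrow>
     Metric_space M d \<and>
     (\<forall>x\<in>M. \<forall>y\<in>M. \<exists>\<gamma>. \<gamma> \<in> {0..d x y} \<rightarrow> M \<and> \<gamma> 0 = x \<and> \<gamma> (d x y) = y \<and>
        (\<forall>s\<in>{0..d x y}. \<forall>t\<in>{0..d x y}. d (\<gamma> s) (\<gamma> t) = \<bar>s - t\<bar>))"

definition geodesic_action :: "'g monoid \<Rightarrow> ('g, 'p) isoact \<Rightarrow> bool" where
  "geodesic_action G R \<longleftrightarrow> isometric_action G R \<and> geodesic_space (points R) (metric R)"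


section \<open>Quasi-isometries and extensions of actions\<close>

definition qi_embedding ::
    "'p set \<Rightarrow> ('p \<Rightarrow> 'p \<Rightarrow> real) \<Rightarrow> 'q set \<Rightarrow> ('q \<Rightarrow> 'q \<Rightarrow> real) \<Rightarrow> ('p \<Rightarrow> 'q) \<Rightarrow> bool" where
  "qi_embedding M d M' d' f \<longleftrightarrow>
     f \<in> M \<rightarrow> M' \<and>
     (\<exists>C>0. \<forall>x\<in>M. \<forall>y\<in>M. 1 / C * d x y - C \<le> d' (f x) (f y) \<and> d' (f x) (f y) \<le> C * d x y + C)"

definition quasi_isometry ::
    "'p set \<Rightarrow> ('p \<Rightarrow> 'p \<Rightarrow> real) \<Rightarrow> 'q set \<Rightarrow> ('q \<Rightarrow> 'q \<Rightarrow> real) \<Rightarrow> ('p \<Rightarrow> 'q) \<Rightarrow> bool" where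
  "quasi_isometry M d M' d' f \<longleftrightarrow>
     qi_embedding M d M' d' f \<and> (\<exists>\<epsilon>. \<forall>y\<in>M'. \<exists>x\<in>M. d' y (f x) \<le> \<epsilon>)"

definition coarsely_equivariant ::
    "'g set \<Rightarrow> ('g, 'p) isoact \<Rightarrow> ('g, 'q) isoact \<Rightarrow> ('p \<Rightarrow> 'q) \<Rightarrow> bool" where
  "coarsely_equivariant H R S f \<longleftrightarrow>
     (\<forall>x\<in>points R. bdd_above ((\<lambda>h. metric S (f (act R h x)) (act S h (f x))) ` H))"

definition is_extension :: "'g set \<Rightarrow> ('g, 'p) isoact \<Rightarrow> ('g, 'q) isoact \<Rightarrow> bool" where
  "is_extension H R S \<longleftrightarrow>
     (\<exists>f. coarsely_equivariant H R S f \<and>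
          qi_embedding (points R) (metric R) (points S) (metric S) f)"

definition extension_problem_solvable :: "'m itself \<Rightarrow> 'g monoid \<Rightarrow> 'g set \<Rightarrow> bool" where
  "extension_problem_solvable (_ :: 'm itself) G H \<longleftrightarrow>
     (\<forall>R :: ('g, 'm) isoact. isometric_action (G\<lparr>carrier := H\<rparr>) R \<longrightarrow>
        (\<exists>S :: ('g, 'm) isoact. isometric_action G S \<and> is_extension H R S))"


section \<open>Equivalence classes of actions on geodesic spaces\<close>

definition equivalent_actions :: "'g monoid \<Rightarrow> ('g, 'p) isoact \<Rightarrow> ('g, 'q) isoact \<Rightarrow> bool" where
  "equivalent_actions G R S \<longleftrightarrow>
     (\<exists>f. coarsely_equivariant (carrier G) R S f \<and>
          quasi_isometry (points R) (metric R) (points S) (metric S) f)"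

text \<open>
  The class of an action \<open>R\<close> consists of actions on subsets of \<open>'m\<close>, but \<open>R\<close> itself may live on any
  type of points, so that the class of a concretely constructed action makes sense.
\<close>

definition action_class :: "'g monoid \<Rightarrow> ('g, 'p) isoact \<Rightarrow> ('g, 'm) isoact set" where
  "action_class G R = {S. geodesic_action G S \<and> equivalent_actions G R S}"

definition action_classes :: "'g monoid \<Rightarrow> ('g, 'm) isoact set set" where
  "action_classes G = action_class G ` {R :: ('g, 'm) isoact. geodesic_action G R}"

definition class_extension :: "'g set \<Rightarrow> ('g, 'm) isoact set \<Rightarrow> ('g, 'm) isoact set \<Rightarrow> bool" where
  "class_extension H A B \<longleftrightarrow> (\<exists>R\<in>A. \<exists>S\<in>B. is_extension H R S)"


section \<open>Graphs as geodesic metric spaces\<close>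

text \<open>Graphs are simple: an edge is a two-element set of vertices.\<close>

definition simple_graph :: "'v set \<Rightarrow> 'v set set \<Rightarrow> bool" where
  "simple_graph V E \<longleftrightarrow> (\<forall>e\<in>E. e \<subseteq> V \<and> card e = 2)"

definition adjacency :: "'v set set \<Rightarrow> ('v \<times> 'v) set" where
  "adjacency E = {(u, v). {u, v} \<in> E}"

definition connected_simple_graph :: "'v set \<Rightarrow> 'v set set \<Rightarrow> bool" where
  "connected_simple_graph V E \<longleftrightarrow>
     simple_graph V E \<and> V \<noteq> {} \<and> (\<forall>u\<in>V. \<forall>v\<in>V. (u, v) \<in> (adjacency E)\<^sup>*)"

definition vertex_dist :: "'v set set \<Rightarrow> 'v \<Rightarrow> 'v \<Rightarrow> nat" where
  "vertex_dist E u v = (LEAST n. (u, v) \<in> adjacency E ^^ n)"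

text \<open>
  A point of a graph, with edges regarded as unit segments, is given by its barycentric coordinates:
  the vertex \<open>v\<close> is the indicator of \<open>{v}\<close>, and a point of the edge \<open>{u, v}\<close> at distance
  \<open>s\<close> from \<open>u\<close> takes the value \<open>1 - s\<close> at \<open>u\<close> and \<open>s\<close> at \<open>v\<close>.
\<close>

definition supp :: "('v \<Rightarrow> real) \<Rightarrow> 'v set" where
  "supp p = {v. p v \<noteq> 0}"

definition realization :: "'v set \<Rightarrow> 'v set set \<Rightarrow> ('v \<Rightarrow> real) set" where
  "realization V E =
     {p. (\<forall>v. 0 \<le> p v) \<and> ((\<exists>v\<in>V. supp p = {v}) \<or> supp p \<in> E) \<and> (\<Sum>v\<in>supp p. p v) = 1}"

text \<open>
  The path metric for edges of length 1. Two points \<open>p\<close>, \<open>q\<close> of a common edge \<open>{u, v}\<close> are at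
  distance \<open>\<bar>p u - q u\<bar> = \<bar>p v - q v\<bar>\<close>; otherwise a path from \<open>p\<close> to \<open>q\<close> leaves the cell of \<open>p\<close>
  through a vertex \<open>u\<close> at distance \<open>1 - p u\<close> and enters the cell of \<open>q\<close> through a vertex \<open>v\<close>
  at distance \<open>1 - q v\<close>. The value 0 off the realization is a dummy.
\<close>

definition graph_dist :: "'v set \<Rightarrow> 'v set set \<Rightarrow> ('v \<Rightarrow> real) \<Rightarrow> ('v \<Rightarrow> real) \<Rightarrow> real" where
  "graph_dist V E p q =
     (if p \<in> realization V E \<and> q \<in> realization V E then
        (if \<exists>e\<in>E. supp p \<subseteq> e \<and> supp q \<subseteq> e
         then (\<Sum>v\<in>supp p \<union> supp q. \<bar>p v - q v\<bar>) / 2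
         else Min ((\<lambda>(u, v). (1 - p u) + real (vertex_dist E u v) + (1 - q v)) ` (supp p \<times> supp q)))
      else 0)"

definition graph_automorphism_action ::
    "'g monoid \<Rightarrow> 'v set \<Rightarrow> 'v set set \<Rightarrow> ('g \<Rightarrow> 'v \<Rightarrow> 'v) \<Rightarrow> bool" where
  "graph_automorphism_action G V E \<phi> \<longleftrightarrow>
     group_action G V \<phi> \<and> (\<forall>g\<in>carrier G. \<forall>e\<in>E. \<phi> g ` e \<in> E)"

definition free_on_vertices :: "'g monoid \<Rightarrow> 'v set \<Rightarrow> ('g \<Rightarrow> 'v \<Rightarrow> 'v) \<Rightarrow> bool" where
  "free_on_vertices G V \<phi> \<longleftrightarrow> (\<forall>g\<in>carrier G. \<forall>v\<in>V. \<phi> g v = v \<longrightarrow> g = \<one>\<^bsub>G\<^esub>)"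

text \<open>The isometric action on the realization induced by an action \<open>\<phi>\<close> by graph automorphisms.\<close>

definition graph_action ::
    "'g monoid \<Rightarrow> 'v set \<Rightarrow> 'v set set \<Rightarrow> ('g \<Rightarrow> 'v \<Rightarrow> 'v) \<Rightarrow> ('g, 'v \<Rightarrow> real) isoact" where
  "graph_action G V E \<phi> =
     \<lparr>points = realization V E,
      metric = graph_dist V E,
      act = (\<lambda>g. \<lambda>p\<in>realization V E. \<lambda>v. if v \<in> V then p (\<phi> (inv\<^bsub>G\<^esub> g) v) else 0)\<rparr>"


section \<open>Induced actions\<close>

definition rel_gen_set :: "'g monoid \<Rightarrow> 'g set \<Rightarrow> 'g set \<Rightarrow> bool" where
  "rel_gen_set G H X \<longleftrightarrow>
     X \<subseteq> carrier G \<and> (\<forall>x\<in>X. inv\<^bsub>G\<^esub> x \<in> X) \<and> generate G (X \<union> H) = carrier G"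

text \<open>
  A choice of representatives of left cosets is a function on the set of cosets;
  \<open>t (g <# H)\<close> is what is usually written $t(g)$.
\<close>

definition transversal :: "'g monoid \<Rightarrow> 'g set \<Rightarrow> ('g set \<Rightarrow> 'g) \<Rightarrow> bool" where
  "transversal G H t \<longleftrightarrow> (\<forall>C\<in>lcosets\<^bsub>G\<^esub> H. t C \<in> C) \<and> t H = \<one>\<^bsub>G\<^esub>"

definition Y_verts :: "'g monoid \<Rightarrow> 'g set \<Rightarrow> 'v set \<Rightarrow> ('g set \<times> 'v) set" where
  "Y_verts G H V = (lcosets\<^bsub>G\<^esub> H) \<times> V"

definition Y_edges :: "'g monoid \<Rightarrow> 'g set \<Rightarrow> 'v set set \<Rightarrow> ('g set \<times> 'v) set set" where
  "Y_edges G H E = {Pair C ` e | C e. C \<in> lcosets\<^bsub>G\<^esub> H \<and> e \<in> E}"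

definition Y_act ::
    "'g monoid \<Rightarrow> 'g set \<Rightarrow> 'v set \<Rightarrow> ('g \<Rightarrow> 'v \<Rightarrow> 'v) \<Rightarrow> ('g set \<Rightarrow> 'g) \<Rightarrow>
     'g \<Rightarrow> 'g set \<times> 'v \<Rightarrow> 'g set \<times> 'v" where
  "Y_act G H V \<phi> t g =
     (\<lambda>(C, r)\<in>Y_verts G H V.
        (g <#\<^bsub>G\<^esub> C, \<phi> (inv\<^bsub>G\<^esub> (t (g <#\<^bsub>G\<^esub> C)) \<otimes>\<^bsub>G\<^esub> g \<otimes>\<^bsub>G\<^esub> t C) r))"

text \<open>
  In the graph obtained from the Cayley graph of \<open>G\<close> with respect to \<open>X\<close> and from \<open>Y\<close> by
  identifying \<open>g\<close> with \<open>g(H, b)\<close>, every vertex of the Cayley graph is identified with exactly one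
  vertex of \<open>Y\<close> (and distinct ones with distinct ones, the action on \<open>V\<close> being free). Hence its
  vertices are those of \<open>Y\<close> with the action of \<open>G\<close> on them, and its edges are those of \<open>Y\<close>
  together with the images \<open>{g(H, b), gx(H, b)}\<close> of the edges \<open>{g, gx}\<close> of the Cayley graph.
  Cayley graphs are simple graphs, so \<open>x = 1\<close> yields no loop.
\<close>

definition glued_Cayley_edges ::
    "'g monoid \<Rightarrow> 'g set \<Rightarrow> 'g set \<Rightarrow> 'v set \<Rightarrow> ('g \<Rightarrow> 'v \<Rightarrow> 'v) \<Rightarrow> ('g set \<Rightarrow> 'g) \<Rightarrow> 'v \<Rightarrow>
     ('g set \<times> 'v) set set" where
  "glued_Cayley_edges G H X V \<phi> t b =
     {{Y_act G H V \<phi> t g (H, b), Y_act G H V \<phi> t (g \<otimes>\<^bsub>G\<^esub> x) (H, b)} | g x.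
        g \<in> carrier G \<and> x \<in> X - {\<one>\<^bsub>G\<^esub>}}"

definition induced_action ::
    "'g monoid \<Rightarrow> 'g set \<Rightarrow> 'g set \<Rightarrow> 'v set \<Rightarrow> 'v set set \<Rightarrow> ('g \<Rightarrow> 'v \<Rightarrow> 'v) \<Rightarrow>
     ('g set \<Rightarrow> 'g) \<Rightarrow> 'v \<Rightarrow> ('g, 'g set \<times> 'v \<Rightarrow> real) isoact" where
  "induced_action G H X V E \<phi> t b =
     graph_action G (Y_verts G H V) (Y_edges G H E \<union> glued_Cayley_edges G H X V \<phi> t b)
       (Y_act G H V \<phi> t)"

text \<open>
  The class of the induced action for fixed choices of a graph representing \<open>A\<close> (with vertices in
  \<open>'m\<close>), of a vertex and of a transversal; \<open>Ind\<close> moreover fixes a finite \<open>X\<close>.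
\<close>

definition Ind_wrt ::
    "'g monoid \<Rightarrow> 'g set \<Rightarrow> 'g set \<Rightarrow> ('g, 'm) isoact set \<Rightarrow> ('g, 'm) isoact set" where
  "Ind_wrt G H X A =
     (SOME B. \<exists>(V :: 'm set) E \<phi> t b.
        connected_simple_graph V E \<and>
        graph_automorphism_action (G\<lparr>carrier := H\<rparr>) V E \<phi> \<and>
        free_on_vertices (G\<lparr>carrier := H\<rparr>) V \<phi> \<and>
        action_class (G\<lparr>carrier := H\<rparr>) (graph_action (G\<lparr>carrier := H\<rparr>) V E \<phi>) = A \<and>
        transversal G H t \<and> b \<in> V \<and>
        B = action_class G (induced_action G H X V E \<phi> t b))"

definition Ind ::
    "'g monoid \<Rightarrow> 'g set \<Rightarrow> ('g, 'm) isoact set \<Rightarrow> ('g, 'm) isoact set" where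
  "Ind G H A = Ind_wrt G H (SOME X. finite X \<and> rel_gen_set G H X) A"


section \<open>Incompressibility\<close>

definition left_invariant_metrics :: "'g monoid \<Rightarrow> 'g set \<Rightarrow> ('g \<Rightarrow> 'g \<Rightarrow> nat) set" where
  "left_invariant_metrics G H =
     {d. Metric_space H (\<lambda>x y. real (d x y)) \<and>
         (\<forall>h\<in>H. \<forall>x\<in>H. \<forall>y\<in>H. d (h \<otimes>\<^bsub>G\<^esub> x) (h \<otimes>\<^bsub>G\<^esub> y) = d x y)}"

definition weight :: "'g monoid \<Rightarrow> 'g set \<Rightarrow> 'g set \<Rightarrow> ('g \<Rightarrow> 'g \<Rightarrow> nat) \<Rightarrow> 'g \<Rightarrow> enat" where
  "weight G H X d g =
     (if g = \<one>\<^bsub>G\<^esub> then 0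
      else if g \<in> X then 1
      else if g \<in> H then enat (d \<one>\<^bsub>G\<^esub> g)
      else \<infinity>)"

text \<open>An infimum in \<^typ>\<open>enat\<close> is attained; it is finite here as \<open>G\<close> is generated by \<open>X \<union> H\<close>.\<close>

definition induced_metric ::
    "'g monoid \<Rightarrow> 'g set \<Rightarrow> 'g set \<Rightarrow> ('g \<Rightarrow> 'g \<Rightarrow> nat) \<Rightarrow> 'g \<Rightarrow> 'g \<Rightarrow> nat" where
  "induced_metric G H X d f g =
     the_enat (INF xs \<in> {xs. set xs \<subseteq> carrier G \<and>
                             foldr (\<otimes>\<^bsub>G\<^esub>) xs \<one>\<^bsub>G\<^esub> = inv\<^bsub>G\<^esub> f \<otimes>\<^bsub>G\<^esub> g}.
                 (\<Sum>x\<leftarrow>xs. weight G H X d x))"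

definition incompressible_wrt :: "'g monoid \<Rightarrow> 'g set \<Rightarrow> 'g set \<Rightarrow> bool" where
  "incompressible_wrt G H X \<longleftrightarrow>
     (\<forall>d\<in>left_invariant_metrics G H.
        qi_embedding H (\<lambda>x y. real (d x y))
          (carrier G) (\<lambda>x y. real (induced_metric G H X d x y)) (\<lambda>h. h))"

definition incompressible :: "'g monoid \<Rightarrow> 'g set \<Rightarrow> bool" where
  "incompressible G H \<longleftrightarrow> (\<exists>X. finite X \<and> rel_gen_set G H X \<and> incompressible_wrt G H X)"

end

(*
  The three conditions are proved equivalent in the cyclic order (a), (c), (b), (a).

  (a) => (c): H with a metric d in M(H) is itself an H-space. If f embeds it into a G-space S and
  s = f(1), then g |-> d(s, gs) is a subadditive function on G which is bounded on the finite set X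
  and bounded by a multiple of d(1, h) on H, hence by a multiple of the induced length; on H it agrees
  with d(1, h) up to multiplicative and additive constants.

  (c) => (b): Let d be the metric on H induced by the orbit of the base vertex b in the graph R. A walk
  in the glued graph between two vertices of the copy of R over H either stays there or leaves it at
  some gb and returns at some hb; in between it is at least as long as the induced length of the
  inverse of g times h, which by incompressibility controls d(g, h) from above.

  (b) => (a): Every isometric action embeds isometrically and equivariantly into a geodesic one, namely
  the convex hull of its image under the Kuratowski embedding.
*)

theory Submission
  imports Defs
begin

section \<open>Group actions and coarse maps\<close>

text \<open>The induced length is the largest subadditive function on \<open>G\<close> that vanishes
  at the identity, is at most 1 on \<open>X\<close> and at most d(1, h) on \<open>H\<close>. Both
  (a) => (c) and the passage from one finite \<open>X\<close> to another come down to this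
  extremality. Two features of the definitions shape the rest. Conditions (a) and (b) quantify over
  actions on subsets of \<open>'m\<close>, whereas realizations of graphs, glued graphs and hulls
  live on function types; each of these spaces has to be bounded in size by \<open>'m\<close> and
  relabelled along an injection. And \<open>Ind\<close> is defined by choice: an admissible choice
  has to be exhibited, after which everything is proved for an arbitrary graph, base vertex and
  transversal. Only the finite set \<open>X\<close> calls for a comparison, because (c) provides
  some \<open>X\<close> while \<open>Ind\<close> has fixed one. Condition (b) sees geodesic spaces
  only, which is why (b) => (a) needs a geodesic space around an arbitrary one, and one that is not
  too large.\<close>

lemma group_actionI:
  assumes "group G"
    and ext: "\<And>g. g \<in> carrier G \<Longrightarrow> \<phi> g \<in> extensional E"
    and closed: "\<And>g x. g \<in> carrier G \<Longrightarrow> x \<in> E \<Longrightarrow> \<phi> g x \<in> E"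
    and one: "\<And>x. x \<in> E \<Longrightarrow> \<phi> \<one>\<^bsub>G\<^esub> x = x"
    and mult: "\<And>g h x. g \<in> carrier G \<Longrightarrow> h \<in> carrier G \<Longrightarrow> x \<in> E \<Longrightarrow>
      \<phi> (g \<otimes>\<^bsub>G\<^esub> h) x = \<phi> g (\<phi> h x)"
  shows "group_action G E \<phi>"
proof -
  interpret group G by fact
  have bij: "\<phi> g \<in> Bij E" if g: "g \<in> carrier G" for g
  proof -
    have "\<phi> (inv\<^bsub>G\<^esub> g) (\<phi> g x) = x" "\<phi> g (\<phi> (inv\<^bsub>G\<^esub> g) x) = x" if "x \<in> E" for x
      using that g one mult[of "inv\<^bsub>G\<^esub> g" g x] mult[of g "inv\<^bsub>G\<^esub> g" x] by auto
    then have "bij_betw (\<phi> g) E E"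
      using g closed by (intro bij_betwI[where g = "\<phi> (inv\<^bsub>G\<^esub> g)"]) auto
    then show ?thesis using ext[OF g] by (simp add: Bij_def)
  qed
  have "\<phi> \<in> hom G (BijGroup E)"
  proof (rule homI)
    fix g assume "g \<in> carrier G" then show "\<phi> g \<in> carrier (BijGroup E)"
      using bij by (simp add: BijGroup_def)
  next
    fix g h assume gh: "g \<in> carrier G" "h \<in> carrier G"
    have "\<phi> (g \<otimes>\<^bsub>G\<^esub> h) = compose E (\<phi> g) (\<phi> h)"
    proof
      fix x show "\<phi> (g \<otimes>\<^bsub>G\<^esub> h) x = compose E (\<phi> g) (\<phi> h) x"
      proof (cases "x \<in> E")
        case True then show ?thesis using gh mult by (simp add: compose_eq)
      next
        case False then show ?thesis
          using gh ext[of "g \<otimes>\<^bsub>G\<^esub> h"] by (simp add: compose_def extensional_def)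
      qed
    qed
    then show "\<phi> (g \<otimes>\<^bsub>G\<^esub> h) = \<phi> g \<otimes>\<^bsub>BijGroup E\<^esub> \<phi> h"
      using gh bij by (simp add: BijGroup_def)
  qed
  then show ?thesis
    by (simp add: group_action_def group_hom_def group_hom_axioms_def group_BijGroup \<open>group G\<close>)
qed

lemma group_action_group: "group_action G E \<phi> \<Longrightarrow> group G"
  by (simp add: group_action_def group_hom_def)

lemma group_action_closed:
  "group_action G E \<phi> \<Longrightarrow> g \<in> carrier G \<Longrightarrow> x \<in> E \<Longrightarrow> \<phi> g x \<in> E"
  by (blast intro: group_action.element_image)

lemma group_action_one: "group_action G E \<phi> \<Longrightarrow> x \<in> E \<Longrightarrow> \<phi> \<one>\<^bsub>G\<^esub> x = x"
  using group_action.id_eq_one by (metis restrict_apply')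

lemma group_action_mult:
  "group_action G E \<phi> \<Longrightarrow> g \<in> carrier G \<Longrightarrow> h \<in> carrier G \<Longrightarrow> x \<in> E \<Longrightarrow>
    \<phi> (g \<otimes>\<^bsub>G\<^esub> h) x = \<phi> g (\<phi> h x)"
  by (rule group_action.composition_rule)

lemma group_action_ext:
  "group_action G E \<phi> \<Longrightarrow> g \<in> carrier G \<Longrightarrow> \<phi> g \<in> extensional E"
  by (blast dest: group_action.bij_prop0 Bij_imp_extensional)

lemma group_action_inv:
  assumes "group_action G E \<phi>" "g \<in> carrier G" "x \<in> E"
  shows "\<phi> (inv\<^bsub>G\<^esub> g) (\<phi> g x) = x" "\<phi> g (\<phi> (inv\<^bsub>G\<^esub> g) x) = x"
proof -
  interpret group G using assms(1) by (rule group_action_group)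
  show "\<phi> (inv\<^bsub>G\<^esub> g) (\<phi> g x) = x" "\<phi> g (\<phi> (inv\<^bsub>G\<^esub> g) x) = x"
    using assms group_action_mult[OF assms(1), of "inv\<^bsub>G\<^esub> g" g x]
      group_action_mult[OF assms(1), of g "inv\<^bsub>G\<^esub> g" x] group_action_one[OF assms(1)] by auto
qed

lemma group_action_subgroup:
  assumes "group_action G E \<phi>" "subgroup H G"
  shows "group_action (G\<lparr>carrier := H\<rparr>) E \<phi>"
proof -
  interpret group G using assms(1) by (rule group_action_group)
  have "H \<subseteq> carrier G" using assms(2) by (rule subgroup.subset)
  then show ?thesis
    using assms
    by (intro group_actionI) (auto simp: subgroup_imp_group subset_iff group_action_ext
        group_action_closed group_action_one group_action_mult)
qed

lemma isometric_action_group: "isometric_action G R \<Longrightarrow> group G"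
  unfolding isometric_action_def by (blast dest: group_action_group)

lemma isometric_action_metric: "isometric_action G R \<Longrightarrow> Metric_space (points R) (metric R)"
  by (simp add: isometric_action_def)

lemma isometric_action_closed:
  "isometric_action G R \<Longrightarrow> g \<in> carrier G \<Longrightarrow> x \<in> points R \<Longrightarrow> act R g x \<in> points R"
  unfolding isometric_action_def by (blast intro: group_action_closed)

lemma isometric_action_isom:
  "isometric_action G R \<Longrightarrow> g \<in> carrier G \<Longrightarrow> x \<in> points R \<Longrightarrow> y \<in> points R \<Longrightarrow>
    metric R (act R g x) (act R g y) = metric R x y"
  by (simp add: isometric_action_def)

lemma isometric_action_subgroup:
  assumes "isometric_action G R" "subgroup H G"
  shows "isometric_action (G\<lparr>carrier := H\<rparr>) R"
  using assms subgroup.subset[OF assms(2)]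
  by (auto simp: isometric_action_def group_action_subgroup)

text \<open>Keeps the multiplicative and the additive constant apart and solves the lower inequality
  for \<open>d x y\<close>, so that estimates compose without division. The single constant of
  \<open>qi_embedding\<close> becomes their sum.\<close>

lemma qi_embeddingI:
  assumes "f \<in> M \<rightarrow> M'" and A: "A \<ge> 1" and B: "B \<ge> 0"
    and lower: "\<And>x y. x \<in> M \<Longrightarrow> y \<in> M \<Longrightarrow> d x y \<le> A * d' (f x) (f y) + B"
    and upper: "\<And>x y. x \<in> M \<Longrightarrow> y \<in> M \<Longrightarrow> d' (f x) (f y) \<le> A * d x y + B"
    and nonneg: "\<And>x y. 0 \<le> d x y" "\<And>x y. 0 \<le> d' x y"
  shows "qi_embedding M d M' d' f"
  unfolding qi_embedding_def
proof (intro conjI exI[of _ "A + B"] ballI)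
  show "f \<in> M \<rightarrow> M'" by fact
  show AB: "A + B > 0" using A B by simp
  fix x y assume xy: "x \<in> M" "y \<in> M"
  \<comment> \<open>Multiplying the lower inequality of \<open>qi_embedding\<close> by its constant
    squares the subtracted term, so \<open>B\<close> has to be at most that square, which
    \<open>A \<ge> 1\<close> ensures.\<close>
  have "B \<le> (A + B) * (A + B)"
    using mult_mono[of 1 "A + B" "A + B" "A + B"] A B by (smt (verit) mult_1)
  moreover have "A * d' (f x) (f y) \<le> (A + B) * d' (f x) (f y)"
    using B nonneg(2)[of "f x" "f y"] by (intro mult_right_mono) auto
  ultimately have "d x y \<le> (A + B) * d' (f x) (f y) + (A + B) * (A + B)"
    using lower[OF xy] by linarith
  then show "1 / (A + B) * d x y - (A + B) \<le> d' (f x) (f y)"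
    using AB by (simp add: field_simps)
  have "d' (f x) (f y) \<le> A * d x y + B" by (rule upper[OF xy])
  also have "\<dots> \<le> (A + B) * d x y + (A + B)"
    using A B nonneg(1)[of x y] by (intro add_mono mult_right_mono) auto
  finally show "d' (f x) (f y) \<le> (A + B) * d x y + (A + B)" .
qed

lemma qi_embeddingE:
  assumes "qi_embedding M d M' d' f"
    and nonneg: "\<And>x y. 0 \<le> d x y" "\<And>x y. 0 \<le> d' x y"
  obtains A where "A \<ge> 1"
    "\<And>x y. x \<in> M \<Longrightarrow> y \<in> M \<Longrightarrow> d x y \<le> A * d' (f x) (f y) + A"
    "\<And>x y. x \<in> M \<Longrightarrow> y \<in> M \<Longrightarrow> d' (f x) (f y) \<le> A * d x y + A"
proof -
  obtain C where C: "C > 0"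
    and lo: "\<And>x y. x \<in> M \<Longrightarrow> y \<in> M \<Longrightarrow> 1 / C * d x y - C \<le> d' (f x) (f y)"
    and up: "\<And>x y. x \<in> M \<Longrightarrow> y \<in> M \<Longrightarrow> d' (f x) (f y) \<le> C * d x y + C"
    using assms(1) unfolding qi_embedding_def by blast
  show thesis
  proof
    \<comment> \<open>Solving the lower inequality for \<open>d x y\<close> produces the additive
      error \<open>C * C\<close>; the sum dominates this error, \<open>C\<close> and 1.\<close>
    show "1 + C + C * C \<ge> 1" using C by simp
    fix x y assume xy: "x \<in> M" "y \<in> M"
    have "d x y \<le> C * d' (f x) (f y) + C * C"
      using lo[OF xy] C by (simp add: field_simps)
    also have "\<dots> \<le> (1 + C + C * C) * d' (f x) (f y) + (1 + C + C * C)"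
      using C nonneg(2)[of "f x" "f y"] by (intro add_mono mult_right_mono) auto
    finally show "d x y \<le> (1 + C + C * C) * d' (f x) (f y) + (1 + C + C * C)" .
    have "d' (f x) (f y) \<le> C * d x y + C" by (rule up[OF xy])
    also have "\<dots> \<le> (1 + C + C * C) * d x y + (1 + C + C * C)"
      using C nonneg(1)[of x y] by (intro add_mono mult_right_mono) auto
    finally show "d' (f x) (f y) \<le> (1 + C + C * C) * d x y + (1 + C + C * C)" .
  qed
qed

lemma qi_embedding_compose:
  assumes "qi_embedding M d M' d' f" "qi_embedding M' d' M'' d'' g"
    and "Metric_space M d" "Metric_space M' d'" "Metric_space M'' d''"
  shows "qi_embedding M d M'' d'' (g \<circ> f)"
proof -
  interpret R: Metric_space M d by fact
  interpret S: Metric_space M' d' by fact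
  interpret T: Metric_space M'' d'' by fact
  have f: "f \<in> M \<rightarrow> M'" and g: "g \<in> M' \<rightarrow> M''"
    using assms by (auto simp: qi_embedding_def)
  obtain A where A: "A \<ge> 1"
    "\<And>x y. x \<in> M \<Longrightarrow> y \<in> M \<Longrightarrow> d x y \<le> A * d' (f x) (f y) + A"
    "\<And>x y. x \<in> M \<Longrightarrow> y \<in> M \<Longrightarrow> d' (f x) (f y) \<le> A * d x y + A"
    by (rule qi_embeddingE[OF assms(1) R.nonneg S.nonneg]) blast
  obtain B where B: "B \<ge> 1"
    "\<And>x y. x \<in> M' \<Longrightarrow> y \<in> M' \<Longrightarrow> d' x y \<le> B * d'' (g x) (g y) + B"
    "\<And>x y. x \<in> M' \<Longrightarrow> y \<in> M' \<Longrightarrow> d'' (g x) (g y) \<le> B * d' x y + B"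
    by (rule qi_embeddingE[OF assms(2) S.nonneg T.nonneg]) blast
  have AB: "1 \<le> A * B" "A \<le> A * B" "B \<le> A * B" using A(1) B(1) mult_mono[of 1 A 1 B]
      mult_left_mono[of 1 B A] mult_right_mono[of 1 A B] by auto
  show ?thesis
  \<comment> \<open>Substitution leaves the errors \<open>A * B + A\<close> and
    \<open>A * B + B\<close>, both at most \<open>2 * A * B\<close> because \<open>A\<close> and
    \<open>B\<close> are at least 1.\<close>
  proof (rule qi_embeddingI[where A = "A * B" and B = "2 * A * B"])
    show "g \<circ> f \<in> M \<rightarrow> M''" using f g by auto
    fix x y assume xy: "x \<in> M" "y \<in> M"
    have xy': "f x \<in> M'" "f y \<in> M'" using xy f by auto
    have "d x y \<le> A * d' (f x) (f y) + A" by (rule A(2)[OF xy])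
    also have "\<dots> \<le> A * (B * d'' (g (f x)) (g (f y)) + B) + A"
      using B(2)[OF xy'] A(1) by simp
    finally show "d x y \<le> A * B * d'' ((g \<circ> f) x) ((g \<circ> f) y) + 2 * A * B"
      using AB by (simp add: algebra_simps)
    have "d'' (g (f x)) (g (f y)) \<le> B * d' (f x) (f y) + B" by (rule B(3)[OF xy'])
    also have "\<dots> \<le> B * (A * d x y + A) + B" using A(3)[OF xy] B(1) by simp
    finally show "d'' ((g \<circ> f) x) ((g \<circ> f) y) \<le> A * B * d x y + 2 * A * B"
      using AB by (simp add: algebra_simps)
  qed (use AB in auto)
qed

text \<open>The defect of \<open>f\<close> at \<open>x\<close> is carried over by the upper
  inequality for \<open>g\<close>; the defect of \<open>g\<close> is needed only at the single point
  \<open>f x\<close>. Hence bounds that depend on the point are enough.\<close>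

lemma coarsely_equivariant_compose:
  assumes R: "isometric_action K R" and S: "isometric_action K S" and T: "isometric_action K T"
    and f: "coarsely_equivariant (carrier K) R S f" "f \<in> points R \<rightarrow> points S"
    and g: "coarsely_equivariant (carrier K) S T g"
    and qi: "qi_embedding (points S) (metric S) (points T) (metric T) g"
  shows "coarsely_equivariant (carrier K) R T (g \<circ> f)"
  unfolding coarsely_equivariant_def
proof
  fix x assume x: "x \<in> points R"
  interpret S: Metric_space "points S" "metric S" using S by (rule isometric_action_metric)
  interpret T: Metric_space "points T" "metric T" using T by (rule isometric_action_metric)
  have fx: "f x \<in> points S" using f(2) x by auto
  have gp: "g \<in> points S \<rightarrow> points T" using qi by (simp add: qi_embedding_def)
  obtain A where A: "A \<ge> 1"
    "\<And>x y. x \<in> points S \<Longrightarrow> y \<in> points S \<Longrightarrow> metric T (g x) (g y) \<le> A * metric S x y + A"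
    by (rule qi_embeddingE[OF qi S.nonneg T.nonneg]) blast
  obtain B where B: "\<And>h. h \<in> carrier K \<Longrightarrow> metric S (f (act R h x)) (act S h (f x)) \<le> B"
    using f(1) x unfolding coarsely_equivariant_def bdd_above_def by fastforce
  obtain C where C: "\<And>h. h \<in> carrier K \<Longrightarrow> metric T (g (act S h (f x))) (act T h (g (f x))) \<le> C"
    using g fx unfolding coarsely_equivariant_def bdd_above_def by fastforce
  show "bdd_above ((\<lambda>h. metric T ((g \<circ> f) (act R h x)) (act T h ((g \<circ> f) x))) ` carrier K)"
  proof (rule bdd_aboveI2)
    fix h assume h: "h \<in> carrier K"
    have p: "f (act R h x) \<in> points S" "act S h (f x) \<in> points S"
      "act T h (g (f x)) \<in> points T"
      using x fx f(2) gp isometric_action_closed[OF R h x] isometric_action_closed[OF S h fx]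
        isometric_action_closed[OF T h] by auto
    have "metric T (g (f (act R h x))) (act T h (g (f x)))
        \<le> metric T (g (f (act R h x))) (g (act S h (f x)))
          + metric T (g (act S h (f x))) (act T h (g (f x)))"
      using p gp by (intro T.triangle) auto
    also have "\<dots> \<le> (A * metric S (f (act R h x)) (act S h (f x)) + A) + C"
      by (intro add_mono A(2) C p h)
    also have "\<dots> \<le> (A * B + A) + C"
      using A(1) B[OF h] by simp
    finally show "metric T ((g \<circ> f) (act R h x)) (act T h ((g \<circ> f) x)) \<le> A * B + A + C"
      by simp
  qed
qed

lemma is_extension_trans:
  assumes "isometric_action K R" "isometric_action K S" "isometric_action K T"
    and "is_extension (carrier K) R S" "is_extension (carrier K) S T"
  shows "is_extension (carrier K) R T"
proof -
  obtain f where f: "coarsely_equivariant (carrier K) R S f"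
    "qi_embedding (points R) (metric R) (points S) (metric S) f"
    using assms(4) by (auto simp: is_extension_def)
  obtain g where g: "coarsely_equivariant (carrier K) S T g"
    "qi_embedding (points S) (metric S) (points T) (metric T) g"
    using assms(5) by (auto simp: is_extension_def)
  have "f \<in> points R \<rightarrow> points S" using f(2) by (simp add: qi_embedding_def)
  then show ?thesis
    unfolding is_extension_def
    using coarsely_equivariant_compose[OF assms(1-3) f(1) _ g] qi_embedding_compose[OF f(2) g(2)]
      assms(1-3)[THEN isometric_action_metric] by blast
qed

lemma equivalent_actions_imp_extension:
  assumes "equivalent_actions G R S" "H \<subseteq> carrier G"
  shows "is_extension H R S"
  using assms unfolding equivalent_actions_def is_extension_def quasi_isometry_def
    coarsely_equivariant_def by (meson bdd_above_mono image_mono)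

lemma equivalent_actions_trans:
  assumes "isometric_action G R" "isometric_action G S" "isometric_action G T"
    and "equivalent_actions G R S" "equivalent_actions G S T"
  shows "equivalent_actions G R T"
proof -
  interpret S: Metric_space "points S" "metric S" using assms(2) by (rule isometric_action_metric)
  interpret T: Metric_space "points T" "metric T" using assms(3) by (rule isometric_action_metric)
  obtain f \<epsilon> where f: "coarsely_equivariant (carrier G) R S f"
    "qi_embedding (points R) (metric R) (points S) (metric S) f"
    "\<And>y. y \<in> points S \<Longrightarrow> \<exists>x\<in>points R. metric S y (f x) \<le> \<epsilon>"
    using assms(4) unfolding equivalent_actions_def quasi_isometry_def by blast
  obtain g \<delta> where g: "coarsely_equivariant (carrier G) S T g"
    "qi_embedding (points S) (metric S) (points T) (metric T) g"
    "\<And>y. y \<in> points T \<Longrightarrow> \<exists>x\<in>points S. metric T y (g x) \<le> \<delta>"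
    using assms(5) unfolding equivalent_actions_def quasi_isometry_def by blast
  have fp: "f \<in> points R \<rightarrow> points S" and gp: "g \<in> points S \<rightarrow> points T"
    using f(2) g(2) by (auto simp: qi_embedding_def)
  obtain A where A: "A \<ge> 1"
    "\<And>x y. x \<in> points S \<Longrightarrow> y \<in> points S \<Longrightarrow> metric T (g x) (g y) \<le> A * metric S x y + A"
    by (rule qi_embeddingE[OF g(2) S.nonneg T.nonneg]) blast
  have "\<exists>x\<in>points R. metric T z ((g \<circ> f) x) \<le> \<delta> + (A * \<epsilon> + A)" if z: "z \<in> points T" for z
  proof -
    obtain y where y: "y \<in> points S" "metric T z (g y) \<le> \<delta>" using g(3)[OF z] by blast
    obtain x where x: "x \<in> points R" "metric S y (f x) \<le> \<epsilon>" using f(3)[OF y(1)] by blast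
    have "metric T z (g (f x)) \<le> metric T z (g y) + metric T (g y) (g (f x))"
      using x y z fp gp by (intro T.triangle) auto
    also have "\<dots> \<le> \<delta> + (A * metric S y (f x) + A)"
      using x y fp by (intro add_mono A(2)) auto
    also have "\<dots> \<le> \<delta> + (A * \<epsilon> + A)" using x A(1) by simp
    finally show ?thesis using x(1) by auto
  qed
  moreover have "coarsely_equivariant (carrier G) R T (g \<circ> f)"
    by (rule coarsely_equivariant_compose[OF assms(1-3) f(1) fp g(1,2)])
  moreover have "qi_embedding (points R) (metric R) (points T) (metric T) (g \<circ> f)"
    using f(2) g(2) assms(1-3)[THEN isometric_action_metric] by (rule qi_embedding_compose)
  ultimately show ?thesis
    unfolding equivalent_actions_def quasi_isometry_def by blast
qed

text \<open>A quasi-inverse \<open>g\<close> picks for each \<open>y\<close> a point whose image is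
  within \<open>\<epsilon>\<close> of \<open>y\<close>. Since \<open>f \<circ> g\<close> moves
  points by at most \<open>\<epsilon>\<close>, every estimate for \<open>g\<close> is made after
  applying \<open>f\<close> and then pulled back by the lower inequality.\<close>

lemma equivalent_actions_sym:
  assumes R: "isometric_action G R" and S: "isometric_action G S"
    and "equivalent_actions G R S"
  shows "equivalent_actions G S R"
proof -
  interpret R: Metric_space "points R" "metric R" using R by (rule isometric_action_metric)
  interpret S: Metric_space "points S" "metric S" using S by (rule isometric_action_metric)
  obtain f \<epsilon> where f: "coarsely_equivariant (carrier G) R S f"
    "qi_embedding (points R) (metric R) (points S) (metric S) f"
    "\<And>y. y \<in> points S \<Longrightarrow> \<exists>x\<in>points R. metric S y (f x) \<le> \<epsilon>"
    using assms(3) unfolding equivalent_actions_def quasi_isometry_def by blast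
  have fp: "f x \<in> points S" if "x \<in> points R" for x
    using f(2) that by (auto simp: qi_embedding_def)
  obtain A where A: "A \<ge> 1"
    "\<And>x y. x \<in> points R \<Longrightarrow> y \<in> points R \<Longrightarrow> metric R x y \<le> A * metric S (f x) (f y) + A"
    "\<And>x y. x \<in> points R \<Longrightarrow> y \<in> points R \<Longrightarrow> metric S (f x) (f y) \<le> A * metric R x y + A"
    by (rule qi_embeddingE[OF f(2) R.nonneg S.nonneg]) blast
  define g where "g = (\<lambda>y. SOME x. x \<in> points R \<and> metric S y (f x) \<le> \<epsilon>)"
  have g: "g y \<in> points R" "metric S y (f (g y)) \<le> \<epsilon>" if "y \<in> points S" for y
    using someI_ex[of "\<lambda>x. x \<in> points R \<and> metric S y (f x) \<le> \<epsilon>"] f(3)[OF that]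
    unfolding g_def by auto
  \<comment> \<open>The spaces are nonempty, so \<open>\<epsilon>\<close> bounds at least one
    distance.\<close>
  have \<epsilon>: "\<epsilon> \<ge> 0"
    using R g(2) fp S.nonneg unfolding isometric_action_def by (meson ex_in_conv order_trans)
  have fg: "metric S (f (g y)) (f (g z)) \<le> metric S y z + 2 * \<epsilon>"
    "metric S y z \<le> metric S (f (g y)) (f (g z)) + 2 * \<epsilon>" if "y \<in> points S" "z \<in> points S" for y z
  proof -
    have p: "f (g y) \<in> points S" "f (g z) \<in> points S" using that g fp by auto
    show "metric S (f (g y)) (f (g z)) \<le> metric S y z + 2 * \<epsilon>"
      using S.triangle[OF p(1) that(1) p(2)] S.triangle[OF that p(2)]
        g(2)[OF that(1)] g(2)[OF that(2)] S.commute[of "f (g y)" y] by linarith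
    show "metric S y z \<le> metric S (f (g y)) (f (g z)) + 2 * \<epsilon>"
      using S.triangle[OF that(1) p(1) that(2)] S.triangle[OF p that(2)]
        g(2)[OF that(1)] g(2)[OF that(2)] S.commute[of z "f (g z)"] by linarith
  qed
  have "qi_embedding (points S) (metric S) (points R) (metric R) g"
  proof (rule qi_embeddingI[where A = A and B = "A * (2 * \<epsilon>) + A + 2 * \<epsilon>"])
    show "g \<in> points S \<rightarrow> points R" using g by auto
    fix y z assume yz: "y \<in> points S" "z \<in> points S"
    show "metric S y z \<le> A * metric R (g y) (g z) + (A * (2 * \<epsilon>) + A + 2 * \<epsilon>)"
      using fg(2)[OF yz] A(3)[OF g(1)[OF yz(1)] g(1)[OF yz(2)]] A(1) \<epsilon>
        mult_nonneg_nonneg[of A "2 * \<epsilon>"] by linarith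
    have "metric R (g y) (g z) \<le> A * metric S (f (g y)) (f (g z)) + A"
      using A(2) g(1) yz by blast
    also have "\<dots> \<le> A * (metric S y z + 2 * \<epsilon>) + A"
      using fg(1)[OF yz] A(1) by simp
    finally show "metric R (g y) (g z) \<le> A * metric S y z + (A * (2 * \<epsilon>) + A + 2 * \<epsilon>)"
      using \<epsilon> by (simp add: algebra_simps)
  qed (use A(1) \<epsilon> in auto)
  moreover have "\<exists>y\<in>points S. metric R x (g y) \<le> A * \<epsilon> + A" if x: "x \<in> points R" for x
  proof
    show "f x \<in> points S" using fp x .
    have "metric R x (g (f x)) \<le> A * metric S (f x) (f (g (f x))) + A"
      using A(2) x g(1) fp by blast
    also have "\<dots> \<le> A * \<epsilon> + A" using g(2) fp x A(1) by simp
    finally show "metric R x (g (f x)) \<le> A * \<epsilon> + A" .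
  qed
  moreover have "coarsely_equivariant (carrier G) S R g"
    unfolding coarsely_equivariant_def
  proof
    fix y assume y: "y \<in> points S"
    have gy: "g y \<in> points R" using g(1) y .
    obtain B where B: "\<And>h. h \<in> carrier G \<Longrightarrow> metric S (f (act R h (g y))) (act S h (f (g y))) \<le> B"
      using f(1) gy unfolding coarsely_equivariant_def bdd_above_def by fastforce
    show "bdd_above ((\<lambda>h. metric R (g (act S h y)) (act R h (g y))) ` carrier G)"
    proof (rule bdd_aboveI2)
      fix h assume h: "h \<in> carrier G"
      have hy: "act S h y \<in> points S" and hgy: "act R h (g y) \<in> points R"
        and hfgy: "act S h (f (g y)) \<in> points S"
        using isometric_action_closed[OF R h] isometric_action_closed[OF S h] y gy fp by auto
      \<comment> \<open>The comparison passes through \<open>act S h y\<close> and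
        \<open>act S h (f (g y))\<close>. The choice of \<open>g\<close> costs
        \<open>\<epsilon>\<close> at \<open>act S h y\<close> and, as \<open>h\<close> is an
        isometry, \<open>\<epsilon>\<close> again at \<open>y\<close>; the defect of
        \<open>f\<close> at \<open>g y\<close> costs \<open>B\<close>.\<close>
      have "metric S (f (g (act S h y))) (f (act R h (g y)))
          \<le> metric S (f (g (act S h y))) (act S h y) + metric S (act S h y) (f (act R h (g y)))"
        using hy hgy g fp by (intro S.triangle) auto
      also have "metric S (act S h y) (f (act R h (g y)))
          \<le> metric S (act S h y) (act S h (f (g y))) + metric S (act S h (f (g y))) (f (act R h (g y)))"
        using hy hgy hfgy fp by (intro S.triangle) auto
      also have "metric S (act S h y) (act S h (f (g y))) = metric S y (f (g y))"
        using isometric_action_isom[OF S h] y gy fp by auto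
      finally have "metric S (f (g (act S h y))) (f (act R h (g y))) \<le> \<epsilon> + (\<epsilon> + B)"
        using g(2)[OF hy] g(2)[OF y] B[OF h] by (simp add: S.commute)
      then have "A * metric S (f (g (act S h y))) (f (act R h (g y))) + A \<le> A * (\<epsilon> + (\<epsilon> + B)) + A"
        using A(1) by simp
      then show "metric R (g (act S h y)) (act R h (g y)) \<le> A * (\<epsilon> + (\<epsilon> + B)) + A"
        using A(2)[OF g(1)[OF hy] hgy] by linarith
    qed
  qed
  ultimately show ?thesis
    unfolding equivalent_actions_def quasi_isometry_def by blast
qed

lemma action_class_eqI:
  assumes "isometric_action G R" "isometric_action G S" "equivalent_actions G R S"
  shows "(action_class G R :: ('g, 'm) isoact set) = action_class G S"
proof -
  have "equivalent_actions G R T \<longleftrightarrow> equivalent_actions G S T" if "geodesic_action G T"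
    for T :: "('g, 'm) isoact"
  proof -
    have T: "isometric_action G T" using that by (simp add: geodesic_action_def)
    show ?thesis
      using equivalent_actions_trans[OF assms(2,1) T equivalent_actions_sym[OF assms]]
        equivalent_actions_trans[OF assms(1,2) T assms(3)] by blast
  qed
  then show ?thesis
    unfolding action_class_def by blast
qed

text \<open>All equivalences constructed below (relabelling, vertices of a graph inside the graph, a
  free graph over a given space) are exactly equivariant and distort distances only
  additively.\<close>

lemma equivalent_actionsI:
  assumes R: "isometric_action G R" and S: "isometric_action G S"
    and f: "f \<in> points R \<rightarrow> points S"
    and eq: "\<And>g x. g \<in> carrier G \<Longrightarrow> x \<in> points R \<Longrightarrow> f (act R g x) = act S g (f x)"
    and lower: "\<And>x y. x \<in> points R \<Longrightarrow> y \<in> points R \<Longrightarrow> metric R x y \<le> metric S (f x) (f y) + B"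
    and upper: "\<And>x y. x \<in> points R \<Longrightarrow> y \<in> points R \<Longrightarrow> metric S (f x) (f y) \<le> metric R x y + B"
    and dense: "\<And>y. y \<in> points S \<Longrightarrow> \<exists>x\<in>points R. metric S y (f x) \<le> \<epsilon>"
  shows "equivalent_actions G R S"
proof -
  interpret R: Metric_space "points R" "metric R" using R by (rule isometric_action_metric)
  interpret S: Metric_space "points S" "metric S" using S by (rule isometric_action_metric)
  obtain x0 where x0: "x0 \<in> points R" using R by (auto simp: isometric_action_def)
  have "f x0 \<in> points S" using f x0 by auto
  \<comment> \<open>Comparing a point with itself shows that the additive error is
    nonnegative.\<close>
  then have "B \<ge> 0" using upper[OF x0 x0] lower[OF x0 x0] x0 by simp
  then have "qi_embedding (points R) (metric R) (points S) (metric S) f"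
    using f lower upper by (intro qi_embeddingI[where A = 1 and B = B]) auto
  moreover have "coarsely_equivariant (carrier G) R S f"
    unfolding coarsely_equivariant_def
  proof (intro ballI bdd_aboveI2)
    fix x g assume "x \<in> points R" "g \<in> carrier G"
    then show "metric S (f (act R g x)) (act S g (f x)) \<le> 0"
      using isometric_action_closed[OF S, of g "f x"] f by (auto simp: eq Pi_iff)
  qed
  ultimately show ?thesis
    using dense unfolding equivalent_actions_def quasi_isometry_def by blast
qed

section \<open>Relabelling the points of an action\<close>

definition transport :: "('p \<Rightarrow> 'q) \<Rightarrow> ('g, 'p) isoact \<Rightarrow> ('g, 'q) isoact" where
  "transport j R =
     \<lparr>points = j ` points R,
      metric = (\<lambda>x y. if x \<in> j ` points R \<and> y \<in> j ` points R
        then metric R (inv_into (points R) j x) (inv_into (points R) j y) else 0),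
      act = (\<lambda>g. \<lambda>x\<in>j ` points R. j (act R g (inv_into (points R) j x)))\<rparr>"

lemma transport_simps:
  assumes "inj_on j (points R)"
  shows "points (transport j R) = j ` points R"
    "x \<in> points R \<Longrightarrow> y \<in> points R \<Longrightarrow> metric (transport j R) (j x) (j y) = metric R x y"
    "x \<in> points R \<Longrightarrow> act (transport j R) g (j x) = j (act R g x)"
  using assms by (auto simp: transport_def)

text \<open>Off the image the transported metric is 0, which gives nonnegativity and symmetry for
  all arguments as \<open>Metric_space\<close> demands; the transported maps are restricted to the
  image, which gives the extensionality that \<open>group_action\<close> demands.\<close>

lemma isometric_action_transport:
  assumes R: "isometric_action G R" and j: "inj_on j (points R)"
  shows "isometric_action G (transport j R)"
proof -
  interpret R: Metric_space "points R" "metric R" using R by (rule isometric_action_metric)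
  note ts = transport_simps[OF j]
  have ga: "group_action G (points R) (act R)" using R by (simp add: isometric_action_def)
  have ne: "points R \<noteq> {}" using R by (simp add: isometric_action_def)
  have m: "Metric_space (points (transport j R)) (metric (transport j R))"
  proof
    fix x y
    show "0 \<le> metric (transport j R) x y" by (simp add: transport_def)
    show "metric (transport j R) x y = metric (transport j R) y x"
      by (simp add: transport_def R.commute)
  next
    fix x y assume "x \<in> points (transport j R)" "y \<in> points (transport j R)"
    then show "metric (transport j R) x y = 0 \<longleftrightarrow> x = y"
      using j by (auto simp: ts inj_on_eq_iff)
  next
    fix x y z
    assume "x \<in> points (transport j R)" "y \<in> points (transport j R)" "z \<in> points (transport j R)"
    then show "metric (transport j R) x z
        \<le> metric (transport j R) x y + metric (transport j R) y z"
      by (auto simp: ts R.triangle)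
  qed
  have a: "group_action G (points (transport j R)) (act (transport j R))"
  proof (rule group_actionI)
    show "group G" using R by (rule isometric_action_group)
  qed (use ga in \<open>auto simp: ts group_action_closed group_action_one group_action_mult\<close>,
       simp add: transport_def)
  show ?thesis
    unfolding isometric_action_def
    using m a ne isometric_action_isom[OF R] isometric_action_closed[OF R] by (auto simp: ts)
qed

lemma equivalent_actions_transport:
  assumes R: "isometric_action G R" and j: "inj_on j (points R)"
  shows "equivalent_actions G R (transport j R)"
proof -
  interpret R: Metric_space "points R" "metric R" using R by (rule isometric_action_metric)
  note ts = transport_simps[OF j]
  show ?thesis
    by (rule equivalent_actionsI[OF R isometric_action_transport[OF R j], where f = j and B = 0 and \<epsilon> = 0])
      (auto simp: ts intro!: bexI)
qed

lemma geodesic_action_transport: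
  assumes R: "geodesic_action G R" and j: "inj_on j (points R)"
  shows "geodesic_action G (transport j R)"
proof -
  note ts = transport_simps[OF j]
  have R': "isometric_action G R" using R by (simp add: geodesic_action_def)
  have "\<exists>\<gamma>. \<gamma> \<in> {0..metric (transport j R) x y} \<rightarrow> points (transport j R) \<and> \<gamma> 0 = x
      \<and> \<gamma> (metric (transport j R) x y) = y
      \<and> (\<forall>s\<in>{0..metric (transport j R) x y}. \<forall>t\<in>{0..metric (transport j R) x y}.
            metric (transport j R) (\<gamma> s) (\<gamma> t) = \<bar>s - t\<bar>)"
    if p: "x \<in> points (transport j R)" "y \<in> points (transport j R)" for x y
  proof -
    obtain x' y' where xy: "x = j x'" "y = j y'" "x' \<in> points R" "y' \<in> points R"
      using p ts(1) by auto
    then obtain \<gamma> where "\<gamma> \<in> {0..metric R x' y'} \<rightarrow> points R" "\<gamma> 0 = x'" "\<gamma> (metric R x' y') = y'"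
      "\<forall>s\<in>{0..metric R x' y'}. \<forall>t\<in>{0..metric R x' y'}. metric R (\<gamma> s) (\<gamma> t) = \<bar>s - t\<bar>"
      using R unfolding geodesic_action_def geodesic_space_def by blast
    then show ?thesis
      using xy by (intro exI[of _ "j \<circ> \<gamma>"]) (auto simp: ts Pi_iff)
  qed
  then show ?thesis
    using isometric_action_transport[OF R' j]
    unfolding geodesic_action_def geodesic_space_def
    by (meson isometric_action_metric)
qed

section \<open>Cardinality\<close>

text \<open>A real number is determined by its Dedekind cut, and a set of rationals is coded by a
  set of natural numbers.\<close>

lemma real_lepoll_nat_set: "(UNIV :: real set) \<lesssim> (UNIV :: nat set set)"
proof -
  let ?f = "\<lambda>x::real. to_nat ` {q::rat. of_rat q < x}"
  have "x = y" if "?f x = ?f y" for x y :: real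
  proof -
    have eq: "{q::rat. of_rat q < x} = {q. of_rat q < y}"
      using that by (simp add: inj_image_eq_iff)
    show "x = y"
    proof (rule ccontr)
      assume "x \<noteq> y"
      then obtain q where "x < of_rat q \<and> of_rat q < y \<or> y < of_rat q \<and> of_rat q < x"
        using of_rat_dense by (meson linorder_neqE_linordered_idom)
      then show False using eq by (smt (verit) mem_Collect_eq)
    qed
  qed
  then have "inj ?f" by (rule injI)
  then show ?thesis by (auto simp: lepoll_def)
qed

lemma times_lepoll_infinite:
  assumes "infinite C" "A \<lesssim> C" "B \<lesssim> C"
  shows "A \<times> B \<lesssim> C"
proof -
  have "C \<times> C \<approx> C"
    using card_of_Times_same_infinite[OF assms(1)] by (simp add: eqpoll_iff_card_of_ordIso)
  then show ?thesis
    using times_lepoll_mono[OF assms(2,3)] by (metis lepoll_trans2)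
qed

text \<open>A point has at most two nonzero coordinates, with sum 1, so two vertices and one real
  number determine it.\<close>

lemma realization_lepoll:
  fixes V :: "'v set"
  assumes "simple_graph V E" and V: "V \<lesssim> (UNIV :: 'm set)"
    and c: "(UNIV :: nat set set) \<lesssim> (UNIV :: 'm set)"
  shows "realization V E \<lesssim> (UNIV :: 'm set)"
proof -
  have inf: "infinite (UNIV :: 'm set)"
    using c lepoll_trans[OF real_lepoll_nat_set c] infinite_UNIV_char_0[where 'a = real]
    by (metis infinite_le_lepoll lepoll_trans)
  have re: "(UNIV :: real set) \<lesssim> (UNIV :: 'm set)"
    by (rule lepoll_trans[OF real_lepoll_nat_set c])
  let ?f = "\<lambda>(u, v, s::real) w::'v. if w = u then s else if w = v then 1 - s else 0"
  have "realization V E \<subseteq> ?f ` (V \<times> V \<times> UNIV)"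
  proof
    fix p assume p: "p \<in> realization V E"
    then have sum: "(\<Sum>v\<in>supp p. p v) = 1" by (simp add: realization_def)
    consider v where "v \<in> V" "supp p = {v}" | "supp p \<in> E"
      using p by (auto simp: realization_def)
    then show "p \<in> ?f ` (V \<times> V \<times> UNIV)"
    proof cases
      case 1
      \<comment> \<open>For equal vertices the first branch of \<open>?f\<close> takes precedence,
        so the weight recorded for a vertex is 1.\<close>
      then have "p = ?f (v, v, 1)"
        using sum by (auto simp: supp_def fun_eq_iff)
      then show ?thesis using 1 by (intro image_eqI[of _ _ "(v, v, 1)"]) auto
    next
      case 2
      then have "supp p \<subseteq> V" "card (supp p) = 2" using assms(1) by (auto simp: simple_graph_def)
      then obtain u v where uv: "supp p = {u, v}" "u \<noteq> v" by (meson card_2_iff)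
      then have "p u + p v = 1" using sum by simp
      moreover have "p w = 0" if "w \<noteq> u" "w \<noteq> v" for w
        using uv that by (auto simp: supp_def)
      ultimately have "p = ?f (u, v, p u)" using uv by (auto simp: fun_eq_iff)
      then show ?thesis
        using uv \<open>supp p \<subseteq> V\<close> by (intro image_eqI[of _ _ "(u, v, p u)"]) auto
    qed
  qed
  then have "realization V E \<lesssim> V \<times> V \<times> (UNIV :: real set)" by (rule subset_image_lepoll)
  also have "\<dots> \<lesssim> (UNIV :: 'm set)"
    by (intro times_lepoll_infinite inf V re)
  finally show ?thesis .
qed

section \<open>Graphs as geodesic spaces\<close>

text \<open>The condition of \<open>geodesic_space\<close> for a single pair of points, isolated so
  that geodesics can be assembled from pieces.\<close>

definition has_geodesic :: "'p set \<Rightarrow> ('p \<Rightarrow> 'p \<Rightarrow> real) \<Rightarrow> 'p \<Rightarrow> 'p \<Rightarrow> bool" where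
  "has_geodesic M d x y \<longleftrightarrow>
     (\<exists>\<gamma>. \<gamma> \<in> {0..d x y} \<rightarrow> M \<and> \<gamma> 0 = x \<and> \<gamma> (d x y) = y \<and>
        (\<forall>s\<in>{0..d x y}. \<forall>t\<in>{0..d x y}. d (\<gamma> s) (\<gamma> t) = \<bar>s - t\<bar>))"

lemma geodesic_spaceI:
  assumes "Metric_space M d" "\<And>x y. x \<in> M \<Longrightarrow> y \<in> M \<Longrightarrow> has_geodesic M d x y"
  shows "geodesic_space M d"
  using assms by (simp add: geodesic_space_def has_geodesic_def)

context Metric_space
begin

lemma has_geodesic_refl: "x \<in> M \<Longrightarrow> has_geodesic M d x x"
  unfolding has_geodesic_def by (intro exI[of _ "\<lambda>_. x"]) auto

text \<open>Across the joint \<open>y\<close> the triangle inequality bounds the distance from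
  above; a smaller distance would shorten the way from \<open>x\<close> to \<open>z\<close> below
  \<open>d x y + d y z\<close>, which \<open>eq\<close> excludes.\<close>

lemma has_geodesic_concat:
  assumes x: "x \<in> M" and y: "y \<in> M" and z: "z \<in> M"
    and xy: "has_geodesic M d x y" and yz: "has_geodesic M d y z" and eq: "d x z = d x y + d y z"
  shows "has_geodesic M d x z"
proof -
  define a b where "a = d x y" and "b = d y z"
  have ab: "a \<ge> 0" "b \<ge> 0" by (auto simp: a_def b_def)
  obtain \<alpha> where \<alpha>: "\<alpha> \<in> {0..a} \<rightarrow> M" "\<alpha> 0 = x" "\<alpha> a = y"
    "\<And>s t. s \<in> {0..a} \<Longrightarrow> t \<in> {0..a} \<Longrightarrow> d (\<alpha> s) (\<alpha> t) = \<bar>s - t\<bar>"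
    using xy unfolding has_geodesic_def a_def by blast
  obtain \<beta> where \<beta>: "\<beta> \<in> {0..b} \<rightarrow> M" "\<beta> 0 = y" "\<beta> b = z"
    "\<And>s t. s \<in> {0..b} \<Longrightarrow> t \<in> {0..b} \<Longrightarrow> d (\<beta> s) (\<beta> t) = \<bar>s - t\<bar>"
    using yz unfolding has_geodesic_def b_def by blast
  define \<gamma> where "\<gamma> = (\<lambda>s. if s \<le> a then \<alpha> s else \<beta> (s - a))"
  have \<gamma>M: "\<gamma> s \<in> M" if "s \<in> {0..a + b}" for s
    using that \<alpha>(1) \<beta>(1) by (auto simp: \<gamma>_def Pi_iff)
  have mixed: "d (\<gamma> s) (\<gamma> t) = t - s" if st: "0 \<le> s" "s \<le> a" "a < t" "t \<le> a + b" for s t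
  proof -
    have p: "\<alpha> s \<in> M" "\<beta> (t - a) \<in> M" using st \<alpha>(1) \<beta>(1) by (auto simp: Pi_iff)
    have 1: "d (\<alpha> s) y = a - s" using \<alpha>(4)[of s a] \<alpha>(3) st ab by simp
    have 2: "d y (\<beta> (t - a)) = t - a" using \<beta>(4)[of 0 "t - a"] \<beta>(2) st ab by simp
    have 3: "d x (\<alpha> s) = s" using \<alpha>(4)[of 0 s] \<alpha>(2) st ab by simp
    have 4: "d (\<beta> (t - a)) z = a + b - t" using \<beta>(4)[of "t - a" b] \<beta>(3) st ab by simp
    have "d (\<alpha> s) (\<beta> (t - a)) \<le> t - s" using triangle[OF p(1) y p(2)] 1 2 by simp
    moreover have "a + b \<le> s + d (\<alpha> s) (\<beta> (t - a)) + (a + b - t)"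
      using triangle[OF x p(1) z] triangle[OF p z] 3 4 eq by (simp add: a_def b_def)
    ultimately show ?thesis using st by (simp add: \<gamma>_def)
  qed
  have "d (\<gamma> s) (\<gamma> t) = \<bar>s - t\<bar>" if st: "s \<in> {0..a + b}" "t \<in> {0..a + b}" for s t
  proof -
    consider "s \<le> a" "t \<le> a" | "s \<le> a" "a < t" | "a < s" "t \<le> a" | "a < s" "a < t" by linarith
    then show ?thesis
    proof cases
      case 1 then show ?thesis using st \<alpha>(4) by (simp add: \<gamma>_def)
    next
      case 2 then show ?thesis using st mixed[of s t] by simp
    next
      case 3 then show ?thesis using st mixed[of t s] commute[of "\<gamma> s"] by simp
    next
      case 4 then show ?thesis using st \<beta>(4)[of "s - a" "t - a"] by (simp add: \<gamma>_def)
    qed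
  qed
  moreover have "\<gamma> 0 = x" using \<alpha>(2) ab by (simp add: \<gamma>_def)
  moreover have "\<gamma> (a + b) = z" using \<alpha>(3) \<beta>(2,3) ab by (auto simp: \<gamma>_def)
  ultimately show ?thesis
    unfolding has_geodesic_def eq a_def[symmetric] b_def[symmetric] using \<gamma>M by blast
qed

end

lemma adjacency_sym: "(u, v) \<in> adjacency E \<longleftrightarrow> (v, u) \<in> adjacency E"
  by (simp add: adjacency_def insert_commute)

lemma relpow_adjacency_sym: "(u, v) \<in> adjacency E ^^ n \<Longrightarrow> (v, u) \<in> adjacency E ^^ n"
proof (induction n arbitrary: v)
  case (Suc n)
  then show ?case by (metis adjacency_sym relpow_Suc_E relpow_Suc_I2)
qed auto

lemma vertex_dist_commute: "vertex_dist E u v = vertex_dist E v u"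
  using relpow_adjacency_sym unfolding vertex_dist_def by metis

lemma vertex_dist_le: "(u, v) \<in> adjacency E ^^ n \<Longrightarrow> vertex_dist E u v \<le> n"
  unfolding vertex_dist_def by (rule Least_le)

definition vertex_point :: "'v \<Rightarrow> 'v \<Rightarrow> real" where
  "vertex_point v = (\<lambda>w. if w = v then 1 else 0)"

text \<open>The distance from \<open>p\<close> to the vertex \<open>w\<close>, as
  \<open>dist_R_vertex_point\<close> confirms. Having it before the metric axioms reduces the case
  distinction in \<open>graph_dist\<close> to inequalities about distances to vertices.\<close>

definition to_vertex :: "'v set set \<Rightarrow> ('v \<Rightarrow> real) \<Rightarrow> 'v \<Rightarrow> real" where
  "to_vertex E p w = Min ((\<lambda>u. 1 - p u + real (vertex_dist E u w)) ` supp p)"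

section \<open>The path metric on the realization of a connected graph\<close>

locale connected_graph =
  fixes V :: "'v set" and E :: "'v set set"
  assumes connected: "connected_simple_graph V E"
begin

abbreviation dist_V :: "'v \<Rightarrow> 'v \<Rightarrow> nat" where "dist_V \<equiv> vertex_dist E"
abbreviation dist_R :: "('v \<Rightarrow> real) \<Rightarrow> ('v \<Rightarrow> real) \<Rightarrow> real" where "dist_R \<equiv> graph_dist V E"
abbreviation R :: "('v \<Rightarrow> real) set" where "R \<equiv> realization V E"

lemma edge_vertices: "{u, v} \<in> E \<Longrightarrow> u \<in> V \<and> v \<in> V \<and> u \<noteq> v"
  using connected by (force simp: connected_simple_graph_def simple_graph_def)

lemma edgeE: assumes "e \<in> E" obtains a b where "e = {a, b}" "a \<noteq> b" "{a, b} \<in> E"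
  using connected assms by (metis card_2_iff connected_simple_graph_def simple_graph_def)

lemma dist_V_relpow: assumes "u \<in> V" "v \<in> V" shows "(u, v) \<in> adjacency E ^^ dist_V u v"
proof -
  have "\<exists>n. (u, v) \<in> adjacency E ^^ n"
    using connected assms rtrancl_imp_relpow unfolding connected_simple_graph_def by metis
  then show ?thesis unfolding vertex_dist_def by (rule LeastI_ex)
qed

lemma dist_V_refl [simp]: "dist_V u u = 0"
  using vertex_dist_le[of u u 0 E] by simp

lemma dist_V_eq_0: "u \<in> V \<Longrightarrow> v \<in> V \<Longrightarrow> dist_V u v = 0 \<longleftrightarrow> u = v"
  using dist_V_relpow[of u v] by auto

lemma dist_V_triangle:
  "u \<in> V \<Longrightarrow> v \<in> V \<Longrightarrow> w \<in> V \<Longrightarrow> dist_V u w \<le> dist_V u v + dist_V v w"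
  using dist_V_relpow[of u v] dist_V_relpow[of v w]
  by (intro vertex_dist_le) (auto simp: relpow_add)

lemma dist_V_edge: assumes "{u, v} \<in> E" shows "dist_V u v = 1"
proof -
  have "dist_V u v \<le> 1" using assms by (intro vertex_dist_le) (simp add: adjacency_def)
  moreover have "dist_V u v \<noteq> 0" using edge_vertices[OF assms] dist_V_eq_0 by blast
  ultimately show ?thesis by simp
qed

lemma dist_V_metric: "Metric_space V (\<lambda>u v. real (dist_V u v))"
  using dist_V_triangle
  by unfold_locales (auto simp: vertex_dist_commute dist_V_eq_0 simp flip: of_nat_add)

lemma supp_vertex_point [simp]: "supp (vertex_point v) = {v}"
  by (auto simp: supp_def vertex_point_def)

lemma vertex_point_in_R [simp]: "v \<in> V \<Longrightarrow> vertex_point v \<in> R"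
  using supp_vertex_point[of v] unfolding realization_def by (auto simp: vertex_point_def)

text \<open>The support may be a single endpoint, so the ends of an edge need no separate treatment
  when a point moves along it.\<close>

lemma realization_edgeI:
  assumes e: "{a, b} \<in> E" and "supp p \<subseteq> {a, b}" "\<And>v. 0 \<le> p v" "p a + p b = 1"
  shows "p \<in> R"
proof -
  have ab: "a \<in> V" "b \<in> V" "a \<noteq> b" using edge_vertices[OF e] by auto
  have "(\<Sum>v\<in>supp p. p v) = (\<Sum>v\<in>{a, b}. p v)"
    using assms by (intro sum.mono_neutral_left) (auto simp: supp_def)
  then have sum: "(\<Sum>v\<in>supp p. p v) = 1" using assms ab by simp
  have "supp p = {} \<or> supp p = {a} \<or> supp p = {b} \<or> supp p = {a, b}" using assms(2) by auto
  moreover have "supp p \<noteq> {}" using sum by auto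
  ultimately show ?thesis using sum assms ab by (auto simp: realization_def)
qed

lemma realizationE [consumes 1, case_names vertex edge]:
  assumes "p \<in> R"
  obtains v where "v \<in> V" "p = vertex_point v"
  | a b where "{a, b} \<in> E" "a \<noteq> b" "supp p = {a, b}"
proof -
  have sum: "(\<Sum>v\<in>supp p. p v) = 1" using assms by (simp add: realization_def)
  consider v where "v \<in> V" "supp p = {v}" | "supp p \<in> E"
    using assms by (auto simp: realization_def)
  then show thesis
  proof cases
    case 1
    then have "p = vertex_point v"
      using sum by (auto simp: supp_def vertex_point_def fun_eq_iff)
    then show ?thesis using that 1 by blast
  next
    case 2
    then show ?thesis using that by (metis edgeE)
  qed
qed

lemma realization_edge_sum:
  assumes "p \<in> R" and e: "{a, b} \<in> E" and "supp p \<subseteq> {a, b}"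
  shows "p a + p b = 1" "0 \<le> p a" "0 \<le> p b" "p a \<le> 1" "p b \<le> 1"
proof -
  have "(\<Sum>v\<in>supp p. p v) = (\<Sum>v\<in>{a, b}. p v)"
    using assms by (intro sum.mono_neutral_left) (auto simp: supp_def)
  then show s: "p a + p b = 1" using assms edge_vertices[OF e] by (simp add: realization_def)
  show "0 \<le> p a" "0 \<le> p b" using assms by (auto simp: realization_def)
  then show "p a \<le> 1" "p b \<le> 1" using s by auto
qed

lemma supp_in_V: "p \<in> R \<Longrightarrow> supp p \<subseteq> V"
  by (erule realizationE) (use edge_vertices in auto)

lemma finite_supp: "p \<in> R \<Longrightarrow> finite (supp p)"
  by (erule realizationE) auto

lemma supp_nonempty: "p \<in> R \<Longrightarrow> supp p \<noteq> {}"
  by (erule realizationE) auto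

lemma realization_le_1:
  assumes "p \<in> R" "u \<in> supp p"
  shows "0 \<le> p u \<and> p u \<le> 1"
  using assms(1)
proof (cases rule: realizationE)
  case (edge a b)
  then show ?thesis using realization_edge_sum[of p a b] assms by auto
qed (simp add: vertex_point_def)

lemma to_vertex_le:
  "p \<in> R \<Longrightarrow> u \<in> supp p \<Longrightarrow> to_vertex E p w \<le> 1 - p u + real (dist_V u w)"
  unfolding to_vertex_def by (intro Min_le finite_imageI finite_supp) auto

lemma to_vertexE:
  assumes "p \<in> R" obtains u where "u \<in> supp p" "to_vertex E p w = 1 - p u + real (dist_V u w)"
proof -
  have "to_vertex E p w \<in> (\<lambda>u. 1 - p u + real (dist_V u w)) ` supp p"
    unfolding to_vertex_def using finite_supp[OF assms] supp_nonempty[OF assms] by (intro Min_in) auto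
  then show thesis using that by auto
qed

lemma to_vertex_vertex_point [simp]: "to_vertex E (vertex_point v) w = real (dist_V v w)"
  by (simp add: to_vertex_def) (simp add: vertex_point_def)

text \<open>Both endpoints may be used even when \<open>p\<close> is one of them: an endpoint
  outside the support contributes 1 plus its distance to \<open>w\<close>, which is no less than the
  distance from the other endpoint.\<close>

lemma to_vertex_edge:
  assumes p: "p \<in> R" and e: "{a, b} \<in> E" and s: "supp p \<subseteq> {a, b}" and w: "w \<in> V"
  shows "to_vertex E p w = min (1 - p a + real (dist_V a w)) (1 - p b + real (dist_V b w))"
proof -
  note es = realization_edge_sum[OF p e s]
  have ab: "a \<in> V" "b \<in> V" using edge_vertices[OF e] by auto
  have d: "dist_V a b = 1" "dist_V b a = 1"
    using dist_V_edge[OF e] vertex_dist_commute[of E a b] by auto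
  have t: "real (dist_V a w) \<le> 1 + real (dist_V b w)" "real (dist_V b w) \<le> 1 + real (dist_V a w)"
    using dist_V_triangle[OF ab w] dist_V_triangle[OF ab(2,1) w] d by linarith+
  have "supp p = {a} \<or> supp p = {b} \<or> supp p = {a, b}" using s supp_nonempty[OF p] by auto
  moreover have "p b = 0" if "supp p = {a}" using that edge_vertices[OF e] by (auto simp: supp_def)
  moreover have "p a = 0" if "supp p = {b}" using that edge_vertices[OF e] by (auto simp: supp_def)
  ultimately show ?thesis
    using t es(1) by (auto simp: to_vertex_def)
qed

lemma to_vertex_lipschitz:
  assumes p: "p \<in> R" and w: "w \<in> V" "w' \<in> V"
  shows "to_vertex E p w \<le> to_vertex E p w' + real (dist_V w' w)"
proof -
  obtain u where u: "u \<in> supp p" "to_vertex E p w' = 1 - p u + real (dist_V u w')"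
    using p by (rule to_vertexE)
  have "u \<in> V" using u supp_in_V p by auto
  then show ?thesis
    using to_vertex_le[OF p u(1), of w] u(2) dist_V_triangle[of u w' w] w by linarith
qed

text \<open>If the optimal ways from \<open>p\<close> to \<open>w\<close> and to \<open>w'\<close>
  leave the edge at the same endpoint, the triangle inequality for vertices suffices. If they leave
  at different endpoints, the two partial lengths \<open>1 - p a\<close> and \<open>1 - p b\<close>
  add up to 1, the length of the edge.\<close>

lemma dist_V_le_to_vertex:
  assumes p: "p \<in> R" and w: "w \<in> V" "w' \<in> V"
  shows "real (dist_V w w') \<le> to_vertex E p w + to_vertex E p w'"
  using p
proof (cases rule: realizationE)
  case (vertex v)
  then show ?thesis
    using dist_V_triangle[of w v w'] w by (simp add: vertex_dist_commute[of E w v])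
next
  case (edge a b)
  have ab: "a \<in> V" "b \<in> V" using edge_vertices[OF edge(1)] by auto
  have d: "dist_V a b = 1" "dist_V b a = 1"
    using dist_V_edge[OF edge(1)] vertex_dist_commute[of E a b] by auto
  have t: "real (dist_V w w') \<le> real (dist_V x w) + real (dist_V x w')" if "x \<in> V" for x
    using dist_V_triangle[of w x w'] w that by (simp add: vertex_dist_commute[of E w x])
  have t': "real (dist_V a w') \<le> 1 + real (dist_V b w')" "real (dist_V b w') \<le> 1 + real (dist_V a w')"
    using dist_V_triangle[OF ab w(2)] dist_V_triangle[OF ab(2,1) w(2)] d by linarith+
  show ?thesis
    using to_vertex_edge[OF p edge(1)] edge(3) w t[OF ab(1)] t[OF ab(2)] t'
      realization_edge_sum[OF p edge(1)] by (simp add: min_def)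
qed

text \<open>The coordinates of each point on the edge sum to 1, so the two coordinate differences
  are opposite and half of the sum of their absolute values is either one.\<close>

lemma dist_R_edge:
  assumes p: "p \<in> R" and q: "q \<in> R" and e: "{a, b} \<in> E"
    and s: "supp p \<subseteq> {a, b}" "supp q \<subseteq> {a, b}"
  shows "dist_R p q = \<bar>p a - q a\<bar>"
proof -
  have "(\<Sum>v\<in>supp p \<union> supp q. \<bar>p v - q v\<bar>) = (\<Sum>v\<in>{a, b}. \<bar>p v - q v\<bar>)"
    using s by (intro sum.mono_neutral_left) (auto simp: supp_def)
  also have "\<dots> = \<bar>p a - q a\<bar> + \<bar>p b - q b\<bar>" using edge_vertices[OF e] by simp
  also have "p b - q b = - (p a - q a)"
    using realization_edge_sum(1)[OF p e s(1)] realization_edge_sum(1)[OF q e s(2)] by linarith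
  finally show ?thesis using assms by (auto simp: graph_dist_def simp del: minus_diff_eq)
qed

definition common_edge :: "('v \<Rightarrow> real) \<Rightarrow> ('v \<Rightarrow> real) \<Rightarrow> bool" where
  "common_edge p q \<longleftrightarrow> (\<exists>e\<in>E. supp p \<subseteq> e \<and> supp q \<subseteq> e)"

lemma common_edgeE:
  assumes "common_edge p q"
  obtains a b where "{a, b} \<in> E" "supp p \<subseteq> {a, b}" "supp q \<subseteq> {a, b}"
  using assms edgeE unfolding common_edge_def by metis

lemma dist_R_off_edge:
  assumes p: "p \<in> R" and q: "q \<in> R" and "\<not> common_edge p q"
  shows "u \<in> supp p \<Longrightarrow> v \<in> supp q \<Longrightarrow> dist_R p q \<le> 1 - p u + real (dist_V u v) + (1 - q v)"
    "\<exists>u\<in>supp p. \<exists>v\<in>supp q. dist_R p q = 1 - p u + real (dist_V u v) + (1 - q v)"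
proof -
  let ?A = "(\<lambda>(u, v). (1 - p u) + real (vertex_dist E u v) + (1 - q v)) ` (supp p \<times> supp q)"
  have eq: "dist_R p q = Min ?A" using assms by (auto simp: graph_dist_def common_edge_def)
  have fin: "finite ?A" using finite_supp p q by auto
  show "u \<in> supp p \<Longrightarrow> v \<in> supp q \<Longrightarrow> dist_R p q \<le> 1 - p u + real (dist_V u v) + (1 - q v)"
    unfolding eq using fin by (intro Min_le) (auto intro!: image_eqI[of _ _ "(u, v)"])
  have "Min ?A \<in> ?A" using fin supp_nonempty p q by (intro Min_in) auto
  then show "\<exists>u\<in>supp p. \<exists>v\<in>supp q. dist_R p q = 1 - p u + real (dist_V u v) + (1 - q v)"
    unfolding eq by (elim imageE) auto
qed

lemma dist_R_le_to_vertex: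
  assumes p: "p \<in> R" and q: "q \<in> R" and w: "w \<in> V"
  shows "dist_R p q \<le> to_vertex E p w + to_vertex E q w"
proof (cases "common_edge p q")
  case True
  then obtain a b where e: "{a, b} \<in> E" "supp p \<subseteq> {a, b}" "supp q \<subseteq> {a, b}" by (rule common_edgeE)
  have ab: "a \<in> V" "b \<in> V" using edge_vertices[OF e(1)] by auto
  \<comment> \<open>Going to \<open>w\<close> from one endpoint and back to the other is at least as
    long as the edge itself.\<close>
  have "1 \<le> real (dist_V a w) + real (dist_V b w)"
    using dist_V_triangle[OF ab(1) w ab(2)] dist_V_edge[OF e(1)] vertex_dist_commute[of E b w]
    by linarith
  then show ?thesis
    using to_vertex_edge[OF p e(1,2) w] to_vertex_edge[OF q e(1,3) w]
      realization_edge_sum[OF p e(1,2)] realization_edge_sum[OF q e(1,3)]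
      dist_R_edge[OF p q e] by (simp add: min_def) linarith
next
  case False
  obtain u where u: "u \<in> supp p" "to_vertex E p w = 1 - p u + real (dist_V u w)"
    using p by (rule to_vertexE)
  obtain v where v: "v \<in> supp q" "to_vertex E q w = 1 - q v + real (dist_V v w)"
    using q by (rule to_vertexE)
  have "u \<in> V" "v \<in> V" using u v supp_in_V p q by auto
  then show ?thesis
    using dist_R_off_edge(1)[OF p q False u(1) v(1)] u(2) v(2) dist_V_triangle[of u w v] w
      vertex_dist_commute[of E v w] by linarith
qed

text \<open>Without a common edge a shortest path passes through a vertex; the witness is the vertex
  through which it enters the cell of \<open>q\<close>. This splitting reduces the triangle
  inequality to facts about \<open>to_vertex\<close>.\<close>

lemma dist_R_off_edgeE:
  assumes p: "p \<in> R" and q: "q \<in> R" and "\<not> common_edge p q"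
  obtains w where "w \<in> V" "dist_R p q = to_vertex E p w + to_vertex E q w"
proof -
  obtain u v where uv: "u \<in> supp p" "v \<in> supp q"
    "dist_R p q = 1 - p u + real (dist_V u v) + (1 - q v)"
    using dist_R_off_edge(2)[OF assms] by blast
  have "v \<in> V" using uv(2) supp_in_V[OF q] by auto
  moreover have "dist_R p q \<ge> to_vertex E p v + to_vertex E q v"
    using to_vertex_le[OF p uv(1), of v] to_vertex_le[OF q uv(2), of v] uv(3) by simp
  ultimately show thesis
    using that dist_R_le_to_vertex[OF p q, of v] by force
qed

text \<open>Each of the two terms in the minimum of \<open>to_vertex_edge\<close> changes by exactly
  \<open>dist_R p q\<close> in absolute value when \<open>p\<close> is replaced by
  \<open>q\<close>.\<close>

lemma to_vertex_diff_edge: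
  assumes p: "p \<in> R" and q: "q \<in> R" and "common_edge p q" and w: "w \<in> V"
  shows "to_vertex E p w \<le> to_vertex E q w + dist_R p q"
proof -
  obtain a b where e: "{a, b} \<in> E" "supp p \<subseteq> {a, b}" "supp q \<subseteq> {a, b}"
    using assms(3) by (rule common_edgeE)
  show ?thesis
    using to_vertex_edge[OF p e(1,2) w] to_vertex_edge[OF q e(1,3) w]
      realization_edge_sum[OF p e(1,2)] realization_edge_sum[OF q e(1,3)]
      dist_R_edge[OF p q e] by (simp add: min_def) linarith
qed

lemma dist_R_commute: "dist_R p q = dist_R q p"
proof -
  have "(\<lambda>(u, v). (1 - p u) + real (vertex_dist E u v) + (1 - q v)) ` (supp p \<times> supp q)
      = (\<lambda>(u, v). (1 - q u) + real (vertex_dist E u v) + (1 - p v)) ` (supp q \<times> supp p)"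
    (is "?f ` _ = ?g ` _")
  proof -
    have "?f (u, v) = ?g (v, u)" for u v by (simp add: vertex_dist_commute[of E u v])
    then show ?thesis by (force simp: image_iff)
  qed
  then have min: "Min ((\<lambda>(u, v). (1 - p u) + real (vertex_dist E u v) + (1 - q v)) ` (supp p \<times> supp q))
      = Min ((\<lambda>(u, v). (1 - q u) + real (vertex_dist E u v) + (1 - p v)) ` (supp q \<times> supp p))"
    by (rule arg_cong)
  have sum: "(\<Sum>v\<in>supp p \<union> supp q. \<bar>p v - q v\<bar>) = (\<Sum>v\<in>supp q \<union> supp p. \<bar>q v - p v\<bar>)"
    by (simp add: Un_commute abs_minus_commute)
  show ?thesis
    unfolding graph_dist_def min sum by (intro if_cong refl) auto
qed

lemma to_vertex_nonneg: "p \<in> R \<Longrightarrow> 0 \<le> to_vertex E p w"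
  using to_vertexE[of p w] realization_le_1 by (smt (verit) of_nat_0_le_iff)

lemma dist_R_nonneg: "0 \<le> dist_R p q"
proof (cases "p \<in> R \<and> q \<in> R")
  case True
  then have p: "p \<in> R" and q: "q \<in> R" by auto
  show ?thesis
  proof (cases "common_edge p q")
    case True
    then show ?thesis by (rule common_edgeE) (simp add: dist_R_edge[OF p q])
  next
    case False
    then show ?thesis
      using dist_R_off_edgeE[OF p q] to_vertex_nonneg p q by (metis add_nonneg_nonneg)
  qed
qed (auto simp: graph_dist_def)

lemma dist_R_eq_0: assumes p: "p \<in> R" and q: "q \<in> R" and 0: "dist_R p q = 0" shows "p = q"
proof (cases "common_edge p q")
  case True
  then obtain a b where e: "{a, b} \<in> E" "supp p \<subseteq> {a, b}" "supp q \<subseteq> {a, b}" by (rule common_edgeE)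
  show ?thesis
  proof
    fix w show "p w = q w"
    proof (cases "w \<in> {a, b}")
      case True
      then show ?thesis
        using dist_R_edge[OF p q e] 0 realization_edge_sum(1)[OF p e(1,2)]
          realization_edge_sum(1)[OF q e(1,3)] by auto
    next
      case False
      then have "w \<notin> supp p" "w \<notin> supp q" using e by auto
      then show ?thesis by (simp add: supp_def)
    qed
  qed
next
  case False
  obtain u v where uv: "u \<in> supp p" "v \<in> supp q"
    "dist_R p q = 1 - p u + real (dist_V u v) + (1 - q v)"
    using dist_R_off_edge(2)[OF p q False] by blast
  \<comment> \<open>The three summands are nonnegative and add up to 0, so each point carries its
    whole weight at one vertex.\<close>
  have 1: "p u = 1" "q v = 1" "dist_V u v = 0"
    using uv 0 realization_le_1[OF p uv(1)] realization_le_1[OF q uv(2)] by auto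
  have "u = v" using 1(3) dist_V_eq_0 supp_in_V p q uv by blast
  have vp: "r = vertex_point x" if "r \<in> R" "r x = 1" for r x
    using that(1)
  proof (cases rule: realizationE)
    case (vertex v) then show ?thesis using that by (auto simp: vertex_point_def split: if_splits)
  next
    case (edge a b)
    then have sum: "r a + r b = 1" and "r a \<noteq> 0" "r b \<noteq> 0"
      using realization_edge_sum(1)[OF that(1) edge(1)] by (auto simp: supp_def)
    then have "r a \<noteq> 1" "r b \<noteq> 1" by linarith+
    moreover have "x \<in> supp r" using that(2) by (simp add: supp_def)
    then have "x = a \<or> x = b" using edge(3) by simp
    ultimately show ?thesis using that(2) by metis
  qed
  show ?thesis using vp[OF p 1(1)] vp[OF q 1(2)] \<open>u = v\<close> by metis
qed

lemma dist_R_refl: assumes p: "p \<in> R" shows "dist_R p p = 0"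
proof (cases "common_edge p p")
  case True
  then show ?thesis by (rule common_edgeE) (simp add: dist_R_edge[OF p p])
next
  \<comment> \<open>A point that lies on no edge is an isolated vertex, where the second formula for
    the distance applies.\<close>
  case False
  show ?thesis using p
  proof (cases rule: realizationE)
    case (vertex v)
    then show ?thesis
      using dist_R_le_to_vertex[OF p p, of v] dist_R_nonneg[of p p] by simp
  next
    case (edge a b)
    then show ?thesis using False by (auto simp: common_edge_def)
  qed
qed

text \<open>A pair without a common edge is split at a vertex, and the inequality becomes one about
  distances to that vertex. If both pairs have common edges, then either \<open>q\<close> is a
  vertex, through which one can pass, or \<open>q\<close> is interior to an edge, which is then the
  only edge containing it, and all three points lie on one segment.\<close>

lemma dist_R_triangle:
  assumes p: "p \<in> R" and q: "q \<in> R" and r: "r \<in> R"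
  shows "dist_R p r \<le> dist_R p q + dist_R q r"
proof (cases "common_edge p q"; cases "common_edge q r")
  assume pq: "common_edge p q" and qr: "common_edge q r"
  show ?thesis using q
  proof (cases rule: realizationE)
    case (vertex v)
    have "to_vertex E p v \<le> dist_R p q" "to_vertex E r v \<le> dist_R q r"
      using to_vertex_diff_edge[OF p q pq, of v] to_vertex_diff_edge[OF r q _, of v] qr vertex
      by (auto simp: common_edge_def dist_R_commute conj_commute)
    then show ?thesis using dist_R_le_to_vertex[OF p r, of v] vertex by linarith
  next
    case (edge a b)
    have "e = {a, b}" if "e \<in> E" "{a, b} \<subseteq> e" for e
      using that(1) by (rule edgeE) (use that(2) edge(2) in auto)
    then have s: "supp p \<subseteq> {a, b}" "supp r \<subseteq> {a, b}"
      using pq qr edge(3) unfolding common_edge_def by metis+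
    show ?thesis
      using dist_R_edge[OF p r edge(1) s] dist_R_edge[OF p q edge(1) s(1)]
        dist_R_edge[OF q r edge(1) _ s(2)] edge(3) by simp
  qed
next
  assume pq: "common_edge p q" and qr: "\<not> common_edge q r"
  obtain w where w: "w \<in> V" "dist_R q r = to_vertex E q w + to_vertex E r w"
    using dist_R_off_edgeE[OF q r qr] .
  then show ?thesis
    using to_vertex_diff_edge[OF p q pq w(1)] dist_R_le_to_vertex[OF p r w(1)] by linarith
next
  assume pq: "\<not> common_edge p q" and qr: "common_edge q r"
  obtain w where w: "w \<in> V" "dist_R p q = to_vertex E p w + to_vertex E q w"
    using dist_R_off_edgeE[OF p q pq] .
  moreover have "common_edge r q" using qr by (auto simp: common_edge_def)
  ultimately show ?thesis
    using to_vertex_diff_edge[OF r q _ w(1)] dist_R_le_to_vertex[OF p r w(1)] dist_R_commute[of r q]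
    by linarith
next
  assume pq: "\<not> common_edge p q" and qr: "\<not> common_edge q r"
  obtain w where w: "w \<in> V" "dist_R p q = to_vertex E p w + to_vertex E q w"
    using dist_R_off_edgeE[OF p q pq] .
  obtain w' where w': "w' \<in> V" "dist_R q r = to_vertex E q w' + to_vertex E r w'"
    using dist_R_off_edgeE[OF q r qr] .
  show ?thesis
    using dist_V_le_to_vertex[OF q w(1) w'(1)] to_vertex_lipschitz[OF r w(1) w'(1)]
      dist_R_le_to_vertex[OF p r w(1)] w(2) w'(2) vertex_dist_commute[of E w w'] by linarith
qed

sublocale realization: Metric_space R dist_R
  by unfold_locales
    (auto simp: dist_R_nonneg dist_R_refl dist_R_triangle intro: dist_R_commute dist_R_eq_0)

lemma dist_R_vertex_point:
  assumes p: "p \<in> R" and v: "v \<in> V"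
  shows "dist_R p (vertex_point v) = to_vertex E p v"
proof (rule antisym)
  have q: "vertex_point v \<in> R" using v by simp
  show "dist_R p (vertex_point v) \<le> to_vertex E p v"
    using dist_R_le_to_vertex[OF p q v] by simp
  show "to_vertex E p v \<le> dist_R p (vertex_point v)"
  proof (cases "common_edge p (vertex_point v)")
    case True
    then show ?thesis using to_vertex_diff_edge[OF p q True v] by simp
  next
    case False
    then obtain w where w: "w \<in> V"
      "dist_R p (vertex_point v) = to_vertex E p w + to_vertex E (vertex_point v) w"
      using dist_R_off_edgeE[OF p q] by blast
    then show ?thesis
      using to_vertex_lipschitz[OF p v w(1)] vertex_dist_commute[of E w v] by simp
  qed
qed

lemma dist_R_vertex_points [simp]:
  "u \<in> V \<Longrightarrow> v \<in> V \<Longrightarrow> dist_R (vertex_point u) (vertex_point v) = real (dist_V u v)"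
  by (simp add: dist_R_vertex_point)

section \<open>Geodesics in the realization\<close>

lemma has_geodesic_edge:
  assumes p: "p \<in> R" and q: "q \<in> R" and e: "{a, b} \<in> E"
    and s: "supp p \<subseteq> {a, b}" "supp q \<subseteq> {a, b}"
  shows "has_geodesic R dist_R p q"
proof -
  define L where "L = dist_R p q"
  have L: "L = \<bar>p a - q a\<bar>" unfolding L_def by (rule dist_R_edge[OF p q e s])
  \<comment> \<open>For \<open>L = 0\<close> the quotient \<open>t / L\<close> is 0, so the formula
    also covers the constant path.\<close>
  define \<gamma> where "\<gamma> = (\<lambda>t w. (1 - t / L) * p w + (t / L) * q w)"
  have sg: "supp (\<gamma> t) \<subseteq> {a, b}" for t
    using s by (force simp: \<gamma>_def supp_def)
  have \<gamma>R: "\<gamma> t \<in> R" if "t \<in> {0..L}" for t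
  proof (rule realization_edgeI[OF e sg])
    have "0 \<le> t / L" "t / L \<le> 1" using that by (auto simp: divide_le_eq_1)
    moreover have "0 \<le> p v" "0 \<le> q v" for v using p q by (auto simp: realization_def)
    ultimately show "0 \<le> \<gamma> t v" for v by (simp add: \<gamma>_def del: times_divide_eq_left)
    have "\<gamma> t a + \<gamma> t b = (1 - t / L) * (p a + p b) + (t / L) * (q a + q b)"
      by (simp add: \<gamma>_def algebra_simps)
    then show "\<gamma> t a + \<gamma> t b = 1"
      using realization_edge_sum(1)[OF p e s(1)] realization_edge_sum(1)[OF q e s(2)] by simp
  qed
  have "dist_R (\<gamma> x) (\<gamma> t) = \<bar>x - t\<bar>" if "x \<in> {0..L}" "t \<in> {0..L}" for x t
  proof (cases "L = 0")
    case True
    then show ?thesis using that dist_R_refl[OF \<gamma>R[of x]] by simp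
  next
    case False
    have "\<gamma> x a - \<gamma> t a = (x - t) / L * (q a - p a)"
      by (simp add: \<gamma>_def field_simps diff_divide_distrib)
    then have "\<bar>\<gamma> x a - \<gamma> t a\<bar> = \<bar>x - t\<bar> / L * L"
      using L by (simp add: abs_mult abs_minus_commute)
    then show ?thesis
      using dist_R_edge[OF \<gamma>R[OF that(1)] \<gamma>R[OF that(2)] e sg sg] False by simp
  qed
  moreover have "\<gamma> 0 = p" by (simp add: \<gamma>_def)
  moreover have "\<gamma> L = q"
    using dist_R_eq_0[OF p q] L_def by (cases "L = 0") (auto simp: \<gamma>_def)
  ultimately show ?thesis
    unfolding has_geodesic_def L_def[symmetric] using \<gamma>R by blast
qed

text \<open>The first edge of a shortest walk leads to a vertex exactly one nearer to
  \<open>v\<close>, so this edge and a geodesic from there satisfy the additivity needed for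
  concatenation.\<close>

lemma has_geodesic_vertices:
  "u \<in> V \<Longrightarrow> v \<in> V \<Longrightarrow> has_geodesic R dist_R (vertex_point u) (vertex_point v)"
proof (induction "dist_V u v" arbitrary: u)
  case 0
  then show ?case using dist_V_eq_0 realization.has_geodesic_refl by (metis vertex_point_in_R)
next
  case (Suc n)
  have "(u, v) \<in> adjacency E ^^ Suc n" using dist_V_relpow[OF Suc.prems] Suc.hyps(2) by simp
  then obtain u' where u': "(u, u') \<in> adjacency E" "(u', v) \<in> adjacency E ^^ n"
    by (rule relpow_Suc_E2)
  have e: "{u, u'} \<in> E" using u'(1) by (simp add: adjacency_def)
  have V: "u' \<in> V" using edge_vertices[OF e] by simp
  have d: "dist_V u' v = n"
    using vertex_dist_le[OF u'(2)] dist_V_triangle[of u u' v] dist_V_edge[OF e] Suc V by linarith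
  have "has_geodesic R dist_R (vertex_point u) (vertex_point u')"
    by (rule has_geodesic_edge[OF _ _ e]) (use V Suc.prems in auto)
  moreover have "has_geodesic R dist_R (vertex_point u') (vertex_point v)"
    using Suc.hyps(1) d V Suc.prems by blast
  ultimately show ?case
    by (rule realization.has_geodesic_concat[rotated 3])
      (use Suc V d dist_V_edge[OF e] in auto)
qed

lemma has_geodesic_to_vertex:
  assumes "p \<in> R" "u \<in> supp p"
  shows "has_geodesic R dist_R p (vertex_point u)" "has_geodesic R dist_R (vertex_point u) p"
proof -
  have "has_geodesic R dist_R p (vertex_point u) \<and> has_geodesic R dist_R (vertex_point u) p"
    using assms(1)
  proof (cases rule: realizationE)
    case (vertex v)
    then show ?thesis using assms realization.has_geodesic_refl by simp
  next
    case (edge a b)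
    then have "u \<in> V" "u = a \<or> u = b" using assms edge_vertices by auto
    then show ?thesis
      using has_geodesic_edge[OF _ _ edge(1)] assms(1) edge(3) by auto
  qed
  then show "has_geodesic R dist_R p (vertex_point u)" "has_geodesic R dist_R (vertex_point u) p"
    by auto
qed

lemma geodesic_realization: "geodesic_space R dist_R"
proof (rule geodesic_spaceI[OF realization.Metric_space_axioms])
  fix p q assume p: "p \<in> R" and q: "q \<in> R"
  show "has_geodesic R dist_R p q"
  proof (cases "common_edge p q")
    case True
    then show ?thesis by (rule common_edgeE) (rule has_geodesic_edge[OF p q])
  next
    case False
    obtain u v where uv: "u \<in> supp p" "v \<in> supp q"
      "dist_R p q = 1 - p u + real (dist_V u v) + (1 - q v)"
      using dist_R_off_edge(2)[OF p q False] by blast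
    have V: "u \<in> V" "v \<in> V" using uv supp_in_V p q by auto
    have VR: "vertex_point u \<in> R" "vertex_point v \<in> R" using V by auto
    have 1: "dist_R p (vertex_point u) \<le> 1 - p u" "dist_R q (vertex_point v) \<le> 1 - q v"
      using to_vertex_le[OF p uv(1), of u] to_vertex_le[OF q uv(2), of v] p q V
      by (auto simp: dist_R_vertex_point)
    have 2: "dist_R (vertex_point v) q \<le> 1 - q v" using 1 dist_R_commute by simp
    \<comment> \<open>The upper bounds for the three legs through \<open>u\<close> and
      \<open>v\<close> add up to \<open>dist_R p q\<close>; the triangle inequality therefore forces
      equality on each leg.\<close>
    have 3: "dist_R (vertex_point u) q = real (dist_V u v) + dist_R (vertex_point v) q"
      and 4: "dist_R p q = dist_R p (vertex_point u) + dist_R (vertex_point u) q"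
      using dist_R_triangle[OF VR q] dist_R_triangle[OF p VR(1) q] 1 2 uv(3) V by auto
    have "has_geodesic R dist_R (vertex_point u) q"
      using realization.has_geodesic_concat[OF VR q has_geodesic_vertices[OF V]
          has_geodesic_to_vertex(2)[OF q uv(2)]] 3 V by simp
    then show ?thesis
      by (rule realization.has_geodesic_concat[OF p VR(1) q has_geodesic_to_vertex(1)[OF p uv(1)] _ 4])
  qed
qed

end

section \<open>Actions by graph automorphisms\<close>

definition vertex_action ::
    "'v set \<Rightarrow> 'v set set \<Rightarrow> ('g \<Rightarrow> 'v \<Rightarrow> 'v) \<Rightarrow> ('g, 'v) isoact" where
  "vertex_action V E \<phi> = \<lparr>points = V, metric = (\<lambda>u v. real (vertex_dist E u v)), act = \<phi>\<rparr>"

lemma vertex_action_simps [simp]: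
  "points (vertex_action V E \<phi>) = V"
  "metric (vertex_action V E \<phi>) u v = real (vertex_dist E u v)"
  "act (vertex_action V E \<phi>) = \<phi>"
  by (auto simp: vertex_action_def)

locale graph_with_action = connected_graph V E
  for K :: "'g monoid" and V :: "'v set" and E :: "'v set set" and \<phi> :: "'g \<Rightarrow> 'v \<Rightarrow> 'v" +
  assumes automorphism_action: "graph_automorphism_action K V E \<phi>"
begin

lemma action: "group_action K V \<phi>"
  using automorphism_action by (simp add: graph_automorphism_action_def)

sublocale K: group K
  using action by (rule group_action_group)

lemmas \<phi>_closed [simp] = group_action_closed[OF action]
lemmas \<phi>_one = group_action_one[OF action]
lemmas \<phi>_mult = group_action_mult[OF action]
lemmas \<phi>_inv [simp] = group_action_inv[OF action]

lemma \<phi>_edge: assumes "g \<in> carrier K" "{u, v} \<in> E" shows "{\<phi> g u, \<phi> g v} \<in> E"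
proof -
  have "\<phi> g ` {u, v} \<in> E"
    using automorphism_action assms unfolding graph_automorphism_action_def by blast
  then show ?thesis by simp
qed

lemma relpow_\<phi>:
  "g \<in> carrier K \<Longrightarrow> (u, v) \<in> adjacency E ^^ n \<Longrightarrow> (\<phi> g u, \<phi> g v) \<in> adjacency E ^^ n"
proof (induction n arbitrary: v)
  case (Suc n)
  then obtain w where w: "(u, w) \<in> adjacency E ^^ n" "(w, v) \<in> adjacency E"
    by (auto elim: relpow_Suc_E)
  then have "(\<phi> g w, \<phi> g v) \<in> adjacency E"
    using \<phi>_edge[OF Suc.prems(1)] by (simp add: adjacency_def)
  then show ?case using Suc.IH[OF Suc.prems(1) w(1)] by (rule relpow_Suc_I[rotated])
qed auto

lemma dist_V_\<phi>:
  assumes g: "g \<in> carrier K" and uv: "u \<in> V" "v \<in> V"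
  shows "dist_V (\<phi> g u) (\<phi> g v) = dist_V u v"
proof (rule antisym)
  show "dist_V (\<phi> g u) (\<phi> g v) \<le> dist_V u v"
    by (rule vertex_dist_le[OF relpow_\<phi>[OF g dist_V_relpow[OF uv]]])
  have "dist_V (\<phi> (inv\<^bsub>K\<^esub> g) (\<phi> g u)) (\<phi> (inv\<^bsub>K\<^esub> g) (\<phi> g v)) \<le> dist_V (\<phi> g u) (\<phi> g v)"
    using g uv by (intro vertex_dist_le[OF relpow_\<phi>[OF _ dist_V_relpow]]) auto
  then show "dist_V u v \<le> dist_V (\<phi> g u) (\<phi> g v)" using g uv by simp
qed

lemma isometric_vertex_action: "isometric_action K (vertex_action V E \<phi>)"
  using action dist_V_metric dist_V_\<phi> connected
  by (simp add: isometric_action_def vertex_action_def connected_simple_graph_def)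

definition \<Phi> :: "'g \<Rightarrow> ('v \<Rightarrow> real) \<Rightarrow> 'v \<Rightarrow> real" where
  "\<Phi> g = act (graph_action K V E \<phi>) g"

lemma \<Phi>_eq: "p \<in> R \<Longrightarrow> \<Phi> g p = (\<lambda>v. if v \<in> V then p (\<phi> (inv\<^bsub>K\<^esub> g) v) else 0)"
  by (simp add: \<Phi>_def graph_action_def)

lemma \<Phi>_apply: "p \<in> R \<Longrightarrow> g \<in> carrier K \<Longrightarrow> v \<in> V \<Longrightarrow> \<Phi> g p (\<phi> g v) = p v"
  by (simp add: \<Phi>_eq)

lemma supp_\<Phi>: assumes p: "p \<in> R" and g: "g \<in> carrier K" shows "supp (\<Phi> g p) = \<phi> g ` supp p"
proof (intro equalityI subsetI)
  fix v assume "v \<in> supp (\<Phi> g p)"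
  then have "v \<in> V" "p (\<phi> (inv\<^bsub>K\<^esub> g) v) \<noteq> 0" using p by (auto simp: supp_def \<Phi>_eq split: if_splits)
  then show "v \<in> \<phi> g ` supp p"
    using g by (intro image_eqI[of _ _ "\<phi> (inv\<^bsub>K\<^esub> g) v"]) (auto simp: supp_def)
next
  fix v assume "v \<in> \<phi> g ` supp p"
  then obtain u where "v = \<phi> g u" "u \<in> supp p" by auto
  then show "v \<in> supp (\<Phi> g p)" using p g supp_in_V[OF p] by (auto simp: supp_def \<Phi>_apply subset_iff)
qed

lemma \<Phi>_vertex_point:
  assumes "g \<in> carrier K" "v \<in> V" shows "\<Phi> g (vertex_point v) = vertex_point (\<phi> g v)"
proof
  fix w
  have "\<phi> (inv\<^bsub>K\<^esub> g) w = v \<longleftrightarrow> w = \<phi> g v" if "w \<in> V" using assms that by (metis \<phi>_inv)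
  then show "\<Phi> g (vertex_point v) w = vertex_point (\<phi> g v) w"
    using assms by (auto simp: \<Phi>_eq) (auto simp: vertex_point_def)
qed

lemma \<Phi>_closed: assumes p: "p \<in> R" and g: "g \<in> carrier K" shows "\<Phi> g p \<in> R"
  using p
proof (cases rule: realizationE)
  case (vertex v)
  then show ?thesis using g by (simp add: \<Phi>_vertex_point)
next
  case (edge a b)
  have ab: "a \<in> V" "b \<in> V" using edge_vertices[OF edge(1)] by auto
  show ?thesis
  proof (rule realization_edgeI[OF \<phi>_edge[OF g edge(1)]])
    show "supp (\<Phi> g p) \<subseteq> {\<phi> g a, \<phi> g b}" using supp_\<Phi>[OF p g] edge(3) by auto
    show "0 \<le> \<Phi> g p v" for v using p by (simp add: \<Phi>_eq) (simp add: realization_def)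
    show "\<Phi> g p (\<phi> g a) + \<Phi> g p (\<phi> g b) = 1"
      using realization_edge_sum(1)[OF p edge(1)] edge(3) ab p g by (simp add: \<Phi>_apply)
  qed
qed

lemma graph_group_action: "group_action K R \<Phi>"
proof (rule group_actionI)
  show "group K" by (rule K.group_axioms)
  show "\<Phi> g \<in> extensional R" for g by (simp add: \<Phi>_def graph_action_def)
  show "\<Phi> g p \<in> R" if "g \<in> carrier K" "p \<in> R" for g p using that \<Phi>_closed by simp
  have z: "p v = 0" if "p \<in> R" "v \<notin> V" for p v
    using supp_in_V[OF that(1)] that(2) by (auto simp: supp_def)
  show "\<Phi> \<one>\<^bsub>K\<^esub> p = p" if "p \<in> R" for p
    using that z by (auto simp: \<Phi>_eq \<phi>_one fun_eq_iff)
  show "\<Phi> (g \<otimes>\<^bsub>K\<^esub> h) p = \<Phi> g (\<Phi> h p)" if "g \<in> carrier K" "h \<in> carrier K" "p \<in> R" for g h p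
    using that \<Phi>_closed[of p h] by (auto simp: \<Phi>_eq \<phi>_mult K.inv_mult_group fun_eq_iff)
qed

lemma dist_R_\<Phi>_le:
  assumes p: "p \<in> R" and q: "q \<in> R" and g: "g \<in> carrier K"
  shows "dist_R (\<Phi> g p) (\<Phi> g q) \<le> dist_R p q"
proof (cases "common_edge p q")
  case True
  then obtain a b where e: "{a, b} \<in> E" "supp p \<subseteq> {a, b}" "supp q \<subseteq> {a, b}" by (rule common_edgeE)
  have a: "a \<in> V" using edge_vertices[OF e(1)] by auto
  have "dist_R (\<Phi> g p) (\<Phi> g q) = \<bar>\<Phi> g p (\<phi> g a) - \<Phi> g q (\<phi> g a)\<bar>"
    by (rule dist_R_edge[OF \<Phi>_closed[OF p g] \<Phi>_closed[OF q g] \<phi>_edge[OF g e(1)]])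
      (use supp_\<Phi>[OF p g] supp_\<Phi>[OF q g] e in auto)
  then show ?thesis using dist_R_edge[OF p q e] p q g a by (simp add: \<Phi>_apply)
next
  case False
  then obtain w where w: "w \<in> V" "dist_R p q = to_vertex E p w + to_vertex E q w"
    using dist_R_off_edgeE[OF p q] by blast
  have "to_vertex E (\<Phi> g r) (\<phi> g w) \<le> to_vertex E r w" if r: "r \<in> R" for r
  proof -
    obtain u where u: "u \<in> supp r" "to_vertex E r w = 1 - r u + real (dist_V u w)"
      using r by (rule to_vertexE)
    have "u \<in> V" using u(1) supp_in_V[OF r] by auto
    then show ?thesis
      using to_vertex_le[OF \<Phi>_closed[OF r g], of "\<phi> g u" "\<phi> g w"] u supp_\<Phi>[OF r g] r g w(1)
      by (simp add: \<Phi>_apply dist_V_\<phi>)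
  qed
  then show ?thesis
    using dist_R_le_to_vertex[OF \<Phi>_closed[OF p g] \<Phi>_closed[OF q g], of "\<phi> g w"] w p q g
    by (smt (verit) \<phi>_closed)
qed

lemma isometric_graph_action: "isometric_action K (graph_action K V E \<phi>)"
proof -
  have "dist_R (\<Phi> g p) (\<Phi> g q) = dist_R p q" if g: "g \<in> carrier K" and p: "p \<in> R" and q: "q \<in> R"
    for g p q
  proof (rule antisym)
    show "dist_R (\<Phi> g p) (\<Phi> g q) \<le> dist_R p q" by (rule dist_R_\<Phi>_le[OF p q g])
    show "dist_R p q \<le> dist_R (\<Phi> g p) (\<Phi> g q)"
      using dist_R_\<Phi>_le[OF \<Phi>_closed[OF p g] \<Phi>_closed[OF q g] K.inv_closed[OF g]]
        group_action_inv(1)[OF graph_group_action g] p q by simp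
  qed
  moreover obtain v where "v \<in> V" using connected by (auto simp: connected_simple_graph_def)
  then have "R \<noteq> {}" using vertex_point_in_R by blast
  moreover have "act (graph_action K V E \<phi>) = \<Phi>" by (simp add: \<Phi>_def fun_eq_iff)
  moreover have "points (graph_action K V E \<phi>) = R" "metric (graph_action K V E \<phi>) = dist_R"
    by (auto simp: graph_action_def)
  ultimately show ?thesis
    using graph_group_action realization.Metric_space_axioms by (simp add: isometric_action_def)
qed

lemma geodesic_graph_action: "geodesic_action K (graph_action K V E \<phi>)"
  using isometric_graph_action geodesic_realization
  by (simp add: geodesic_action_def graph_action_def)

text \<open>The vertices sit isometrically in the graph and every point is within 1 of one. Later
  estimates can thus be made on vertices, with walks and natural numbers in place of barycentric
  coordinates.\<close>

lemma equivalent_vertex_graph_action: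
  "equivalent_actions K (vertex_action V E \<phi>) (graph_action K V E \<phi>)"
proof (rule equivalent_actionsI[OF isometric_vertex_action isometric_graph_action,
      where f = vertex_point and B = 0 and \<epsilon> = 1])
  have pm: "points (graph_action K V E \<phi>) = R" "metric (graph_action K V E \<phi>) = dist_R"
    by (auto simp: graph_action_def)
  show "vertex_point \<in> points (vertex_action V E \<phi>) \<rightarrow> points (graph_action K V E \<phi>)"
    by (auto simp: pm)
  show "vertex_point (act (vertex_action V E \<phi>) g x) = act (graph_action K V E \<phi>) g (vertex_point x)"
    if "g \<in> carrier K" "x \<in> points (vertex_action V E \<phi>)" for g x
    using that by (simp add: \<Phi>_vertex_point flip: \<Phi>_def)
  show "\<exists>x\<in>points (vertex_action V E \<phi>). metric (graph_action K V E \<phi>) p (vertex_point x) \<le> 1"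
    if "p \<in> points (graph_action K V E \<phi>)" for p
  proof -
    have p: "p \<in> R" using that by (simp add: pm)
    obtain u where u: "u \<in> supp p" using supp_nonempty[OF p] by auto
    have "u \<in> V" using u supp_in_V[OF p] by auto
    moreover have "dist_R p (vertex_point u) \<le> 1"
      using dist_R_vertex_point[OF p \<open>u \<in> V\<close>] to_vertex_le[OF p u, of u] realization_le_1[OF p u] by simp
    ultimately show ?thesis by (auto simp: pm)
  qed
qed (auto simp: graph_action_def)

end

section \<open>Every geodesic action is equivalent to an action on a graph, free on vertices\<close>

text \<open>
  The vertices of the graph are the points of \<open>K \<times> R\<close> with the diagonal action (free because of the
  first factor); two of them are adjacent if their second components are at distance at most 1.
\<close>

lemma exists_free_graph:
  fixes R :: "('g, 'm) isoact"
  assumes R: "geodesic_action K R" and K: "carrier K \<lesssim> (UNIV :: 'm set)"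
    and inf: "infinite (UNIV :: 'm set)"
  obtains V :: "'m set" and E \<phi> where "connected_simple_graph V E"
    "graph_automorphism_action K V E \<phi>" "free_on_vertices K V \<phi>"
    "(action_class K (graph_action K V E \<phi>) :: ('g, 'm) isoact set) = action_class K R"
proof -
  have iR: "isometric_action K R" using R by (simp add: geodesic_action_def)
  interpret P: Metric_space "points R" "metric R" using iR by (rule isometric_action_metric)
  interpret K: group K using iR by (rule isometric_action_group)
  have ga: "group_action K (points R) (act R)" and ne: "points R \<noteq> {}"
    using iR by (auto simp: isometric_action_def)
  have "carrier K \<times> points R \<lesssim> (UNIV :: 'm set)"
    by (rule times_lepoll_infinite[OF inf K]) (simp add: subset_imp_lepoll)
  then obtain j :: "'g \<times> 'm \<Rightarrow> 'm" where j: "inj_on j (carrier K \<times> points R)"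
    by (auto simp: lepoll_def)
  define V where "V = j ` (carrier K \<times> points R)"
  define h x where "h = (\<lambda>u. fst (inv_into (carrier K \<times> points R) j u))"
    and "x = (\<lambda>u. snd (inv_into (carrier K \<times> points R) j u))"
  have jV: "j (k, y) \<in> V" "h (j (k, y)) = k" "x (j (k, y)) = y" if "k \<in> carrier K" "y \<in> points R" for k y
    using that j by (auto simp: V_def h_def x_def)
  have hx: "h u \<in> carrier K" "x u \<in> points R" "j (h u, x u) = u" if "u \<in> V" for u
    using that jV by (auto simp: V_def)
  \<comment> \<open>Distance 0 is allowed: distinct vertices over the same point are adjacent, which
    connects the fibres of \<open>x\<close>.\<close>
  define E where "E = {{u, v} | u v. u \<in> V \<and> v \<in> V \<and> u \<noteq> v \<and> metric R (x u) (x v) \<le> 1}"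
  have E: "{u, v} \<in> E \<longleftrightarrow> u \<in> V \<and> v \<in> V \<and> u \<noteq> v \<and> metric R (x u) (x v) \<le> 1" for u v
    unfolding E_def using P.commute by (auto simp: doubleton_eq_iff)
  define \<phi> where "\<phi> = (\<lambda>g. \<lambda>u\<in>V. j (g \<otimes>\<^bsub>K\<^esub> h u, act R g (x u)))"
  have \<phi>: "\<phi> g u \<in> V" "h (\<phi> g u) = g \<otimes>\<^bsub>K\<^esub> h u" "x (\<phi> g u) = act R g (x u)"
    if "g \<in> carrier K" "u \<in> V" for g u
    using that jV hx group_action_closed[OF ga] by (auto simp: \<phi>_def)
  have eqI: "u = v" if "u \<in> V" "v \<in> V" "h u = h v" "x u = x v" for u v
    using that hx(3) by metis
  have act: "group_action K V \<phi>"
  proof (rule group_actionI)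
    show "\<phi> g \<in> extensional V" for g by (simp add: \<phi>_def)
    show "\<phi> \<one>\<^bsub>K\<^esub> u = u" if "u \<in> V" for u
      using that by - (rule eqI, auto simp: \<phi> hx group_action_one[OF ga])
    show "\<phi> (g \<otimes>\<^bsub>K\<^esub> k) u = \<phi> g (\<phi> k u)" if "g \<in> carrier K" "k \<in> carrier K" "u \<in> V" for g k u
      using that by - (rule eqI, auto simp: \<phi> hx group_action_mult[OF ga] K.m_assoc)
  qed (auto simp: \<phi> K.group_axioms)
  have \<phi>_inj: "\<phi> g u \<noteq> \<phi> g v" if "g \<in> carrier K" "u \<in> V" "v \<in> V" "u \<noteq> v" for g u v
    using group_action_inv(1)[OF act that(1)] that by metis
  have aut: "graph_automorphism_action K V E \<phi>"
    unfolding graph_automorphism_action_def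
  proof (intro conjI ballI act)
    fix g e assume g: "g \<in> carrier K" and "e \<in> E"
    then obtain u v where "e = {u, v}" "u \<in> V" "v \<in> V" "u \<noteq> v" "metric R (x u) (x v) \<le> 1"
      by (auto simp: E_def)
    then show "\<phi> g ` e \<in> E"
      using g isometric_action_isom[OF iR g] by (simp add: E \<phi> \<phi>_inj hx)
  qed
  have free: "free_on_vertices K V \<phi>"
    unfolding free_on_vertices_def
  proof (intro ballI impI)
    fix g u assume gu: "g \<in> carrier K" "u \<in> V" "\<phi> g u = u"
    then have "g \<otimes>\<^bsub>K\<^esub> h u = h u" using \<phi>(2) by metis
    then show "g = \<one>\<^bsub>K\<^esub>" using gu hx by simp
  qed
  have lower: "v \<in> V \<and> metric R (x u) (x v) \<le> real n"
    if "(u, v) \<in> adjacency E ^^ n" "u \<in> V" for u v n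
    using that
  proof (induction n arbitrary: v)
    case 0 then show ?case using hx by auto
  next
    case (Suc n)
    then obtain w where w: "(u, w) \<in> adjacency E ^^ n" "(w, v) \<in> adjacency E"
      by (auto elim: relpow_Suc_E)
    have "w \<in> V" "metric R (x u) (x w) \<le> real n" using Suc w by auto
    moreover have "v \<in> V" "metric R (x w) (x v) \<le> 1" using w(2) by (auto simp: adjacency_def E)
    ultimately show ?case
      using P.triangle[of "x u" "x w" "x v"] hx Suc.prems by auto
  qed
  \<comment> \<open>At most \<open>n\<close> steps of length at most 1 along geodesics keep the
    group component; one extra step changes that component over the final point.\<close>
  have upper: "\<exists>m\<le>Suc n. (u, v) \<in> adjacency E ^^ m"
    if "u \<in> V" "v \<in> V" "metric R (x u) (x v) \<le> real n" for u v n
    using that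
  proof (induction n arbitrary: u)
    case 0
    have "x u = x v" using 0 P.nonneg[of "x u" "x v"] hx P.zero by (metis order_antisym of_nat_0)
    then have "u = v \<or> {u, v} \<in> E" using 0 by (simp add: E hx)
    then show ?case
      by (auto simp: adjacency_def intro: exI[of _ 0] exI[of _ 1])
  next
    case (Suc n)
    show ?case
    proof (cases "metric R (x u) (x v) \<le> real n")
      case True
      then show ?thesis using Suc.IH[OF Suc.prems(1,2)] le_SucI by blast
    next
      case False
      define D where "D = metric R (x u) (x v)"
      obtain \<gamma> where \<gamma>: "\<gamma> \<in> {0..D} \<rightarrow> points R" "\<gamma> 0 = x u" "\<gamma> D = x v"
        "\<And>s t. s \<in> {0..D} \<Longrightarrow> t \<in> {0..D} \<Longrightarrow> metric R (\<gamma> s) (\<gamma> t) = \<bar>s - t\<bar>"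
        using R hx Suc.prems unfolding geodesic_action_def geodesic_space_def D_def by blast
      have D: "D > real n" "D \<le> real n + 1" using False Suc.prems by (auto simp: D_def)
      define y where "y = \<gamma> (D - real n)"
      have y: "y \<in> points R" "metric R (x u) y = D - real n" "metric R y (x v) = real n"
        using \<gamma>(1,2,3) \<gamma>(4)[of 0 "D - real n"] \<gamma>(4)[of "D - real n" D] D
        by (auto simp: y_def Pi_iff)
      define w where "w = j (h u, y)"
      have w: "w \<in> V" "x w = y" using jV y hx Suc.prems by (auto simp: w_def)
      have "u \<noteq> w" using y(1,2) D w by auto
      then have "(u, w) \<in> adjacency E" using w y D Suc.prems by (simp add: E adjacency_def)
      moreover obtain m where "m \<le> Suc n" "(w, v) \<in> adjacency E ^^ m"
        using Suc.IH[of w] w y Suc.prems by auto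
      ultimately show ?thesis
        using relpow_Suc_I2[of u w "adjacency E" v m] by (meson Suc_le_mono)
    qed
  qed
  have conn: "connected_simple_graph V E"
    unfolding connected_simple_graph_def
  proof (intro conjI ballI)
    show "simple_graph V E" by (auto simp: simple_graph_def E_def)
    show "V \<noteq> {}" using ne K.one_closed by (auto simp: V_def)
    show "(u, v) \<in> (adjacency E)\<^sup>*" if "u \<in> V" "v \<in> V" for u v
    proof -
      obtain n where "metric R (x u) (x v) \<le> real n" using real_arch_simple by blast
      then show ?thesis using upper[OF that] relpow_imp_rtrancl by blast
    qed
  qed
  interpret graph_with_action K V E \<phi> by unfold_locales (use conn aut in auto)
  have "equivalent_actions K (vertex_action V E \<phi>) R"
  proof (rule equivalent_actionsI[OF isometric_vertex_action iR, where f = x and B = 2 and \<epsilon> = 0])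
    show "metric R (x u) (x v) \<le> metric (vertex_action V E \<phi>) u v + 2"
      if "u \<in> points (vertex_action V E \<phi>)" "v \<in> points (vertex_action V E \<phi>)" for u v
      using lower[OF dist_V_relpow[of u v]] that by auto
    show "metric (vertex_action V E \<phi>) u v \<le> metric R (x u) (x v) + 2"
      if uv: "u \<in> points (vertex_action V E \<phi>)" "v \<in> points (vertex_action V E \<phi>)" for u v
    proof -
      \<comment> \<open>Rounding up costs at most 1 and the change of the group component costs 1
        more, which accounts for \<open>B = 2\<close>.\<close>
      define n where "n = nat \<lceil>metric R (x u) (x v)\<rceil>"
      have n: "metric R (x u) (x v) \<le> real n" "real n \<le> metric R (x u) (x v) + 1"
        using P.nonneg[of "x u" "x v"] by (simp_all add: n_def)
      obtain m where "m \<le> Suc n" "(u, v) \<in> adjacency E ^^ m" using upper[of u v n] n(1) uv by auto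
      then have "dist_V u v \<le> Suc n" using vertex_dist_le[of u v m E] by simp
      then show ?thesis using n by simp
    qed
    show "\<exists>u\<in>points (vertex_action V E \<phi>). metric R y (x u) \<le> 0" if "y \<in> points R" for y
      using that jV[of "\<one>\<^bsub>K\<^esub>" y] by (intro bexI[of _ "j (\<one>\<^bsub>K\<^esub>, y)"]) auto
  qed (auto simp: hx \<phi>)
  then have "equivalent_actions K (graph_action K V E \<phi>) R"
    using equivalent_actions_trans[OF isometric_graph_action isometric_vertex_action iR]
      equivalent_actions_sym[OF isometric_vertex_action isometric_graph_action
        equivalent_vertex_graph_action] by blast
  then have "(action_class K (graph_action K V E \<phi>) :: ('g, 'm) isoact set) = action_class K R"
    by (rule action_class_eqI[OF isometric_graph_action iR])
  then show thesis using that conn aut free by blast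
qed

lemma exists_transversal:
  assumes "group G" "subgroup H G"
  obtains t where "transversal G H t"
proof
  interpret group G by fact
  have "C \<noteq> {}" if "C \<in> lcosets\<^bsub>G\<^esub> H" for C
    using that lcos_self[OF _ assms(2)] by (auto simp: LCOSETS_def)
  then show "transversal G H (\<lambda>C. if C = H then \<one>\<^bsub>G\<^esub> else SOME c. c \<in> C)"
    using subgroup.one_closed[OF assms(2)] by (auto simp: transversal_def some_in_eq)
qed

text \<open>\<open>Ind_wrt\<close> is a choice, so nothing is known about it until one admissible
  graph, vertex and transversal have been exhibited. From then on the class may be taken to arise
  from some such data, without knowing which.\<close>

lemma Ind_wrtE:
  fixes A :: "('g, 'm) isoact set"
  assumes G: "group G" and H: "subgroup H G" and A: "A \<in> action_classes (G\<lparr>carrier := H\<rparr>)"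
    and cG: "carrier G \<lesssim> (UNIV :: 'm set)" and inf: "infinite (UNIV :: 'm set)"
  obtains V :: "'m set" and E \<phi> t b where "connected_simple_graph V E"
    "graph_automorphism_action (G\<lparr>carrier := H\<rparr>) V E \<phi>"
    "free_on_vertices (G\<lparr>carrier := H\<rparr>) V \<phi>"
    "action_class (G\<lparr>carrier := H\<rparr>) (graph_action (G\<lparr>carrier := H\<rparr>) V E \<phi>) = A"
    "transversal G H t" "b \<in> V"
    "Ind_wrt G H X A = action_class G (induced_action G H X V E \<phi> t b)"
proof -
  obtain R :: "('g, 'm) isoact" where R: "geodesic_action (G\<lparr>carrier := H\<rparr>) R"
    and AR: "A = action_class (G\<lparr>carrier := H\<rparr>) R"
    using A by (auto simp: action_classes_def)
  have cH: "carrier (G\<lparr>carrier := H\<rparr>) \<lesssim> (UNIV :: 'm set)"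
    using lepoll_trans[OF subset_imp_lepoll cG] subgroup.subset[OF H] by simp
  obtain V :: "'m set" and E \<phi> where g: "connected_simple_graph V E"
    "graph_automorphism_action (G\<lparr>carrier := H\<rparr>) V E \<phi>"
    "free_on_vertices (G\<lparr>carrier := H\<rparr>) V \<phi>"
    "(action_class (G\<lparr>carrier := H\<rparr>) (graph_action (G\<lparr>carrier := H\<rparr>) V E \<phi>)
        :: ('g, 'm) isoact set) = action_class (G\<lparr>carrier := H\<rparr>) R"
    using exists_free_graph[OF R cH inf] by blast
  obtain t where t: "transversal G H t" using exists_transversal[OF G H] .
  obtain b where "b \<in> V" using g(1) by (auto simp: connected_simple_graph_def)
  then have "\<exists>B :: ('g, 'm) isoact set. \<exists>(V :: 'm set) E \<phi> t b.
        connected_simple_graph V E \<and>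
        graph_automorphism_action (G\<lparr>carrier := H\<rparr>) V E \<phi> \<and>
        free_on_vertices (G\<lparr>carrier := H\<rparr>) V \<phi> \<and>
        action_class (G\<lparr>carrier := H\<rparr>) (graph_action (G\<lparr>carrier := H\<rparr>) V E \<phi>) = A \<and>
        transversal G H t \<and> b \<in> V \<and>
        B = action_class G (induced_action G H X V E \<phi> t b)"
    using g t AR by blast
  from someI_ex[OF this] show thesis
    unfolding Ind_wrt_def[symmetric] using that by blast
qed

section \<open>Incompressibility\<close>

locale induced_length = group G for G :: "'g monoid" (structure) +
  fixes H X :: "'g set" and d :: "'g \<Rightarrow> 'g \<Rightarrow> nat"
  assumes subgroup: "subgroup H G" and rel_gen: "rel_gen_set G H X"
    and left_inv: "d \<in> left_invariant_metrics G H"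
begin

definition words :: "'g \<Rightarrow> 'g list set" where
  "words g = {xs. set xs \<subseteq> carrier G \<and> foldr (\<otimes>) xs \<one> = g}"

definition cost :: "'g list \<Rightarrow> enat" where
  "cost xs = (\<Sum>x\<leftarrow>xs. weight G H X d x)"

definition len :: "'g \<Rightarrow> nat" where
  "len g = the_enat (INF xs\<in>words g. cost xs)"

lemma induced_metric_eq_len: "induced_metric G H X d f g = len (inv f \<otimes> g)"
  by (simp add: induced_metric_def len_def words_def cost_def)

lemma H_carrier: "h \<in> H \<Longrightarrow> h \<in> carrier G"
  using subgroup.subset[OF subgroup] by auto

lemma X_carrier: "x \<in> X \<Longrightarrow> x \<in> carrier G"
  using rel_gen by (auto simp: rel_gen_set_def)

lemma d_metric: "Metric_space H (\<lambda>x y. real (d x y))"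
  using left_inv by (simp add: left_invariant_metrics_def)

lemma d_left_inv: "h \<in> H \<Longrightarrow> x \<in> H \<Longrightarrow> y \<in> H \<Longrightarrow> d (h \<otimes> x) (h \<otimes> y) = d x y"
  using left_inv by (simp add: left_invariant_metrics_def)

lemma d_eq_0: "x \<in> H \<Longrightarrow> y \<in> H \<Longrightarrow> d x y = 0 \<longleftrightarrow> x = y"
  using Metric_space.zero[OF d_metric] by simp

lemma d_translate:
  assumes "x \<in> H" "y \<in> H" shows "d x y = d \<one> (inv x \<otimes> y)"
  using d_left_inv[of "inv x" x y] assms H_carrier subgroup.m_inv_closed[OF subgroup] by simp

lemma foldr_carrier: "set xs \<subseteq> carrier G \<Longrightarrow> foldr (\<otimes>) xs \<one> \<in> carrier G"
  by (induction xs) auto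

lemma foldr_append_mult:
  "set xs \<subseteq> carrier G \<Longrightarrow> set ys \<subseteq> carrier G \<Longrightarrow>
    foldr (\<otimes>) (xs @ ys) \<one> = foldr (\<otimes>) xs \<one> \<otimes> foldr (\<otimes>) ys \<one>"
  by (induction xs) (auto simp: m_assoc foldr_carrier simp del: foldr_append)

lemma words_append: "xs \<in> words g \<Longrightarrow> ys \<in> words h \<Longrightarrow> xs @ ys \<in> words (g \<otimes> h)"
  using foldr_append_mult[of xs ys] by (auto simp: words_def)

lemma cost_append: "cost (xs @ ys) = cost xs + cost ys"
  by (simp add: cost_def)

lemma words_single: "g \<in> carrier G \<Longrightarrow> [g] \<in> words g" "cost [g] = weight G H X d g"
  by (auto simp: words_def cost_def)

text \<open>Excludes an infinite infimum, on which \<open>the_enat\<close> would return an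
  unspecified number. Both \<open>X\<close> and \<open>H\<close> are closed under inverses, so
  inverted generators are again single letters of finite weight.\<close>

lemma exists_word:
  assumes "g \<in> carrier G" shows "\<exists>xs\<in>words g. cost xs \<noteq> \<infinity>"
proof -
  have single: "\<exists>xs\<in>words h. cost xs \<noteq> \<infinity>" if "h \<in> X \<union> H" for h
    using that words_single H_carrier X_carrier by (intro bexI[of _ "[h]"]) (auto simp: weight_def zero_enat_def one_enat_def)
  have "g \<in> generate G (X \<union> H)" using assms rel_gen by (simp add: rel_gen_set_def)
  then show ?thesis
  proof induction
    case one
    show ?case by (intro bexI[of _ "[]"]) (auto simp: words_def cost_def)
  next
    case (incl h) then show ?case by (rule single)
  next
    case (inv h)
    then have "inv h \<in> X \<union> H"
      using rel_gen subgroup.m_inv_closed[OF subgroup] by (auto simp: rel_gen_set_def)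
    then show ?case by (rule single)
  next
    case (eng g h)
    then obtain xs ys where "xs \<in> words g" "cost xs \<noteq> \<infinity>" "ys \<in> words h" "cost ys \<noteq> \<infinity>" by blast
    then show ?case
      by (intro bexI[of _ "xs @ ys"]) (auto simp: cost_append intro: words_append)
  qed
qed

lemma len_attained:
  assumes "g \<in> carrier G" shows "\<exists>xs\<in>words g. cost xs = enat (len g)"
proof -
  have "cost ` words g \<noteq> {}" using exists_word[OF assms] by auto
  then have "(INF xs\<in>words g. cost xs) \<in> cost ` words g"
    unfolding Inf_enat_def by (metis LeastI_ex ex_in_conv)
  then obtain xs where xs: "xs \<in> words g" "(INF xs\<in>words g. cost xs) = cost xs" by auto
  obtain ys where "ys \<in> words g" "cost ys \<noteq> \<infinity>" using exists_word[OF assms] by blast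
  then have "cost xs \<noteq> \<infinity>"
    using INF_lower[of ys "words g" cost] xs(2) by (metis enat_ord_simps(5))
  then show ?thesis using xs unfolding len_def by (intro bexI[of _ xs]) auto
qed

lemma len_le:
  assumes "xs \<in> words g" "cost xs \<le> enat n" shows "len g \<le> n"
proof -
  have "(INF xs\<in>words g. cost xs) \<le> enat n"
    using INF_lower[OF assms(1), of cost] assms(2) by (rule order_trans)
  then show ?thesis unfolding len_def by (cases "INF xs\<in>words g. cost xs") auto
qed

lemma len_mult:
  assumes "g \<in> carrier G" "h \<in> carrier G" shows "len (g \<otimes> h) \<le> len g + len h"
proof -
  obtain xs where xs: "xs \<in> words g" "cost xs = enat (len g)" using len_attained assms by blast
  obtain ys where ys: "ys \<in> words h" "cost ys = enat (len h)" using len_attained assms by blast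
  show ?thesis
    by (rule len_le[OF words_append[OF xs(1) ys(1)]]) (simp add: cost_append xs ys)
qed

lemma len_one: "len \<one> = 0"
  using len_le[of "[]" \<one> 0] by (simp add: words_def cost_def zero_enat_def)

lemma len_X: assumes "x \<in> X" shows "len x \<le> 1"
  by (rule len_le[OF words_single(1)])
    (use assms X_carrier in \<open>auto simp: words_single weight_def one_enat_def zero_enat_def\<close>)

lemma len_H: assumes "h \<in> H" shows "len h \<le> d \<one> h"
proof (rule len_le[OF words_single(1)])
  \<comment> \<open>An element of \<open>H\<close> that also lies in \<open>X\<close> has weight 1
    instead of \<open>d \<one> h\<close>; integrality of the metric makes this no larger.\<close>
  have "h \<noteq> \<one> \<Longrightarrow> d \<one> h \<ge> 1"
    using d_eq_0[OF subgroup.one_closed[OF subgroup] assms] by auto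
  then show "cost [h] \<le> enat (d \<one> h)"
    using assms by (auto simp: words_single weight_def one_enat_def zero_enat_def)
qed (use assms H_carrier in auto)

text \<open>Subadditivity is applied along a word of minimal cost. Its letters have finite weight,
  hence are \<open>\<one>\<close> or lie in \<open>X\<close> or \<open>H\<close>, and on each of
  them \<open>N\<close> is at most \<open>L\<close> times the weight.\<close>

lemma le_len:
  fixes N :: "'g \<Rightarrow> real"
  assumes sub: "\<And>g h. g \<in> carrier G \<Longrightarrow> h \<in> carrier G \<Longrightarrow> N (g \<otimes> h) \<le> N g + N h"
    and one: "N \<one> \<le> 0"
    and X: "\<And>x. x \<in> X \<Longrightarrow> N x \<le> L"
    and H: "\<And>h. h \<in> H \<Longrightarrow> N h \<le> L * real (d \<one> h)"
    and g: "g \<in> carrier G"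
  shows "N g \<le> L * real (len g)"
proof -
  have "N (foldr (\<otimes>) xs \<one>) \<le> L * real n" if "set xs \<subseteq> carrier G" "cost xs = enat n" for xs n
    using that
  proof (induction xs arbitrary: n)
    case Nil then show ?case using one by (simp add: cost_def zero_enat_def)
  next
    case (Cons x xs)
    have "weight G H X d x + cost xs = enat n" using Cons.prems(2) by (simp add: cost_def)
    then obtain k m where km: "weight G H X d x = enat k" "cost xs = enat m" "n = k + m"
      by (cases "weight G H X d x"; cases "cost xs") auto
    have "N x \<le> L * real k"
      using km(1) one X[of x] H[of x] by (auto simp: weight_def zero_enat_def one_enat_def split: if_splits)
    moreover have "N (foldr (\<otimes>) xs \<one>) \<le> L * real m" using Cons km by auto
    moreover have "N (x \<otimes> foldr (\<otimes>) xs \<one>) \<le> N x + N (foldr (\<otimes>) xs \<one>)"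
      using Cons.prems foldr_carrier by (intro sub) auto
    ultimately show ?case by (simp add: km(3) algebra_simps)
  qed
  then show ?thesis using len_attained[OF g] by (auto simp: words_def)
qed

text \<open>Left invariance reduces distances to lengths, and the upper inequality holds
  automatically by \<open>len_H\<close>; the content of incompressibility is the lower inequality
  alone.\<close>

lemma qi_embedding_inclusionI:
  assumes A: "A \<ge> 1" and B: "B \<ge> 0"
    and lower: "\<And>h. h \<in> H \<Longrightarrow> real (d \<one> h) \<le> A * real (len h) + B"
  shows "qi_embedding H (\<lambda>x y. real (d x y))
          (carrier G) (\<lambda>x y. real (induced_metric G H X d x y)) (\<lambda>h. h)"
proof (rule qi_embeddingI[OF _ A B])
  fix x y assume xy: "x \<in> H" "y \<in> H"
  then have k: "inv x \<otimes> y \<in> H"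
    using subgroup.m_closed[OF subgroup] subgroup.m_inv_closed[OF subgroup] by auto
  show "real (d x y) \<le> A * real (induced_metric G H X d x y) + B"
    using lower[OF k] d_translate[OF xy] by (simp add: induced_metric_eq_len)
  have "real (induced_metric G H X d x y) \<le> real (d x y)"
    using len_H[OF k] d_translate[OF xy] by (simp add: induced_metric_eq_len)
  also have "\<dots> \<le> A * real (d x y) + B"
    using A B mult_right_mono[of 1 A "real (d x y)"] by simp
  finally show "real (induced_metric G H X d x y) \<le> A * real (d x y) + B" .
qed (use H_carrier in auto)

lemma incompressible_wrtE:
  assumes "incompressible_wrt G H X"
  obtains A where "A \<ge> 1" "\<And>h. h \<in> H \<Longrightarrow> real (d \<one> h) \<le> A * real (len h) + A"
proof -
  have "qi_embedding H (\<lambda>x y. real (d x y))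
          (carrier G) (\<lambda>x y. real (induced_metric G H X d x y)) (\<lambda>h. h)"
    using assms left_inv by (simp add: incompressible_wrt_def)
  then obtain A where A: "A \<ge> 1"
    "\<And>x y. x \<in> H \<Longrightarrow> y \<in> H \<Longrightarrow> real (d x y) \<le> A * real (induced_metric G H X d x y) + A"
    by (rule qi_embeddingE) auto
  have "real (d \<one> h) \<le> A * real (len h) + A" if "h \<in> H" for h
    using A(2)[OF subgroup.one_closed[OF subgroup] that] H_carrier[OF that]
    by (simp add: induced_metric_eq_len)
  then show thesis using that A(1) by blast
qed

end

text \<open>The length with respect to \<open>X\<close> is itself subadditive and bounded on the
  finite set \<open>X'\<close>, so \<open>le_len\<close> bounds it linearly by the length with
  respect to \<open>X'\<close>.\<close>

lemma incompressible_wrt_finite: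
  assumes G: "group G" and H: "subgroup H G"
    and X: "rel_gen_set G H X" "incompressible_wrt G H X"
    and X': "rel_gen_set G H X'" "finite X'"
  shows "incompressible_wrt G H X'"
  unfolding incompressible_wrt_def
proof
  fix d assume d: "d \<in> left_invariant_metrics G H"
  interpret group G by fact
  interpret l: induced_length G H X d
    by (intro induced_length.intro induced_length_axioms.intro) (use assms d in auto)
  interpret l': induced_length G H X' d
    by (intro induced_length.intro induced_length_axioms.intro) (use assms d in auto)
  obtain A where A: "A \<ge> 1" "\<And>h. h \<in> H \<Longrightarrow> real (d \<one>\<^bsub>G\<^esub> h) \<le> A * real (l.len h) + A"
    using l.incompressible_wrtE[OF X(2)] by blast
  \<comment> \<open>The sum bounds the length on \<open>X'\<close>; the 1 makes \<open>L\<close> at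
    least 1, as the estimate on \<open>H\<close> requires.\<close>
  define L where "L = real (1 + (\<Sum>x\<in>X'. l.len x))"
  have L: "L \<ge> 1" by (simp add: L_def sum_nonneg)
  have "real (l.len g) \<le> L * real (l'.len g)" if g: "g \<in> carrier G" for g
  proof (rule l'.le_len[where N = "\<lambda>g. real (l.len g)", OF _ _ _ _ g])
    show "real (l.len (g \<otimes>\<^bsub>G\<^esub> h)) \<le> real (l.len g) + real (l.len h)"
      if "g \<in> carrier G" "h \<in> carrier G" for g h
      using l.len_mult[OF that] by simp
    show "real (l.len x) \<le> L" if "x \<in> X'" for x
      using member_le_sum[of x X' l.len] that X'(2) by (simp add: L_def del: of_nat_sum)
    show "real (l.len h) \<le> L * real (d \<one>\<^bsub>G\<^esub> h)" if "h \<in> H" for h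
      using l.len_H[OF that] L mult_mono[of 1 L "real (l.len h)" "real (d \<one>\<^bsub>G\<^esub> h)"] by simp
  qed (simp add: l.len_one)
  then have "real (d \<one>\<^bsub>G\<^esub> h) \<le> (A * L) * real (l'.len h) + A" if "h \<in> H" for h
    using A(2)[OF that] A(1) l.H_carrier[OF that]
    by (smt (verit) mult.assoc mult_left_mono)
  moreover have "A * L \<ge> 1" using A(1) L mult_mono[of 1 A 1 L] by simp
  ultimately show "qi_embedding H (\<lambda>x y. real (d x y))
          (carrier G) (\<lambda>x y. real (induced_metric G H X' d x y)) (\<lambda>h. h)"
    using l'.qi_embedding_inclusionI[of "A * L" A] A(1) by simp
qed

section \<open>From solvability of the extension problem to incompressibility\<close>

lemma isometric_left_translation:
  assumes G: "group G" and H: "subgroup H G" and d: "d \<in> left_invariant_metrics G H"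
  shows "isometric_action (G\<lparr>carrier := H\<rparr>)
    \<lparr>points = H, metric = (\<lambda>x y. real (d x y)), act = (\<lambda>h. \<lambda>x\<in>H. h \<otimes>\<^bsub>G\<^esub> x)\<rparr>"
proof -
  interpret group G by fact
  note c = subgroup.m_closed[OF H] subgroup.one_closed[OF H] subgroup.mem_carrier[OF H]
  have "group_action (G\<lparr>carrier := H\<rparr>) H (\<lambda>h. \<lambda>x\<in>H. h \<otimes>\<^bsub>G\<^esub> x)"
    by (rule group_actionI) (auto simp: c m_assoc subgroup_imp_group[OF H])
  then show ?thesis
    using d c by (auto simp: isometric_action_def left_invariant_metrics_def)
qed

theorem extension_problem_solvable_imp_incompressible_wrt:
  fixes G :: "'g monoid" (structure)
  assumes G: "group G" and H: "subgroup H G" and X: "rel_gen_set G H X" "finite X"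
    and cG: "carrier G \<lesssim> (UNIV :: 'm set)"
    and ext: "extension_problem_solvable TYPE('m) G H"
  shows "incompressible_wrt G H X"
  unfolding incompressible_wrt_def
proof
  fix d assume d: "d \<in> left_invariant_metrics G H"
  interpret induced_length G H X d
    by (intro induced_length.intro induced_length_axioms.intro) (use assms d in auto)
  let ?K = "G\<lparr>carrier := H\<rparr>"
  define R :: "('g, 'g) isoact" where
    "R = \<lparr>points = H, metric = (\<lambda>x y. real (d x y)), act = (\<lambda>h. \<lambda>x\<in>H. h \<otimes>\<^bsub>G\<^esub> x)\<rparr>"
  have R: "isometric_action ?K R"
    unfolding R_def by (rule isometric_left_translation[OF G H d])
  \<comment> \<open>The extension problem concerns subsets of \<open>'m\<close> only, so
    \<open>H\<close> is relabelled before it is extended, and the relabelling is then composed with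
    the extension.\<close>
  have "H \<lesssim> (UNIV :: 'm set)"
    using lepoll_trans[OF subset_imp_lepoll cG] subgroup.subset[OF H] by simp
  then obtain j :: "'g \<Rightarrow> 'm" where j: "inj_on j (points R)" by (auto simp: lepoll_def R_def)
  note R' = isometric_action_transport[OF R j]
  obtain S :: "('g, 'm) isoact" where S: "isometric_action G S"
    "is_extension H (transport j R) S"
    using ext R' unfolding extension_problem_solvable_def by blast
  have aS: "group_action G (points S) (act S)" using S(1) by (simp add: isometric_action_def)
  note S' = isometric_action_subgroup[OF S(1) H]
  have "is_extension (carrier ?K) R S"
    using is_extension_trans[OF R R' S'] S(2)
      equivalent_actions_imp_extension[OF equivalent_actions_transport[OF R j]] by simp
  then obtain f where f: "coarsely_equivariant H R S f"
    "qi_embedding H (\<lambda>x y. real (d x y)) (points S) (metric S) f"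
    by (auto simp: is_extension_def R_def)
  interpret S: Metric_space "points S" "metric S" using S(1) by (rule isometric_action_metric)
  obtain A where A: "A \<ge> 1"
    "\<And>x y. x \<in> H \<Longrightarrow> y \<in> H \<Longrightarrow> real (d x y) \<le> A * metric S (f x) (f y) + A"
    "\<And>x y. x \<in> H \<Longrightarrow> y \<in> H \<Longrightarrow> metric S (f x) (f y) \<le> A * real (d x y) + A"
    by (rule qi_embeddingE[OF f(2) _ S.nonneg]) auto
  have one: "\<one> \<in> H" using H by (rule subgroup.one_closed)
  have fp: "f h \<in> points S" if "h \<in> H" for h using f(2) that by (auto simp: qi_embedding_def)
  define s where "s = f \<one>"
  have s: "s \<in> points S" using fp one by (simp add: s_def)
  have gs: "act S g s \<in> points S" if "g \<in> carrier G" for g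
    using isometric_action_closed[OF S(1) that s] .
  have "\<exists>B. \<forall>h\<in>H. metric S (f h) (act S h s) \<le> B"
  proof -
    have "bdd_above ((\<lambda>h. metric S (f (act R h \<one>)) (act S h (f \<one>))) ` H)"
      using f(1) one by (auto simp: coarsely_equivariant_def R_def)
    moreover have "act R h \<one> = h" if "h \<in> H" for h using that one H_carrier by (simp add: R_def)
    ultimately show ?thesis unfolding bdd_above_def s_def by auto
  qed
  then obtain B where B: "\<And>h. h \<in> H \<Longrightarrow> metric S (f h) (act S h s) \<le> B" by blast
  have "B \<ge> 0" using B[OF one] S.nonneg order_trans by blast
  define N where "N g = metric S (act S g s) s" for g
  have N_one: "N \<one> = 0"
    using s by (simp add: N_def group_action_one[OF aS])
  have N_mult: "N (g \<otimes> h) \<le> N g + N h" if "g \<in> carrier G" "h \<in> carrier G" for g h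
  proof -
    have "act S (g \<otimes> h) s = act S g (act S h s)"
      using s that by (simp add: group_action_mult[OF aS])
    then show ?thesis
      using S.triangle[of "act S g (act S h s)" "act S g s" s] that s gs
        isometric_action_isom[OF S(1) that(1) gs[OF that(2)] s]
        isometric_action_closed[OF S(1) that(1) gs[OF that(2)]] by (simp add: N_def)
  qed
  \<comment> \<open>\<open>2 * A + B\<close> serves the elements of \<open>H\<close>, the sum those
    of the finite set \<open>X\<close>.\<close>
  define L where "L = 2 * A + B + (\<Sum>x\<in>X. N x)"
  have sumN: "(\<Sum>x\<in>X. N x) \<ge> 0" by (intro sum_nonneg) (simp add: N_def)
  have L: "L \<ge> 1" using A(1) sumN \<open>B \<ge> 0\<close> by (simp add: L_def)
  have N_X: "N x \<le> L" if "x \<in> X" for x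
    using member_le_sum[of x X N] that X(2) A(1) \<open>B \<ge> 0\<close> by (simp add: L_def N_def)
  have N_H: "N h \<le> L * real (d \<one> h)" if h: "h \<in> H" for h
  \<comment> \<open>The required bound has no additive term. Away from the identity
    \<open>d \<one> h\<close> is at least 1 and absorbs the constants; at the identity
    \<open>N\<close> vanishes.\<close>
  proof (cases "h = \<one>")
    case True then show ?thesis using L by (simp add: N_one)
  next
    case False
    then have 1: "real (d \<one> h) \<ge> 1" using d_eq_0[OF one h] by (simp add: Suc_le_eq)
    have "N h \<le> metric S (act S h s) (f h) + metric S (f h) s"
      unfolding N_def using S.triangle gs fp s h H_carrier by simp
    also have "\<dots> \<le> B + (A * real (d \<one> h) + A)"
      using B[OF h] A(3)[OF one h] by (simp add: S.commute s_def)
    also have "\<dots> \<le> B * real (d \<one> h) + (A * real (d \<one> h) + A * real (d \<one> h))"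
      using 1 A(1) \<open>B \<ge> 0\<close> mult_left_mono[of 1 "real (d \<one> h)" B]
        mult_left_mono[of 1 "real (d \<one> h)" A] by linarith
    also have "\<dots> = (2 * A + B) * real (d \<one> h)" by (simp add: algebra_simps)
    also have "\<dots> \<le> L * real (d \<one> h)"
      using sumN by (intro mult_right_mono) (auto simp: L_def)
    finally show ?thesis .
  qed
  show "qi_embedding H (\<lambda>x y. real (d x y))
          (carrier G) (\<lambda>x y. real (induced_metric G H X d x y)) (\<lambda>h. h)"
  proof (rule qi_embedding_inclusionI)
    \<comment> \<open>\<open>A\<close> comes from the lower inequality for \<open>f\<close> and
      \<open>L\<close> from \<open>le_len\<close>; the additive term contains \<open>A * B\<close>
      because \<open>f h\<close> was replaced by \<open>act S h s\<close>.\<close>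
    show "A * L \<ge> 1" using A(1) L mult_mono[of 1 A 1 L] by simp
    show "A * B + A \<ge> 0" using A(1) \<open>B \<ge> 0\<close> by simp
    fix h assume h: "h \<in> H"
    have "metric S s (f h) \<le> metric S s (act S h s) + metric S (act S h s) (f h)"
      using S.triangle gs fp s h H_carrier by simp
    also have "\<dots> \<le> N h + B" using B[OF h] by (simp add: N_def S.commute)
    also have "\<dots> \<le> L * real (len h) + B"
      using le_len[where N = N, OF N_mult _ N_X N_H H_carrier[OF h]] N_one by simp
    finally have "A * metric S s (f h) \<le> A * (L * real (len h) + B)" using A(1) by simp
    then show "real (d \<one> h) \<le> A * L * real (len h) + (A * B + A)"
      using A(2)[OF one h] by (simp add: s_def algebra_simps)
  qed
qed

section \<open>Induced actions\<close>

locale induced_graph = graph_with_action "G\<lparr>carrier := H\<rparr>" V E \<phi> + G: group G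
  for G :: "'g monoid" (structure) and H :: "'g set"
    and V :: "'v set" and E :: "'v set set" and \<phi> :: "'g \<Rightarrow> 'v \<Rightarrow> 'v" +
  fixes X :: "'g set" and t :: "'g set \<Rightarrow> 'g" and b :: 'v
  assumes H: "subgroup H G" and rel_gen: "rel_gen_set G H X"
    and free: "free_on_vertices (G\<lparr>carrier := H\<rparr>) V \<phi>"
    and transversal: "transversal G H t" and b: "b \<in> V"
begin

abbreviation cosets :: "'g set set" where "cosets \<equiv> lcosets H"
abbreviation V' :: "('g set \<times> 'v) set" where "V' \<equiv> Y_verts G H V"
definition E' :: "('g set \<times> 'v) set set" where
  "E' = Y_edges G H E \<union> glued_Cayley_edges G H X V \<phi> t b"
abbreviation \<psi> :: "'g \<Rightarrow> 'g set \<times> 'v \<Rightarrow> 'g set \<times> 'v" where "\<psi> \<equiv> Y_act G H V \<phi> t"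

lemmas H_mult [simp] = subgroup.m_closed[OF H]
  and H_inv [simp] = subgroup.m_inv_closed[OF H]
  and H_one [simp] = subgroup.one_closed[OF H]
  and H_carrier [simp] = subgroup.mem_carrier[OF H]
  and H_subset = subgroup.subset[OF H]

lemma mult_inv_cancel: "x \<in> carrier G \<Longrightarrow> y \<in> carrier G \<Longrightarrow> x \<otimes> (inv x \<otimes> y) = y"
  by (simp add: G.m_assoc[symmetric])

lemma X_carrier: "x \<in> X \<Longrightarrow> x \<in> carrier G" and X_inv: "x \<in> X \<Longrightarrow> inv x \<in> X"
  using rel_gen by (auto simp: rel_gen_set_def)

lemma cosets_self: "g \<in> carrier G \<Longrightarrow> g <# H \<in> cosets"
  by (auto simp: LCOSETS_def)

lemma coset_H: "h \<in> H \<Longrightarrow> h <# H = H"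
  using G.coset_join3[OF _ H] by simp

lemma H_coset: "H \<in> cosets"
  using cosets_self[of \<one>] coset_H[of \<one>] by simp

lemma mem_coset: "g \<in> carrier G \<Longrightarrow> g \<in> g <# H"
  using G.lcos_self[OF _ H] .

lemma cosetD:
  assumes "C \<in> cosets" "g \<in> C" shows "g \<in> carrier G" "g <# H = C"
proof -
  obtain a h where a: "a \<in> carrier G" "C = a <# H" "h \<in> H" "g = a \<otimes> h"
    using assms by (auto simp: LCOSETS_def l_coset_def)
  show "g \<in> carrier G" using a by simp
  have "g <# H = a <# (h <# H)"
    using a by (simp add: G.lcos_m_assoc[OF H_subset])
  then show "g <# H = C" using a coset_H by simp
qed

lemma coset_eq_H: "g \<in> carrier G \<Longrightarrow> g <# H = H \<Longrightarrow> g \<in> H"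
  using mem_coset by auto

lemma t_mem: "C \<in> cosets \<Longrightarrow> t C \<in> C"
  using transversal by (auto simp: transversal_def)

lemma t_carrier [simp]: "C \<in> cosets \<Longrightarrow> t C \<in> carrier G"
  using t_mem cosetD by blast

lemma t_H [simp]: "t H = \<one>"
  using transversal by (auto simp: transversal_def)

lemma t_diff: assumes "C \<in> cosets" "g \<in> C" shows "inv (t C) \<otimes> g \<in> H"
proof -
  have "g \<in> t C <# H" using assms cosetD(2)[OF assms(1) t_mem[OF assms(1)]] by simp
  then obtain h where "h \<in> H" "g = t C \<otimes> h" by (auto simp: l_coset_def)
  then show ?thesis using assms by (simp add: G.m_assoc[symmetric])
qed

lemma shift_coset:
  assumes "g \<in> carrier G" "C \<in> cosets" shows "g <# C \<in> cosets"
proof -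
  obtain a where "a \<in> carrier G" "C = a <# H" using assms by (auto simp: LCOSETS_def)
  then show ?thesis using assms cosets_self[of "g \<otimes> a"] by (simp add: G.lcos_m_assoc[OF H_subset])
qed

lemma coset_subset: "C \<in> cosets \<Longrightarrow> C \<subseteq> carrier G"
  using cosetD(1) by auto

text \<open>The element of \<open>H\<close> by which \<open>g\<close> twists the copy over
  \<open>C\<close> while moving it to the copy over \<open>g <# C\<close>. It is a cocycle:
  \<open>\<sigma> g (h <# C) \<otimes> \<sigma> h C = \<sigma> (g \<otimes> h) C\<close>, which is
  what makes \<open>Y_act\<close> an action.\<close>

definition \<sigma> :: "'g \<Rightarrow> 'g set \<Rightarrow> 'g" where "\<sigma> g C = inv (t (g <# C)) \<otimes> g \<otimes> t C"

lemma \<sigma>_H: assumes "g \<in> carrier G" "C \<in> cosets" shows "\<sigma> g C \<in> H"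
proof -
  have "g \<otimes> t C \<in> g <# C" using t_mem[OF assms(2)] by (auto simp: l_coset_def)
  then show ?thesis
    using t_diff[OF shift_coset[OF assms]] assms shift_coset[OF assms]
    by (simp add: \<sigma>_def G.m_assoc)
qed

lemma \<psi>_eq: "C \<in> cosets \<Longrightarrow> r \<in> V \<Longrightarrow> \<psi> g (C, r) = (g <# C, \<phi> (\<sigma> g C) r)"
  by (simp add: Y_act_def Y_verts_def \<sigma>_def)

lemma \<psi>_base: "g \<in> carrier G \<Longrightarrow> \<psi> g (H, b) = (g <# H, \<phi> (inv (t (g <# H)) \<otimes> g) b)"
  using cosets_self by (simp add: \<psi>_eq H_coset b \<sigma>_def)

text \<open>The normalisation \<open>t H = \<one>\<close> removes the twist on the base copy, so
  \<open>Pair H\<close> is equivariant exactly and not just coarsely.\<close>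

lemma \<psi>_H: assumes "h \<in> H" "r \<in> V" shows "\<psi> h (H, r) = (H, \<phi> h r)"
  using assms by (simp add: \<psi>_eq H_coset \<sigma>_def coset_H)

lemma action_Y: "group_action G V' \<psi>"
proof (rule group_actionI)
  show "\<psi> g \<in> extensional V'" for g by (simp add: Y_act_def)
  show "\<psi> g y \<in> V'" if "g \<in> carrier G" "y \<in> V'" for g y
    using that shift_coset \<sigma>_H by (auto simp: Y_verts_def \<psi>_eq)
  show "\<psi> \<one> y = y" if yV: "y \<in> V'" for y
  proof -
    obtain C r where y: "y = (C, r)" "C \<in> cosets" "r \<in> V" using yV by (auto simp: Y_verts_def)
    have "\<one> <# C = C" using G.lcos_mult_one coset_subset y by simp
    moreover from this have "\<sigma> \<one> C = \<one>" using y by (simp add: \<sigma>_def)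
    ultimately show ?thesis using y \<phi>_one by (simp add: \<psi>_eq)
  qed
  show "\<psi> (g \<otimes> h) y = \<psi> g (\<psi> h y)" if gh: "g \<in> carrier G" "h \<in> carrier G" and yV: "y \<in> V'" for g h y
  proof -
    obtain C r where y: "y = (C, r)" "C \<in> cosets" "r \<in> V" using yV by (auto simp: Y_verts_def)
    have 1: "(g \<otimes> h) <# C = g <# (h <# C)" using G.lcos_m_assoc[OF coset_subset gh] y by simp
    have c: "h <# C \<in> cosets" "g <# (h <# C) \<in> cosets" using shift_coset gh y by auto
    have "\<sigma> g (h <# C) \<otimes> \<sigma> h C = \<sigma> (g \<otimes> h) C"
      unfolding \<sigma>_def 1 using c y gh by (simp add: G.m_assoc mult_inv_cancel)
    then have "\<phi> (\<sigma> (g \<otimes> h) C) r = \<phi> (\<sigma> g (h <# C)) (\<phi> (\<sigma> h C) r)"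
      using \<phi>_mult[of "\<sigma> g (h <# C)" "\<sigma> h C" r] \<sigma>_H[OF gh(1) c(1)] \<sigma>_H[OF gh(2) y(2)] y by simp
    then show ?thesis
      using y c 1 \<sigma>_H[OF gh(2) y(2)] by (simp add: \<psi>_eq)
  qed
qed (rule G.group_axioms)

lemma \<phi>_free: assumes "h \<in> H" "k \<in> H" "\<phi> h b = \<phi> k b" shows "h = k"
proof -
  have "\<phi> (inv k \<otimes> h) b = \<phi> (inv k) (\<phi> k b)"
    using \<phi>_mult[of "inv k" h b] assms b by simp
  also have "\<dots> = b" using \<phi>_mult[of "inv k" k b] assms b \<phi>_one by simp
  finally have "inv k \<otimes> h = \<one>"
    using free assms b by (auto simp: free_on_vertices_def)
  then show ?thesis using assms by (metis G.inv_equality G.inv_inv H_carrier H_inv)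
qed

text \<open>The first component determines the coset, hence its representative, and freeness
  recovers the remaining factor in \<open>H\<close> from the vertex. Consequently no glued edge
  degenerates to a loop.\<close>

lemma \<psi>_base_inj:
  assumes "g \<in> carrier G" "h \<in> carrier G" "\<psi> g (H, b) = \<psi> h (H, b)" shows "g = h"
proof -
  have pair: "(g <# H, \<phi> (inv (t (g <# H)) \<otimes> g) b) = (h <# H, \<phi> (inv (t (h <# H)) \<otimes> h) b)"
    using assms(3) unfolding \<psi>_base[OF assms(1)] \<psi>_base[OF assms(2)] .
  then have eq: "g <# H = h <# H" by (rule Pair_inject)
  have \<phi>_eq: "\<phi> (inv (t (g <# H)) \<otimes> g) b = \<phi> (inv (t (g <# H)) \<otimes> h) b"
    using pair by (metis Pair_inject)
  have "h \<in> g <# H" using mem_coset[OF assms(2)] eq by simp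
  then have "inv (t (g <# H)) \<otimes> g = inv (t (g <# H)) \<otimes> h"
    by (rule \<phi>_free[OF t_diff[OF cosets_self[OF assms(1)] mem_coset[OF assms(1)]]
          t_diff[OF cosets_self[OF assms(1)]] \<phi>_eq])
  then show ?thesis
    using G.Units_l_cancel assms(1,2) t_carrier[OF cosets_self[OF assms(1)]] by simp
qed

section \<open>The glued graph: automorphisms and connectedness\<close>

lemma Y_edge: "C \<in> cosets \<Longrightarrow> {u, v} \<in> E \<Longrightarrow> {(C, u), (C, v)} \<in> E'"
  unfolding E'_def Y_edges_def by (intro UnI1 CollectI exI[of _ C] exI[of _ "{u, v}"]) simp

lemma glued_edge:
  "g \<in> carrier G \<Longrightarrow> x \<in> X \<Longrightarrow> x \<noteq> \<one> \<Longrightarrow> {\<psi> g (H, b), \<psi> (g \<otimes> x) (H, b)} \<in> E'"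
  unfolding E'_def glued_Cayley_edges_def by blast

lemma E'_cases [consumes 1, case_names Y glued]:
  assumes "e \<in> E'"
  obtains C u v where "e = {(C, u), (C, v)}" "C \<in> cosets" "{u, v} \<in> E" "u \<noteq> v" "u \<in> V" "v \<in> V"
  | g x where "e = {\<psi> g (H, b), \<psi> (g \<otimes> x) (H, b)}" "g \<in> carrier G" "x \<in> X" "x \<noteq> \<one>"
proof -
  consider "e \<in> Y_edges G H E" | "e \<in> glued_Cayley_edges G H X V \<phi> t b" using assms by (auto simp: E'_def)
  then show thesis
  proof cases
    case 1
    then obtain C e' where "e = Pair C ` e'" "C \<in> cosets" "e' \<in> E" by (auto simp: Y_edges_def)
    moreover obtain u v where "e' = {u, v}" "u \<noteq> v" "{u, v} \<in> E" using edgeE[OF \<open>e' \<in> E\<close>] .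
    ultimately show ?thesis using that(1) edge_vertices by auto
  next
    case 2
    then show ?thesis using that(2) unfolding glued_Cayley_edges_def by blast
  qed
qed

lemma base_V': "g \<in> carrier G \<Longrightarrow> \<psi> g (H, b) \<in> V'"
  using group_action_closed[OF action_Y] b H_coset by (auto simp: Y_verts_def)

lemma simple_graph_Y: "simple_graph V' E'"
  unfolding simple_graph_def
proof
  fix e assume "e \<in> E'"
  then show "e \<subseteq> V' \<and> card e = 2"
  proof (cases rule: E'_cases)
    case (Y C u v) then show ?thesis by (auto simp: Y_verts_def)
  next
    case (glued g x)
    then have "\<psi> g (H, b) \<noteq> \<psi> (g \<otimes> x) (H, b)"
      using \<psi>_base_inj[of g "g \<otimes> x"] X_carrier by (auto simp: G.r_cancel_one')
    then show ?thesis using glued X_carrier base_V' by auto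
  qed
qed

lemma automorphism_Y: "graph_automorphism_action G V' E' \<psi>"
  unfolding graph_automorphism_action_def
proof (intro conjI ballI action_Y)
  fix g e assume g: "g \<in> carrier G" and "e \<in> E'"
  from this(2) show "\<psi> g ` e \<in> E'"
  proof (cases rule: E'_cases)
    case (Y C u v)
    then show ?thesis
      using g Y_edge[OF shift_coset[OF g Y(2)] \<phi>_edge[of "\<sigma> g C" u v]] \<sigma>_H[OF g Y(2)]
      by (simp add: \<psi>_eq)
  next
    case (glued k x)
    have "\<psi> g ` e = {\<psi> (g \<otimes> k) (H, b), \<psi> (g \<otimes> k \<otimes> x) (H, b)}"
      using glued g X_carrier group_action_mult[OF action_Y g, of _ "(H, b)"] b H_coset
      by (simp add: Y_verts_def G.m_assoc)
    then show ?thesis using glued_edge[of "g \<otimes> k" x] glued g by simp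
  qed
qed

lemma connected_copy:
  assumes "C \<in> cosets" "u \<in> V" "(u, v) \<in> adjacency E ^^ n"
  shows "((C, u), (C, v)) \<in> adjacency E' ^^ n"
  using assms(3)
proof (induction n arbitrary: v)
  case (Suc n)
  then obtain w where w: "(u, w) \<in> adjacency E ^^ n" "(w, v) \<in> adjacency E"
    by (auto elim: relpow_Suc_E)
  then have "((C, w), (C, v)) \<in> adjacency E'"
    using Y_edge[OF assms(1)] by (simp add: adjacency_def)
  then show ?case using Suc.IH[OF w(1)] by (rule relpow_Suc_I[rotated])
qed simp

lemma connected_copy_rtrancl:
  "C \<in> cosets \<Longrightarrow> u \<in> V \<Longrightarrow> v \<in> V \<Longrightarrow> ((C, u), (C, v)) \<in> (adjacency E')\<^sup>*"
  using connected_copy[OF _ _ dist_V_relpow] relpow_imp_rtrancl by blast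

lemma adjacency_rtrancl_sym:
  "(u, v) \<in> (adjacency F)\<^sup>* \<Longrightarrow> (v, u) \<in> (adjacency F)\<^sup>*"
  using relpow_adjacency_sym by (metis rtrancl_power)

lemma rtrancl_\<psi>:
  assumes "g \<in> carrier G" "(y, z) \<in> (adjacency E')\<^sup>*"
  shows "(\<psi> g y, \<psi> g z) \<in> (adjacency E')\<^sup>*"
  using assms(2)
proof induction
  case (step u v)
  have "\<psi> g ` {u, v} \<in> E'"
    using automorphism_Y assms(1) step(2)
    unfolding graph_automorphism_action_def adjacency_def by blast
  then show ?case using step.IH by (simp add: adjacency_def rtrancl_into_rtrancl)
qed simp

text \<open>A word in \<open>X\<close> and \<open>H\<close> is followed letter by letter: letters of
  \<open>H\<close> move inside the base copy, the others are glued edges, and the walk for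
  \<open>h\<close> translated by \<open>g\<close> continues the walk for \<open>g\<close>.\<close>

lemma connected_base:
  assumes "g \<in> carrier G" shows "((H, b), \<psi> g (H, b)) \<in> (adjacency E')\<^sup>*"
proof -
  have oV: "(H, b) \<in> V'" using b H_coset by (simp add: Y_verts_def)
  have single: "((H, b), \<psi> h (H, b)) \<in> (adjacency E')\<^sup>*" if "h \<in> X \<union> H" for h
  proof (cases "h \<in> H")
    case True
    then show ?thesis using connected_copy_rtrancl H_coset b by (simp add: \<psi>_H)
  next
    case False
    then have "h \<noteq> \<one>" "h \<in> X" using that by auto
    then have "{(H, b), \<psi> h (H, b)} \<in> E'"
      using glued_edge[of \<one> h] X_carrier group_action_one[OF action_Y oV] by simp
    then show ?thesis by (simp add: adjacency_def r_into_rtrancl)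
  qed
  have gen: "g \<in> generate G (X \<union> H)" using assms rel_gen by (simp add: rel_gen_set_def)
  have XH: "X \<union> H \<subseteq> carrier G" using X_carrier by auto
  show ?thesis using gen
  proof induction
    case one show ?case using single by simp
  next
    case (incl h) then show ?case by (rule single)
  next
    case (inv h) then show ?case using X_inv by (intro single) auto
  next
    case (eng g h)
    have gh: "g \<in> carrier G" "h \<in> carrier G" using eng G.generate_in_carrier[OF XH] by auto
    have "(\<psi> g (H, b), \<psi> (g \<otimes> h) (H, b)) \<in> (adjacency E')\<^sup>*"
      using rtrancl_\<psi>[OF gh(1) eng.IH(2)] group_action_mult[OF action_Y gh oV] by simp
    then show ?case using eng.IH(1) by (rule rtrancl_trans[rotated])
  qed
qed

lemma connected_Y: "connected_simple_graph V' E'"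
proof -
  have "((H, b), y) \<in> (adjacency E')\<^sup>*" if yV: "y \<in> V'" for y
  proof -
    obtain C r where y: "y = (C, r)" "C \<in> cosets" "r \<in> V" using yV by (auto simp: Y_verts_def)
    have g: "t C \<in> carrier G" "t C <# H = C" using y t_mem cosetD by auto
    \<comment> \<open>The translate of \<open>(H, b)\<close> by \<open>t C\<close> is
      \<open>(C, b)\<close>, so the copy over \<open>C\<close> is reached through its own base
      vertex.\<close>
    have "(\<psi> (t C) (H, b), y) \<in> (adjacency E')\<^sup>*"
      using connected_copy_rtrancl[OF y(2) _ y(3)] y g b by (simp add: \<psi>_base)
    then show ?thesis using connected_base[OF g(1)] by (rule rtrancl_trans[rotated])
  qed
  then show ?thesis
    unfolding connected_simple_graph_def
    using simple_graph_Y base_V'[of \<one>] adjacency_rtrancl_sym rtrancl_trans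
    by (metis (no_types, lifting) G.one_closed empty_iff)
qed

lemma graph_with_action_Y: "graph_with_action G V' E' \<psi>"
  by unfold_locales (use connected_Y automorphism_Y in auto)

lemma induced_action_eq: "induced_action G H X V E \<phi> t b = graph_action G V' E' \<psi>"
  by (simp add: induced_action_def E'_def)

section \<open>From incompressibility to extensions\<close>

definition orbit_dist :: "'g \<Rightarrow> 'g \<Rightarrow> nat" where
  "orbit_dist h k = dist_V (\<phi> h b) (\<phi> k b)"

text \<open>The orbit gives a metric and not only a pseudometric because \<open>H\<close> acts
  freely on the vertices, and its values are natural numbers because distances of vertices are; both
  are required for incompressibility to apply to it.\<close>

lemma orbit_dist_left_invariant: "orbit_dist \<in> left_invariant_metrics G H"
proof -
  have "Metric_space H (\<lambda>x y. real (orbit_dist x y))"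
  proof
    fix x y z assume "x \<in> H" "y \<in> H" "z \<in> H"
    then show "real (orbit_dist x z) \<le> real (orbit_dist x y) + real (orbit_dist y z)"
      using dist_V_triangle[of "\<phi> x b" "\<phi> y b" "\<phi> z b"] b by (simp add: orbit_dist_def flip: of_nat_add)
  qed (use dist_V_eq_0 \<phi>_free b in \<open>auto simp: orbit_dist_def vertex_dist_commute\<close>)
  moreover have "orbit_dist (h \<otimes> x) (h \<otimes> y) = orbit_dist x y" if "h \<in> H" "x \<in> H" "y \<in> H" for h x y
    using that \<phi>_mult[of h _ b] dist_V_\<phi>[of h "\<phi> x b" "\<phi> y b"] b by (simp add: orbit_dist_def)
  ultimately show ?thesis by (simp add: left_invariant_metrics_def)
qed

sublocale il: induced_length G H X orbit_dist
  by unfold_locales (use H rel_gen orbit_dist_left_invariant in auto)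

text \<open>
  In the second case, \<open>g(H, b)\<close> is where the walk first leaves the copy \<open>C\<close>, and \<open>h(H, b)\<close> where it
  last enters the copy \<open>H\<close>.
\<close>

lemma walk_to_base_copy:
  assumes "((C, r), (H, v)) \<in> adjacency E' ^^ n" "C \<in> cosets" "r \<in> V" "v \<in> V"
  shows "C = H \<and> dist_V r v \<le> n \<or>
    (\<exists>g\<in>C. \<exists>h\<in>H. dist_V r (\<phi> (inv (t C) \<otimes> g) b) + il.len (inv g \<otimes> h) + dist_V (\<phi> h b) v \<le> n)"
  using assms
proof (induction n arbitrary: C r)
  case 0
  then show ?case by simp
next
  case (Suc n)
  obtain C1 r1 where "((C, r), (C1, r1)) \<in> adjacency E'" and
    walk: "((C1, r1), (H, v)) \<in> adjacency E' ^^ n"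
    using Suc.prems(1) by (metis relpow_Suc_D2 surj_pair)
  then have e: "{(C, r), (C1, r1)} \<in> E'" by (simp add: adjacency_def)
  have C1: "C1 \<in> cosets" "r1 \<in> V" using simple_graph_Y e by (auto simp: simple_graph_def Y_verts_def)
  note IH = Suc.IH[OF walk C1 Suc.prems(4)]
  from e show ?case
  proof (cases rule: E'_cases)
    case (Y D u w)
    then have eq: "C1 = C" and "{r, r1} \<in> E" by (auto simp: doubleton_eq_iff insert_commute)
    then have tri: "dist_V r z \<le> Suc (dist_V r1 z)" if "z \<in> V" for z
      using dist_V_triangle[of r r1 z] dist_V_edge[of r r1] that C1 Suc.prems by simp
    from IH show ?thesis
    proof (elim disjE conjE bexE)
      assume "C1 = H" "dist_V r1 v \<le> n"
      then show ?thesis using tri[OF Suc.prems(4)] eq by simp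
    next
      fix g h assume gh: "g \<in> C1" "h \<in> H"
        "dist_V r1 (\<phi> (inv (t C1) \<otimes> g) b) + il.len (inv g \<otimes> h) + dist_V (\<phi> h b) v \<le> n"
      have "\<phi> (inv (t C1) \<otimes> g) b \<in> V" using t_diff[OF C1(1) gh(1)] b by simp
      then show ?thesis
        using tri gh eq by (intro disjI2 bexI[of _ g] bexI[of _ h]) force+
    qed
  next
    case (glued k x)
    have kx: "k \<otimes> x \<in> carrier G" "inv k \<otimes> (k \<otimes> x) = x" "inv (k \<otimes> x) \<otimes> k = inv x"
      using glued X_carrier by (auto simp: G.m_assoc[symmetric] G.inv_mult_group) (simp add: G.m_assoc)
    \<comment> \<open>Edges are unordered, so the step follows \<open>x\<close> or its inverse; the
      symmetry of \<open>X\<close> covers both.\<close>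
    obtain g1 g2 where g: "g1 \<in> carrier G" "g2 \<in> carrier G" "inv g1 \<otimes> g2 \<in> X"
      "(C, r) = \<psi> g1 (H, b)" "(C1, r1) = \<psi> g2 (H, b)"
    proof -
      have "(C, r) = \<psi> k (H, b) \<and> (C1, r1) = \<psi> (k \<otimes> x) (H, b) \<or>
          (C, r) = \<psi> (k \<otimes> x) (H, b) \<and> (C1, r1) = \<psi> k (H, b)"
        using glued(1) by (auto simp: doubleton_eq_iff)
      then show thesis
        using that[of k "k \<otimes> x"] that[of "k \<otimes> x" k] kx glued X_inv by auto
    qed
    have Cr: "C = g1 <# H" "r = \<phi> (inv (t C) \<otimes> g1) b" "C1 = g2 <# H" "r1 = \<phi> (inv (t C1) \<otimes> g2) b"
      using g by (auto simp: \<psi>_base)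
    have g1: "g1 \<in> C" "dist_V r (\<phi> (inv (t C) \<otimes> g1) b) = 0" using Cr mem_coset g by auto
    from IH show ?thesis
    proof (elim disjE conjE bexE)
      \<comment> \<open>The rest of the walk is controlled inside the base copy: \<open>g1\<close>
        is the point of exit, \<open>g2\<close> the point of entry, and the glued edge between them
        has induced length at most 1.\<close>
      assume C1H: "C1 = H" and le: "dist_V r1 v \<le> n"
      have "g2 \<in> H" using coset_eq_H g Cr C1H by simp
      moreover have "r1 = \<phi> g2 b" using Cr C1H g by simp
      ultimately show ?thesis
        using g1 il.len_X[OF g(3)] le by (intro disjI2 bexI[of _ g1] bexI[of _ g2]) auto
    next
      fix k h assume kh: "k \<in> C1" "h \<in> H"
        "dist_V r1 (\<phi> (inv (t C1) \<otimes> k) b) + il.len (inv k \<otimes> h) + dist_V (\<phi> h b) v \<le> n"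
      have k: "k \<in> carrier G" using cosetD C1 kh by auto
      have m: "inv (t C1) \<otimes> g2 \<in> H" "inv (t C1) \<otimes> k \<in> H"
        using t_diff[OF C1(1)] kh mem_coset g Cr by auto
      \<comment> \<open>The exit moves from \<open>k\<close> back to \<open>g1\<close>, and the
        section inside \<open>C1\<close> from \<open>g2\<close> to \<open>k\<close> joins the middle
        part. This costs nothing extra: \<open>inv g2 \<otimes> k\<close> lies in \<open>H\<close>,
        and its induced length is at most the orbit distance, which is the distance travelled in the
        copy.\<close>
      have eq: "inv (inv (t C1) \<otimes> g2) \<otimes> (inv (t C1) \<otimes> k) = inv g2 \<otimes> k"
        using g k C1 by (simp add: G.inv_mult_group G.m_assoc mult_inv_cancel)
      then have "inv g2 \<otimes> k \<in> H" using m H_mult H_inv by metis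
      then have 1: "il.len (inv g2 \<otimes> k) \<le> dist_V r1 (\<phi> (inv (t C1) \<otimes> k) b)"
        using il.len_H[of "inv g2 \<otimes> k"] il.d_translate[OF m] eq Cr by (simp add: orbit_dist_def)
      have eq2: "inv g1 \<otimes> h = (inv g1 \<otimes> g2) \<otimes> ((inv g2 \<otimes> k) \<otimes> (inv k \<otimes> h))"
        using g k kh by (simp add: G.m_assoc mult_inv_cancel)
      have "il.len (inv g1 \<otimes> h)
          \<le> il.len (inv g1 \<otimes> g2) + (il.len (inv g2 \<otimes> k) + il.len (inv k \<otimes> h))"
        unfolding eq2 using g k kh
        by (intro order_trans[OF il.len_mult] add_left_mono il.len_mult) auto
      then show ?thesis
        using g1 il.len_X[OF g(3)] 1 kh by (intro disjI2 bexI[of _ g1] bexI[of _ h]) auto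
    qed
  qed
qed

theorem is_extension_induced_action:
  assumes "incompressible_wrt G H X"
  shows "is_extension H (graph_action (G\<lparr>carrier := H\<rparr>) V E \<phi>) (induced_action G H X V E \<phi> t b)"
proof -
  interpret Y: graph_with_action G V' E' \<psi> by (rule graph_with_action_Y)
  let ?K = "G\<lparr>carrier := H\<rparr>"
  let ?R = "vertex_action V E \<phi>" and ?S = "vertex_action V' E' \<psi>"
  obtain A where A: "A \<ge> 1" "\<And>h. h \<in> H \<Longrightarrow> real (orbit_dist \<one> h) \<le> A * real (il.len h) + A"
    using il.incompressible_wrtE[OF assms] by blast
  have "qi_embedding V (\<lambda>u v. real (dist_V u v)) V' (\<lambda>y z. real (Y.dist_V y z)) (Pair H)"
  proof (rule qi_embeddingI[OF _ A(1)])
    show "Pair H \<in> V \<rightarrow> V'" using H_coset by (auto simp: Y_verts_def)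
    fix u v assume uv: "u \<in> V" "v \<in> V"
    define n where "n = Y.dist_V (H, u) (H, v)"
    have "n \<le> dist_V u v"
      unfolding n_def by (rule vertex_dist_le[OF connected_copy[OF H_coset uv(1) dist_V_relpow[OF uv]]])
    then show "real (Y.dist_V (H, u) (H, v)) \<le> A * real (dist_V u v) + A"
      using A(1) mult_right_mono[of 1 A "real (dist_V u v)"] by (simp add: n_def)
    have "((H, u), (H, v)) \<in> adjacency E' ^^ n"
      unfolding n_def using uv H_coset by (intro Y.dist_V_relpow) (auto simp: Y_verts_def)
    from walk_to_base_copy[OF this H_coset uv]
    have "real (dist_V u v) \<le> A * real n + A"
    proof (elim disjE conjE bexE)
      assume "dist_V u v \<le> n"
      then show ?thesis using A(1) mult_right_mono[of 1 A "real n"] by simp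
    next
      fix g h assume gh: "g \<in> H" "h \<in> H"
        "dist_V u (\<phi> (inv (t H) \<otimes> g) b) + il.len (inv g \<otimes> h) + dist_V (\<phi> h b) v \<le> n"
      define p q where "p = dist_V u (\<phi> g b)" and "q = dist_V (\<phi> h b) v"
      have le: "real p + real (il.len (inv g \<otimes> h)) + real q \<le> real n"
        using gh by (simp add: p_def q_def flip: of_nat_add)
      have V: "\<phi> g b \<in> V" "\<phi> h b \<in> V" using gh b by auto
      have "dist_V u v \<le> p + dist_V (\<phi> g b) (\<phi> h b) + q"
        using dist_V_triangle[OF uv(1) V(1) uv(2)] dist_V_triangle[OF V uv(2)]
        by (simp add: p_def q_def)
      moreover have "dist_V (\<phi> g b) (\<phi> h b) = orbit_dist \<one> (inv g \<otimes> h)"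
        using il.d_translate[OF gh(1,2)] by (simp add: orbit_dist_def)
      \<comment> \<open>Here the walk starts in the base copy too, so exit and entry both lie in
        \<open>H\<close> and incompressibility applies to their quotient.\<close>
      moreover have "real (orbit_dist \<one> (inv g \<otimes> h)) \<le> A * real (il.len (inv g \<otimes> h)) + A"
        using gh by (intro A(2)) simp
      ultimately have "real (dist_V u v) \<le> real p + (A * real (il.len (inv g \<otimes> h)) + A) + real q"
        by linarith
      also have "\<dots> \<le> A * (real p + real (il.len (inv g \<otimes> h)) + real q) + A"
        using A(1) mult_right_mono[of 1 A "real p"] mult_right_mono[of 1 A "real q"]
        by (simp add: algebra_simps)
      also have "\<dots> \<le> A * real n + A" using le A(1) by simp
      finally show ?thesis .
    qed
    then show "real (dist_V u v) \<le> A * real (Y.dist_V (H, u) (H, v)) + A" by (simp add: n_def)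
  qed (use A(1) in auto)
  moreover have "coarsely_equivariant H ?R ?S (Pair H)"
    unfolding coarsely_equivariant_def
    by (intro ballI bdd_aboveI2[where M = 0]) (simp add: \<psi>_H)
  ultimately have RS: "is_extension (carrier ?K) ?R ?S"
    unfolding is_extension_def by (intro exI[of _ "Pair H"]) (simp add: vertex_action_def)
  \<comment> \<open>The estimate was made on vertices; both sides are now replaced by the
    realizations, to which they are equivalent.\<close>
  note iS = isometric_action_subgroup[OF Y.isometric_vertex_action H]
    and iY = isometric_action_subgroup[OF Y.isometric_graph_action H]
  have "is_extension (carrier ?K) ?R (graph_action G V' E' \<psi>)"
    using equivalent_actions_imp_extension[OF Y.equivalent_vertex_graph_action] H_subset
    by (intro is_extension_trans[OF isometric_vertex_action iS iY RS]) simp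
  moreover have "is_extension (carrier ?K) (graph_action ?K V E \<phi>) ?R"
    using equivalent_actions_imp_extension[OF equivalent_actions_sym[OF isometric_vertex_action
        isometric_graph_action equivalent_vertex_graph_action]] by simp
  ultimately have "is_extension (carrier ?K) (graph_action ?K V E \<phi>) (graph_action G V' E' \<psi>)"
    by (rule is_extension_trans[OF isometric_graph_action isometric_vertex_action iY, rotated])
  then show ?thesis by (simp add: induced_action_eq)
qed

end

section \<open>Embedding an action into a geodesic one\<close>

lemma UN_nat_lepoll:
  fixes L :: "nat \<Rightarrow> 'a set" and C :: "'c set"
  assumes "infinite C" "\<And>n. L n \<lesssim> C"
  shows "(\<Union>n. L n) \<lesssim> C"
proof -
  have "\<forall>n. \<exists>g. L n \<subseteq> g ` C" using assms(2) by (simp add: lepoll_iff)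
  then obtain g where g: "\<And>n. L n \<subseteq> g n ` C" by metis
  have "(\<Union>n. L n) \<subseteq> (\<lambda>(n, c). g n c) ` (UNIV \<times> C)" using g by fastforce
  then have "(\<Union>n. L n) \<lesssim> (UNIV :: nat set) \<times> C" by (rule subset_image_lepoll)
  also have "\<dots> \<lesssim> C"
    by (rule times_lepoll_infinite) (use assms(1) in \<open>auto simp: infinite_le_lepoll\<close>)
  finally show ?thesis .
qed

text \<open>
  The convex hull of the Kuratowski embedding \<open>x \<mapsto> d(x, \<cdot>)\<close> in the functions with the supremum
  distance is geodesic, its geodesics being affine segments. Unlike the whole space of functions it is
  not larger than the given space (and the continuum). It is built in \<open>\<omega>\<close> steps.
\<close>

locale kuratowski_hull =
  fixes K :: "'g monoid" and R :: "('g, 'p) isoact"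
  assumes action: "isometric_action K R"
begin

abbreviation P :: "'p set" where "P \<equiv> points R"
abbreviation d :: "'p \<Rightarrow> 'p \<Rightarrow> real" where "d \<equiv> metric R"

sublocale Metric_space P d using action by (rule isometric_action_metric)
sublocale K: group K using action by (rule isometric_action_group)

lemma group_action: "group_action K P (act R)" and nonempty: "P \<noteq> {}"
  using action by (auto simp: isometric_action_def)

lemmas act_closed [simp] = group_action_closed[OF group_action]
lemmas act_inv [simp] = group_action_inv[OF group_action]

text \<open>The value 0 off \<open>P\<close> is inherited by the whole hull; a function in it is
  then determined on \<open>P\<close>, so the supremum over \<open>P\<close> separates the
  functions.\<close>

definition \<kappa> :: "'p \<Rightarrow> 'p \<Rightarrow> real" where
  "\<kappa> x = (\<lambda>y. if y \<in> P then d x y else 0)"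

definition comb :: "real \<Rightarrow> ('p \<Rightarrow> real) \<Rightarrow> ('p \<Rightarrow> real) \<Rightarrow> 'p \<Rightarrow> real" where
  "comb s f g = (\<lambda>y. (1 - s) * f y + s * g y)"

primrec level :: "nat \<Rightarrow> ('p \<Rightarrow> real) set" where
  "level 0 = \<kappa> ` P"
| "level (Suc n) = (\<lambda>(f, g, s). comb s f g) ` (level n \<times> level n \<times> {0..1})"

definition Hull :: "('p \<Rightarrow> real) set" where "Hull = (\<Union>n. level n)"

lemma level_Suc: "level n \<subseteq> level (Suc n)"
proof
  fix f assume "f \<in> level n"
  then show "f \<in> level (Suc n)"
    by (auto simp: comb_def intro!: image_eqI[of _ _ "(f, f, 0)"])
qed

lemma level_mono: "m \<le> n \<Longrightarrow> level m \<subseteq> level n"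
  by (rule lift_Suc_mono_le[of level, OF level_Suc])

lemma \<kappa>_hull: "x \<in> P \<Longrightarrow> \<kappa> x \<in> Hull"
  unfolding Hull_def by (rule UN_I[of 0]) auto

lemma comb_hull:
  assumes "f \<in> Hull" "g \<in> Hull" "0 \<le> s" "s \<le> 1" shows "comb s f g \<in> Hull"
proof -
  obtain m n where mn: "f \<in> level m" "g \<in> level n" using assms by (auto simp: Hull_def)
  have "f \<in> level (max m n)" "g \<in> level (max m n)"
    using mn level_mono[of m "max m n"] level_mono[of n "max m n"] by auto
  then have "comb s f g \<in> level (Suc (max m n))"
    using assms(3,4) by (auto intro!: image_eqI[of _ _ "(f, g, s)"])
  then show ?thesis unfolding Hull_def by blast
qed

lemma hull_induct [consumes 1, case_names base comb]:
  assumes "f \<in> Hull" and base: "\<And>x. x \<in> P \<Longrightarrow> Q (\<kappa> x)"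
    and comb: "\<And>s f g. f \<in> Hull \<Longrightarrow> g \<in> Hull \<Longrightarrow> Q f \<Longrightarrow> Q g \<Longrightarrow> 0 \<le> s \<Longrightarrow> s \<le> 1 \<Longrightarrow> Q (comb s f g)"
  shows "Q f"
proof -
  have "Q f" if "f \<in> level n" for n f
    using that
  proof (induction n arbitrary: f)
    case (Suc n)
    then obtain g h s where "f = comb s g h" "g \<in> level n" "h \<in> level n" "0 \<le> s" "s \<le> 1" by auto
    moreover from this have "g \<in> Hull" "h \<in> Hull" unfolding Hull_def by blast+
    ultimately show ?case using Suc.IH comb[of g h s] by simp
  qed (auto intro: base)
  then show ?thesis using assms(1) by (auto simp: Hull_def)
qed

lemma hull_outside: "f \<in> Hull \<Longrightarrow> y \<notin> P \<Longrightarrow> f y = 0"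
  by (induction rule: hull_induct) (auto simp: \<kappa>_def comb_def)

lemma abs_comb_le:
  fixes a b :: real
  assumes "\<bar>a\<bar> \<le> B" "\<bar>b\<bar> \<le> B" "0 \<le> s" "s \<le> 1"
  shows "\<bar>(1 - s) * a + s * b\<bar> \<le> B"
proof -
  have "\<bar>(1 - s) * a + s * b\<bar> \<le> (1 - s) * \<bar>a\<bar> + s * \<bar>b\<bar>"
    using assms(3,4) abs_triangle_ineq[of "(1 - s) * a" "s * b"] by (simp add: abs_mult)
  also have "\<dots> \<le> (1 - s) * B + s * B"
    using assms by (intro add_mono mult_left_mono) auto
  finally show ?thesis by (simp add: algebra_simps)
qed

text \<open>The functions themselves are unbounded when the space is, but each stays within bounded
  distance of \<open>d x\<close>: on the image of \<open>\<kappa>\<close> by the reverse triangle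
  inequality, elsewhere by convexity. This makes the suprema in \<open>sup_dist\<close>
  finite.\<close>

lemma hull_bounded:
  assumes "x \<in> P" "f \<in> Hull" shows "\<exists>B. \<forall>y\<in>P. \<bar>f y - d x y\<bar> \<le> B"
  using assms(2)
proof (induction rule: hull_induct)
  case (base z)
  have "\<bar>\<kappa> z y - d x y\<bar> \<le> d z x" if "y \<in> P" for y
    using mdist_reverse_triangle[of z y x] base assms(1) that by (simp add: \<kappa>_def commute)
  then show ?case by blast
next
  case (comb s f g)
  then obtain B C where B: "\<forall>y\<in>P. \<bar>f y - d x y\<bar> \<le> B" "\<forall>y\<in>P. \<bar>g y - d x y\<bar> \<le> C" by blast
  have "\<bar>comb s f g y - d x y\<bar> \<le> max B C" if "y \<in> P" for y
  proof -
    have "comb s f g y - d x y = (1 - s) * (f y - d x y) + s * (g y - d x y)"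
      by (simp add: comb_def algebra_simps)
    then show ?thesis using abs_comb_le[of "f y - d x y" "max B C" "g y - d x y" s] B that comb
      by (simp add: max.coboundedI1 max.coboundedI2)
  qed
  then show ?case by blast
qed

definition sup_dist :: "('p \<Rightarrow> real) \<Rightarrow> ('p \<Rightarrow> real) \<Rightarrow> real" where
  "sup_dist f g = (if f \<in> Hull \<and> g \<in> Hull then SUP y\<in>P. \<bar>f y - g y\<bar> else 0)"

lemma sup_dist_upper:
  assumes "f \<in> Hull" "g \<in> Hull" "y \<in> P" shows "\<bar>f y - g y\<bar> \<le> sup_dist f g"
proof -
  obtain x where x: "x \<in> P" using nonempty by blast
  obtain B C where "\<forall>y\<in>P. \<bar>f y - d x y\<bar> \<le> B" "\<forall>y\<in>P. \<bar>g y - d x y\<bar> \<le> C"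
    using hull_bounded[OF x] assms by meson
  then have "\<bar>f y - g y\<bar> \<le> B + C" if "y \<in> P" for y using that by (smt (verit))
  then have "bdd_above ((\<lambda>y. \<bar>f y - g y\<bar>) ` P)" by (rule bdd_aboveI2)
  from cSUP_upper[OF assms(3) this] show ?thesis using assms by (simp add: sup_dist_def)
qed

lemma sup_dist_least:
  assumes "f \<in> Hull" "g \<in> Hull" "\<And>y. y \<in> P \<Longrightarrow> \<bar>f y - g y\<bar> \<le> B" shows "sup_dist f g \<le> B"
  using assms nonempty by (simp add: sup_dist_def cSUP_least)

lemma sup_dist_metric: "Metric_space Hull sup_dist"
proof
  fix f g
  show "0 \<le> sup_dist f g"
  proof (cases "f \<in> Hull \<and> g \<in> Hull")
    case True
    obtain x where "x \<in> P" using nonempty by blast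
    then have "0 \<le> \<bar>f x - g x\<bar>" "\<bar>f x - g x\<bar> \<le> sup_dist f g" using sup_dist_upper True by auto
    then show ?thesis by linarith
  next
    case False then show ?thesis by (auto simp: sup_dist_def)
  qed
  show "sup_dist f g = sup_dist g f"
    by (simp add: sup_dist_def abs_minus_commute conj_commute)
next
  fix f g assume fg: "f \<in> Hull" "g \<in> Hull"
  have "f = g" if "sup_dist f g = 0"
  proof
    fix y show "f y = g y"
      using sup_dist_upper[OF fg, of y] that hull_outside[OF fg(1)] hull_outside[OF fg(2)]
      by (cases "y \<in> P") auto
  qed
  moreover have "sup_dist f f = 0" using fg(1) nonempty by (simp add: sup_dist_def)
  ultimately show "sup_dist f g = 0 \<longleftrightarrow> f = g" by blast
next
  fix f g h assume fgh: "f \<in> Hull" "g \<in> Hull" "h \<in> Hull"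
  show "sup_dist f h \<le> sup_dist f g + sup_dist g h"
    using sup_dist_upper[OF fgh(1,2)] sup_dist_upper[OF fgh(2,3)]
    by (intro sup_dist_least fgh) (smt (verit))
qed

sublocale Hull: Metric_space Hull sup_dist by (rule sup_dist_metric)

text \<open>The reverse triangle inequality bounds the supremum from above, and evaluation at
  \<open>z\<close> attains it.\<close>

lemma sup_dist_\<kappa>: assumes "x \<in> P" "z \<in> P" shows "sup_dist (\<kappa> x) (\<kappa> z) = d x z"
proof (rule antisym)
  show "sup_dist (\<kappa> x) (\<kappa> z) \<le> d x z"
  proof (rule sup_dist_least)
    fix y assume "y \<in> P"
    then show "\<bar>\<kappa> x y - \<kappa> z y\<bar> \<le> d x z"
      using mdist_reverse_triangle[of x y z] assms by (simp add: \<kappa>_def commute)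
  qed (use assms \<kappa>_hull in auto)
  show "d x z \<le> sup_dist (\<kappa> x) (\<kappa> z)"
    using sup_dist_upper[OF \<kappa>_hull[OF assms(1)] \<kappa>_hull[OF assms(2)] assms(2)] assms
    by (simp add: \<kappa>_def)
qed

text \<open>Along the affine segment the difference of two points is a fixed multiple of
  \<open>f - g\<close> at every argument, so the supremum scales by that factor.\<close>

lemma has_geodesic_hull:
  assumes f: "f \<in> Hull" and g: "g \<in> Hull" shows "has_geodesic Hull sup_dist f g"
proof (cases "f = g")
  case True then show ?thesis using Hull.has_geodesic_refl f by simp
next
  case False
  define L where "L = sup_dist f g"
  have L: "L > 0" using Hull.mdist_pos_less[OF False f g] by (simp add: L_def)
  define \<gamma> where "\<gamma> = (\<lambda>t. comb (t / L) f g)"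
  have \<gamma>: "\<gamma> t \<in> Hull" if "t \<in> {0..L}" for t
    using that L f g by (auto simp: \<gamma>_def intro!: comb_hull)
  have diff: "\<bar>\<gamma> s y - \<gamma> t y\<bar> = \<bar>s - t\<bar> / L * \<bar>f y - g y\<bar>" for s t y
  proof -
    have "\<gamma> s y - \<gamma> t y = (s - t) / L * (g y - f y)"
      by (simp add: \<gamma>_def comb_def diff_divide_distrib algebra_simps)
    then show ?thesis using L by (simp add: abs_mult abs_minus_commute)
  qed
  have "sup_dist (\<gamma> s) (\<gamma> t) = \<bar>s - t\<bar>" if st: "s \<in> {0..L}" "t \<in> {0..L}" for s t
  proof (rule antisym)
    show "sup_dist (\<gamma> s) (\<gamma> t) \<le> \<bar>s - t\<bar>"
    proof (rule sup_dist_least[OF \<gamma>[OF st(1)] \<gamma>[OF st(2)]])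
      fix y assume "y \<in> P"
      then have "\<bar>s - t\<bar> / L * \<bar>f y - g y\<bar> \<le> \<bar>s - t\<bar> / L * L"
        using sup_dist_upper[OF f g] L by (intro mult_left_mono) (auto simp: L_def)
      then show "\<bar>\<gamma> s y - \<gamma> t y\<bar> \<le> \<bar>s - t\<bar>" using L by (simp add: diff)
    qed
    show "\<bar>s - t\<bar> \<le> sup_dist (\<gamma> s) (\<gamma> t)"
    proof (cases "s = t")
      case False
      \<comment> \<open>The lower bound uses the scaling backwards: \<open>f - g\<close> is a
        multiple of the difference of \<open>\<gamma> s\<close> and
        \<open>\<gamma> t\<close>.\<close>
      have "sup_dist f g \<le> L / \<bar>s - t\<bar> * sup_dist (\<gamma> s) (\<gamma> t)"
      proof (rule sup_dist_least[OF f g])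
        fix y assume "y \<in> P"
        then have "\<bar>s - t\<bar> / L * \<bar>f y - g y\<bar> \<le> sup_dist (\<gamma> s) (\<gamma> t)"
          using sup_dist_upper[OF \<gamma>[OF st(1)] \<gamma>[OF st(2)]] by (simp only: diff)
        then show "\<bar>f y - g y\<bar> \<le> L / \<bar>s - t\<bar> * sup_dist (\<gamma> s) (\<gamma> t)"
          using L False by (simp add: field_simps)
      qed
      then show ?thesis using L False by (simp add: field_simps flip: L_def)
    qed (use Hull.nonneg in auto)
  qed
  moreover have "\<gamma> 0 = f" "\<gamma> L = g" using L by (auto simp: \<gamma>_def comb_def)
  ultimately show ?thesis
    unfolding has_geodesic_def L_def[symmetric] using \<gamma> by blast
qed

definition hull_act :: "'g \<Rightarrow> ('p \<Rightarrow> real) \<Rightarrow> 'p \<Rightarrow> real" where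
  "hull_act g = (\<lambda>f\<in>Hull. \<lambda>y. if y \<in> P then f (act R (inv\<^bsub>K\<^esub> g) y) else 0)"

text \<open>As \<open>g\<close> is an isometry, the distance from \<open>x\<close> to the translate
  of \<open>y\<close> by the inverse of \<open>g\<close> equals the distance from
  \<open>act R g x\<close> to \<open>y\<close>.\<close>

lemma hull_act_\<kappa>:
  assumes "g \<in> carrier K" "x \<in> P" shows "hull_act g (\<kappa> x) = \<kappa> (act R g x)"
proof
  fix y show "hull_act g (\<kappa> x) y = \<kappa> (act R g x) y"
    using assms \<kappa>_hull isometric_action_isom[OF action assms(1), of x "act R (inv\<^bsub>K\<^esub> g) y"]
    by (auto simp: hull_act_def) (auto simp: \<kappa>_def)
qed

text \<open>Precomposition commutes with convex combinations and maps the image of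
  \<open>\<kappa>\<close> to itself.\<close>

lemma hull_act_closed: "f \<in> Hull \<Longrightarrow> g \<in> carrier K \<Longrightarrow> hull_act g f \<in> Hull"
proof (induction rule: hull_induct)
  case (base x) then show ?case by (simp add: hull_act_\<kappa> \<kappa>_hull)
next
  case (comb s f h)
  have "hull_act g (comb s f h) = comb s (hull_act g f) (hull_act g h)"
    using comb comb_hull by (auto simp: hull_act_def fun_eq_iff) (auto simp: comb_def)
  then show ?case using comb comb_hull by simp
qed

lemma hull_group_action: "group_action K Hull hull_act"
proof (rule group_actionI[OF K.group_axioms])
  show "hull_act \<one>\<^bsub>K\<^esub> f = f" if "f \<in> Hull" for f
    using that hull_outside by (auto simp: hull_act_def fun_eq_iff group_action_one[OF group_action])
  show "hull_act (g \<otimes>\<^bsub>K\<^esub> h) f = hull_act g (hull_act h f)"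
    if "g \<in> carrier K" "h \<in> carrier K" "f \<in> Hull" for g h f
    using that hull_act_closed[of f h]
    by (auto simp: hull_act_def fun_eq_iff K.inv_mult_group group_action_mult[OF group_action])
qed (auto simp: hull_act_closed, simp add: hull_act_def)

lemma sup_dist_hull_act_le:
  assumes "f \<in> Hull" "h \<in> Hull" "g \<in> carrier K"
  shows "sup_dist (hull_act g f) (hull_act g h) \<le> sup_dist f h"
proof (rule sup_dist_least)
  fix y assume "y \<in> P"
  then show "\<bar>hull_act g f y - hull_act g h y\<bar> \<le> sup_dist f h"
    using assms sup_dist_upper[of f h "act R (inv\<^bsub>K\<^esub> g) y"] by (simp add: hull_act_def)
qed (use assms hull_act_closed in auto)

definition hull_action :: "('g, 'p \<Rightarrow> real) isoact" where
  "hull_action = \<lparr>points = Hull, metric = sup_dist, act = hull_act\<rparr>"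

lemma geodesic_hull_action: "geodesic_action K hull_action"
proof -
  have "sup_dist (hull_act g f) (hull_act g h) = sup_dist f h"
    if "g \<in> carrier K" "f \<in> Hull" "h \<in> Hull" for g f h
  proof (rule antisym)
    show "sup_dist (hull_act g f) (hull_act g h) \<le> sup_dist f h"
      using that by (simp add: sup_dist_hull_act_le)
    show "sup_dist f h \<le> sup_dist (hull_act g f) (hull_act g h)"
      using sup_dist_hull_act_le[of "hull_act g f" "hull_act g h" "inv\<^bsub>K\<^esub> g"] that
        group_action_inv(1)[OF hull_group_action] by (simp add: hull_act_closed)
  qed
  moreover have "Hull \<noteq> {}" using nonempty \<kappa>_hull by blast
  ultimately have "isometric_action K hull_action"
    using hull_group_action sup_dist_metric by (simp add: isometric_action_def hull_action_def)
  then show ?thesis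
    using geodesic_spaceI[OF sup_dist_metric has_geodesic_hull]
    by (simp add: geodesic_action_def hull_action_def)
qed

lemma is_extension_hull_action: "is_extension (carrier K) R hull_action"
proof -
  have "qi_embedding P d Hull sup_dist \<kappa>"
    by (rule qi_embeddingI[where A = 1 and B = 0]) (auto simp: \<kappa>_hull sup_dist_\<kappa>)
  moreover have "coarsely_equivariant (carrier K) R hull_action \<kappa>"
    unfolding coarsely_equivariant_def
    by (intro ballI bdd_aboveI2[where M = 0]) (simp add: hull_action_def hull_act_\<kappa> \<kappa>_hull)
  ultimately show ?thesis
    unfolding is_extension_def by (intro exI[of _ \<kappa>]) (simp add: hull_action_def)
qed

text \<open>Each level is an image of two copies of the previous one and an interval, so it stays
  within \<open>C\<close>; there are countably many levels.\<close>

lemma hull_lepoll: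
  assumes "P \<lesssim> C" "(UNIV :: real set) \<lesssim> C" shows "Hull \<lesssim> C"
proof -
  have inf: "infinite C"
    using assms(2) infinite_UNIV_char_0[where 'a = real] by (meson infinite_le_lepoll lepoll_trans)
  have "level n \<lesssim> C" for n
  proof (induction n)
    case 0 then show ?case using lepoll_trans[OF image_lepoll assms(1)] by simp
  next
    case (Suc n)
    have "level n \<times> level n \<times> {0..1::real} \<lesssim> C"
      by (intro times_lepoll_infinite inf Suc lepoll_trans[OF subset_imp_lepoll assms(2)]) simp
    then show ?case using lepoll_trans[OF image_lepoll] by simp
  qed
  then show ?thesis unfolding Hull_def by (rule UN_nat_lepoll[OF inf])
qed

end

section \<open>Extensions and induced actions\<close>

context
  fixes G :: "'g monoid" and H :: "'g set"
  assumes c: "(UNIV :: nat set set) \<lesssim> (UNIV :: 'm set)"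
    and G: "group G" and cG: "carrier G \<lesssim> (UNIV :: 'm set)" and H: "subgroup H G"
begin

lemma real_lepoll: "(UNIV :: real set) \<lesssim> (UNIV :: 'm set)"
  by (rule lepoll_trans[OF real_lepoll_nat_set c])

lemma infinite_m: "infinite (UNIV :: 'm set)"
  using real_lepoll infinite_UNIV_char_0[where 'a = real] by (meson infinite_le_lepoll lepoll_trans)

text \<open>Members of both classes have to be exhibited on subsets of \<open>'m\<close>, so the
  realizations of the graph and of the glued graph are relabelled and the extension between them is
  composed with the relabellings.\<close>

lemma Ind_wrt_extension:
  assumes X: "rel_gen_set G H X" "incompressible_wrt G H X"
    and A: "(A :: ('g, 'm) isoact set) \<in> action_classes (G\<lparr>carrier := H\<rparr>)"
  shows "class_extension H A (Ind_wrt G H X A)"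
proof -
  let ?K = "G\<lparr>carrier := H\<rparr>"
  obtain V :: "'m set" and E \<phi> t b where g: "connected_simple_graph V E"
    "graph_automorphism_action ?K V E \<phi>" "free_on_vertices ?K V \<phi>"
    "action_class ?K (graph_action ?K V E \<phi>) = A" "transversal G H t" "b \<in> V"
    and Ind: "Ind_wrt G H X A = action_class G (induced_action G H X V E \<phi> t b)"
    using Ind_wrtE[OF G H A cG infinite_m] by metis
  interpret group G by (rule G)
  interpret induced_graph G H V E \<phi> X t b
    by (intro induced_graph.intro graph_with_action.intro connected_graph.intro
        graph_with_action_axioms.intro induced_graph_axioms.intro) (use g G H X in auto)
  interpret Y: graph_with_action G V' E' "\<psi>" by (rule graph_with_action_Y)
  let ?R = "graph_action ?K V E \<phi>" and ?S = "graph_action G V' E' \<psi>"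
  have "realization V E \<lesssim> (UNIV :: 'm set)"
    using realization_lepoll[OF _ subset_imp_lepoll[OF subset_UNIV] c] g(1)
    by (simp add: connected_simple_graph_def)
  then obtain i :: "('m \<Rightarrow> real) \<Rightarrow> 'm" where i: "inj_on i (points ?R)"
    by (auto simp: lepoll_def graph_action_def)
  have "cosets \<subseteq> (\<lambda>g. g <#\<^bsub>G\<^esub> H) ` carrier G" by (auto simp: LCOSETS_def)
  then have "cosets \<lesssim> (UNIV :: 'm set)" using lepoll_trans[OF subset_image_lepoll cG] by blast
  then have "V' \<lesssim> (UNIV :: 'm set)"
    unfolding Y_verts_def by (rule times_lepoll_infinite[OF infinite_m]) (simp add: subset_imp_lepoll)
  then have "realization V' E' \<lesssim> (UNIV :: 'm set)"
    using realization_lepoll[OF simple_graph_Y _ c] by blast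
  then obtain j :: "('g set \<times> 'm \<Rightarrow> real) \<Rightarrow> 'm" where j: "inj_on j (points ?S)"
    by (auto simp: lepoll_def graph_action_def)
  have R: "transport i ?R \<in> A"
    unfolding g(4)[symmetric] action_class_def
    using geodesic_action_transport[OF geodesic_graph_action i]
      equivalent_actions_transport[OF isometric_graph_action i] by simp
  have S: "transport j ?S \<in> Ind_wrt G H X A"
    unfolding Ind induced_action_eq action_class_def
    using geodesic_action_transport[OF Y.geodesic_graph_action j]
      equivalent_actions_transport[OF Y.isometric_graph_action j] by simp
  note iR = isometric_graph_action and iR' = isometric_action_transport[OF isometric_graph_action i]
  note iS = isometric_action_subgroup[OF Y.isometric_graph_action H]
  note iS' = isometric_action_subgroup[OF isometric_action_transport[OF Y.isometric_graph_action j] H]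
  have 1: "is_extension (carrier ?K) (transport i ?R) ?R"
    using equivalent_actions_imp_extension[OF equivalent_actions_sym[OF iR iR'
        equivalent_actions_transport[OF iR i]]] by simp
  have 2: "is_extension (carrier ?K) ?R ?S"
    using is_extension_induced_action[OF X(2)] by (simp add: induced_action_eq)
  have 3: "is_extension (carrier ?K) ?S (transport j ?S)"
    using equivalent_actions_imp_extension[OF equivalent_actions_transport[OF
        Y.isometric_graph_action j]] H_subset by simp
  have "is_extension (carrier ?K) (transport i ?R) (transport j ?S)"
    by (rule is_extension_trans[OF iR' iR iS' 1 is_extension_trans[OF iR iS iS' 2 3]])
  then show ?thesis unfolding class_extension_def using R S by auto
qed

text \<open>The hypothesis extends some member \<open>R3\<close> of the class of the relabelled
  hull, not the hull itself. The extension of \<open>R\<close> is the chain from \<open>R\<close>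
  into its hull, then to the relabelled hull, then by equivalence to \<open>R3\<close>, and finally
  to \<open>S\<close>.\<close>

lemma extension_problem_solvableI:
  assumes "\<And>A :: ('g, 'm) isoact set. A \<in> action_classes (G\<lparr>carrier := H\<rparr>) \<Longrightarrow>
    class_extension H A (Ind_wrt G H X A)"
  shows "extension_problem_solvable TYPE('m) G H"
  unfolding extension_problem_solvable_def
proof (intro allI impI)
  let ?K = "G\<lparr>carrier := H\<rparr>"
  fix R :: "('g, 'm) isoact" assume R: "isometric_action ?K R"
  interpret k: kuratowski_hull ?K R by unfold_locales (rule R)
  have "k.Hull \<lesssim> (UNIV :: 'm set)"
    by (rule k.hull_lepoll[OF _ real_lepoll]) (simp add: subset_imp_lepoll)
  then obtain j :: "('m \<Rightarrow> real) \<Rightarrow> 'm" where j: "inj_on j (points k.hull_action)"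
    by (auto simp: lepoll_def k.hull_action_def)
  let ?R1 = "k.hull_action" and ?R2 = "transport j k.hull_action"
  have g2: "geodesic_action ?K ?R2" by (rule geodesic_action_transport[OF k.geodesic_hull_action j])
  have i1: "isometric_action ?K ?R1" and i2: "isometric_action ?K ?R2"
    using k.geodesic_hull_action g2 by (auto simp: geodesic_action_def)
  define A where "A = (action_class ?K ?R2 :: ('g, 'm) isoact set)"
  have A: "A \<in> action_classes ?K" using g2 by (auto simp: A_def action_classes_def)
  obtain R3 S where R3: "R3 \<in> A" and S: "S \<in> Ind_wrt G H X A" and ext: "is_extension H R3 S"
    using assms[OF A] by (auto simp: class_extension_def)
  \<comment> \<open>Whatever data were chosen, \<open>Ind_wrt\<close> is an
    \<open>action_class\<close>, so its members are isometric actions of \<open>G\<close>.\<close>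
  obtain V :: "'m set" and E \<phi> t b where
    "Ind_wrt G H X A = action_class G (induced_action G H X V E \<phi> t b)"
    using Ind_wrtE[OF G H A cG infinite_m] by metis
  then have iS: "isometric_action G S"
    using S by (simp add: action_class_def geodesic_action_def)
  have i3: "isometric_action ?K R3" and e3: "equivalent_actions ?K ?R2 R3"
    using R3 by (auto simp: A_def action_class_def geodesic_action_def)
  note iS' = isometric_action_subgroup[OF iS H]
  have "is_extension (carrier ?K) ?R1 ?R2" "is_extension (carrier ?K) ?R2 R3"
    using equivalent_actions_imp_extension[OF equivalent_actions_transport[OF i1 j]]
      equivalent_actions_imp_extension[OF e3] by simp_all
  then have "is_extension (carrier ?K) R S"
    using is_extension_trans[OF R i1 iS' k.is_extension_hull_action]
      is_extension_trans[OF i1 i2 iS'] is_extension_trans[OF i2 i3 iS'] ext by simp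
  then show "\<exists>S :: ('g, 'm) isoact. isometric_action G S \<and> is_extension H R S"
    using iS by auto
qed

end

theorem theorem1p11:
  fixes G :: "'g monoid" and H :: "'g set"
  assumes "(UNIV :: nat set set) \<lesssim> (UNIV :: 'm set)"
    and "group G" and "carrier G \<lesssim> (UNIV :: 'm set)"
    and "subgroup H G"
    and "\<exists>X. finite X \<and> X \<subseteq> carrier G \<and> generate G (X \<union> H) = carrier G"
  shows "(extension_problem_solvable TYPE('m) G H
            \<longleftrightarrow> (\<forall>A \<in> (action_classes (G\<lparr>carrier := H\<rparr>) :: ('g, 'm) isoact set set).
                   class_extension H A (Ind G H A)))
       \<and> (extension_problem_solvable TYPE('m) G H \<longleftrightarrow> incompressible G H)"
proof -
  interpret group G by fact
  obtain X0 where X0: "finite X0" "X0 \<subseteq> carrier G" "generate G (X0 \<union> H) = carrier G"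
    using assms(5) by blast
  \<comment> \<open>\<open>rel_gen_set\<close> asks for a symmetric set, so the given generators are
    closed under inverses.\<close>
  let ?X1 = "X0 \<union> (\<lambda>x. inv\<^bsub>G\<^esub> x) ` X0"
  have "H \<subseteq> carrier G" using assms(4) by (rule subgroup.subset)
  then have "generate G (?X1 \<union> H) \<subseteq> carrier G" using X0(2) by (intro generate_incl) auto
  moreover have "carrier G \<subseteq> generate G (?X1 \<union> H)"
    using mono_generate[of "X0 \<union> H" "?X1 \<union> H"] X0(3) by auto
  ultimately have "finite ?X1 \<and> rel_gen_set G H ?X1"
    using X0 by (auto simp: rel_gen_set_def)
  then have ex: "\<exists>X. finite X \<and> rel_gen_set G H X" by blast
  define X where "X = (SOME X. finite X \<and> rel_gen_set G H X)"
  have X: "finite X" "rel_gen_set G H X" using someI_ex[OF ex] by (auto simp: X_def)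
  have Ind: "Ind G H A = Ind_wrt G H X A" for A :: "('g, 'm) isoact set"
    by (simp add: Ind_def X_def)
  have ac: "incompressible G H" if "extension_problem_solvable TYPE('m) G H"
    using extension_problem_solvable_imp_incompressible_wrt[OF assms(2,4) X(2,1) assms(3) that] X
    by (auto simp: incompressible_def)
  have cb: "class_extension H A (Ind G H A)"
    if "incompressible G H" "A \<in> action_classes (G\<lparr>carrier := H\<rparr>)" for A :: "('g, 'm) isoact set"
  proof -
    \<comment> \<open>Incompressibility supplies some finite relative generating set; it is
      transferred to the one fixed in \<open>Ind\<close>.\<close>
    have "incompressible_wrt G H X"
      using that(1) incompressible_wrt_finite[OF assms(2,4) _ _ X(2,1)] by (auto simp: incompressible_def)
    then show ?thesis
      unfolding Ind by (rule Ind_wrt_extension[OF assms(1-4) X(2) _ that(2)])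
  qed
  have ba: "extension_problem_solvable TYPE('m) G H"
    if "\<forall>A \<in> (action_classes (G\<lparr>carrier := H\<rparr>) :: ('g, 'm) isoact set set).
          class_extension H A (Ind G H A)"
    using extension_problem_solvableI[OF assms(1-4), of X] that unfolding Ind by blast
  show ?thesis using ac cb ba by blast
qed

end
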